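(* Let $N\ge2$. Assume that $V\in L^\infty(\mathbb{R}^N)$ satisfies $\lim_{|x|\to\infty}V(x)=V^\infty>0$, and that $p\in C(\mathbb{R}^N)$ satisfies $2<p^-:=\inf_{\mathbb{R}^N}p\le\sup_{\mathbb{R}^N}p=:p^+<2^*$ and $\lim_{|x|\to\infty}p(x)=p^\infty$. Then $J|_{\mathcal{M}}$ satisfies the Palais–Smale condition $(\mathrm{PS})_c$ for all $c\in\mathbb{R}$ with $$c<\left(\frac{p^-}{p^\infty}\right)^{2/p^\infty}\lambda_1^\infty.$$
   Context: All functions are real valued. $2^*=2N/(N-2)$ if $N\ge3$ and $2^*=\infty$ if $N=2$. For $u\in H^1(\mathbb{R}^N)$ set $$J(u)=\int_{\mathbb{R}^N}\left(|\nabla u|^2+V(x)u^2\right)dx,\qquad I(u)=\inf\Big\{\gamma>0:\int_{\mathbb{R}^N}\Big|\frac{u(x)}{\gamma}\Big|^{p(x)}\frac{dx}{p(x)}\le1\Big\},$$ and $\mathcal{M}=\{u\in H^1(\mathbb{R}^N): I(u)=1\}$. Also set $$J^\infty(u)=\int_{\mathbb{R}^N}\left(|\nabla u|^2+V^\infty u^2\right)dx,\qquad I^\infty(u)=\left[\int_{\mathbb{R}^N}|u(x)|^{p^\infty}\frac{dx}{p^\infty}\right]^{1/p^\infty},$$ $\mathcal{M}^\infty=\{u\in H^1(\mathbb{R}^N): I^\infty(u)=1\}$ and $\lambda_1^\infty=\inf_{u\in\mathcal{M}^\infty}J^\infty(u)>0$. The functional $I$ is $C^1$ on $H^1(\mathbb{R}^N)\setminus\{0\}$,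 and for $u\in\mathcal{M}$ one has $\langle I'(u),v\rangle=\int_{\mathbb{R}^N}|u|^{p(x)-2}uv\,dx\Big/\int_{\mathbb{R}^N}|u|^{p(x)}dx$; $\mathcal{M}$ is a $C^1$ Hilbert manifold. A $(\mathrm{PS})_c$-sequence for $J|_{\mathcal{M}}$ is a sequence $(u_k)$ in $\mathcal{M}$ such that $J(u_k)\to c$ and $(J|_{\mathcal{M}})'(u_k)\to0$; the latter means that there are $\mu_k\in\mathbb{R}$ with $J'(u_k)-\mu_kI'(u_k)\to0$ in $H^{-1}(\mathbb{R}^N)$, the dual of $H^1(\mathbb{R}^N)$. $J|_{\mathcal{M}}$ satisfies $(\mathrm{PS})_c$ if every $(\mathrm{PS})_c$-sequence has a subsequence converging strongly in $H^1(\mathbb{R}^N)$. *)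

theory Defs
  imports "HOL-Analysis.Analysis"
begin

text \<open>Elements of \<open>L\<^sup>\<infinity>\<close> and \<open>H\<^sup>1\<close> are represented by Lebesgue measurable functions rather than
  by classes of functions. All notions below are invariant under changes on null sets.\<close>

subsection \<open>The Sobolev space \<open>H\<^sup>1\<close>\<close>

primrec C_k :: "nat \<Rightarrow> ('a::euclidean_space \<Rightarrow> real) \<Rightarrow> bool" where
  "C_k 0 f \<longleftrightarrow> continuous_on UNIV f"
| "C_k (Suc k) f \<longleftrightarrow> (\<forall>x. f differentiable (at x)) \<and>
     (\<forall>b\<in>Basis. C_k k (\<lambda>x. frechet_derivative f (at x) b))"

definition test_function :: "('a::euclidean_space \<Rightarrow> real) \<Rightarrow> bool" where
  "test_function \<phi> \<longleftrightarrow> (\<forall>k. C_k k \<phi>) \<and> compact (closure {x. \<phi> x \<noteq> 0})"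

definition weak_gradient ::
    "('a::euclidean_space \<Rightarrow> real) \<Rightarrow> ('a \<Rightarrow> 'a) \<Rightarrow> bool" where
  "weak_gradient u g \<longleftrightarrow>
     (\<forall>K. compact K \<longrightarrow> u absolutely_integrable_on K \<and> g absolutely_integrable_on K) \<and>
     (\<forall>\<phi>. test_function \<phi> \<longrightarrow> (\<forall>b\<in>Basis.
        (LINT x|lebesgue. u x * frechet_derivative \<phi> (at x) b) =
        - (LINT x|lebesgue. (g x \<bullet> b) * \<phi> x)))"

text \<open>A weak gradient is unique up to null sets, so any choice will do.\<close>

definition grad :: "('a::euclidean_space \<Rightarrow> real) \<Rightarrow> 'a \<Rightarrow> 'a" where
  "grad u = (SOME g. weak_gradient u g)"

definition H1 :: "('a::euclidean_space \<Rightarrow> real) set" where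
  "H1 = {u. u \<in> borel_measurable lebesgue \<and> integrable lebesgue (\<lambda>x. (u x)\<^sup>2) \<and>
     (\<exists>g. weak_gradient u g \<and> integrable lebesgue (\<lambda>x. (norm (g x))\<^sup>2))}"

definition H1_norm :: "('a::euclidean_space \<Rightarrow> real) \<Rightarrow> real" where
  "H1_norm u = sqrt (LINT x|lebesgue. (norm (grad u x))\<^sup>2 + (u x)\<^sup>2)"

text \<open>Since \<open>H1\<close> is a set of functions and not a type, bounded linear functionals, their norm
  in \<open>H\<^sup>-\<^sup>1\<close> and Frechet derivatives are spelled out relative to \<open>H1\<close>. Boundedness forces a
  functional to respect equality almost everywhere.\<close>

definition H1_functional :: "(('a::euclidean_space \<Rightarrow> real) \<Rightarrow> real) \<Rightarrow> bool" where
  "H1_functional L \<longleftrightarrow>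
     (\<forall>u\<in>H1. \<forall>v\<in>H1. L (\<lambda>x. u x + v x) = L u + L v) \<and>
     (\<forall>u\<in>H1. \<forall>a. L (\<lambda>x. a * u x) = a * L u) \<and>
     (\<exists>B. \<forall>u\<in>H1. \<bar>L u\<bar> \<le> B * H1_norm u)"

definition dual_norm :: "(('a::euclidean_space \<Rightarrow> real) \<Rightarrow> real) \<Rightarrow> real" where
  "dual_norm L = (SUP v\<in>{v \<in> H1. H1_norm v \<le> 1}. \<bar>L v\<bar>)"

definition has_H1_derivative ::
    "(('a::euclidean_space \<Rightarrow> real) \<Rightarrow> real) \<Rightarrow> (('a \<Rightarrow> real) \<Rightarrow> real) \<Rightarrow> ('a \<Rightarrow> real) \<Rightarrow> bool"
  where
  "has_H1_derivative F L u \<longleftrightarrow> H1_functional L \<and>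
     (\<forall>e>0. \<exists>d>0. \<forall>h\<in>H1. H1_norm h < d \<longrightarrow>
        \<bar>F (\<lambda>x. u x + h x) - F u - L h\<bar> \<le> e * H1_norm h)"

subsection \<open>Assumptions on the data\<close>

definition L_infinity :: "('a::euclidean_space \<Rightarrow> real) set" where
  "L_infinity = {V. V \<in> borel_measurable lebesgue \<and> (\<exists>C. AE x in lebesgue. \<bar>V x\<bar> \<le> C)}"

text \<open>The limit at infinity of an \<open>L\<^sup>\<infinity>\<close> function, which is only defined up to null sets.\<close>

definition ess_tendsto_at_infinity :: "('a::euclidean_space \<Rightarrow> real) \<Rightarrow> real \<Rightarrow> bool" where
  "ess_tendsto_at_infinity V l \<longleftrightarrow>
     (\<forall>e>0. \<exists>R. AE x in lebesgue. R \<le> norm x \<longrightarrow> \<bar>V x - l\<bar> < e)"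

definition critical_exponent :: "nat \<Rightarrow> ereal" where
  "critical_exponent N = (if N \<le> 2 then \<infinity> else ereal (2 * real N / (real N - 2)))"

subsection \<open>The functionals\<close>

definition J :: "('a::euclidean_space \<Rightarrow> real) \<Rightarrow> ('a \<Rightarrow> real) \<Rightarrow> real" where
  "J V u = (LINT x|lebesgue. (norm (grad u x))\<^sup>2 + V x * (u x)\<^sup>2)"

text \<open>The nonnegative integral makes a divergent integral count as \<open>\<infinity>\<close>, whereas the Bochner
  integral would be \<open>0\<close>.\<close>

definition I :: "('a::euclidean_space \<Rightarrow> real) \<Rightarrow> ('a \<Rightarrow> real) \<Rightarrow> real" where
  "I p u = Inf {\<gamma>::real. \<gamma> > 0 \<and>
     (\<integral>\<^sup>+ x. ennreal (\<bar>u x / \<gamma>\<bar> powr p x / p x) \<partial>lebesgue) \<le> 1}"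

definition M :: "('a::euclidean_space \<Rightarrow> real) \<Rightarrow> ('a \<Rightarrow> real) set" where
  "M p = {u \<in> H1. I p u = 1}"

definition J_inf :: "real \<Rightarrow> ('a::euclidean_space \<Rightarrow> real) \<Rightarrow> real" where
  "J_inf Vinf u = (LINT x|lebesgue. (norm (grad u x))\<^sup>2 + Vinf * (u x)\<^sup>2)"

definition I_inf :: "real \<Rightarrow> ('a::euclidean_space \<Rightarrow> real) \<Rightarrow> real" where
  "I_inf pinf u = (LINT x|lebesgue. \<bar>u x\<bar> powr pinf / pinf) powr (1 / pinf)"

definition M_inf :: "real \<Rightarrow> ('a::euclidean_space \<Rightarrow> real) set" where
  "M_inf pinf = {u \<in> H1. I_inf pinf u = 1}"

text \<open>The type argument selects the underlying Euclidean space.\<close>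

definition lambda1_inf :: "'a::euclidean_space itself \<Rightarrow> real \<Rightarrow> real \<Rightarrow> real" where
  "lambda1_inf _ Vinf pinf = (INF u\<in>(M_inf pinf :: ('a \<Rightarrow> real) set). J_inf Vinf u)"

subsection \<open>The Palais--Smale condition\<close>

definition PS_sequence ::
    "('a::euclidean_space \<Rightarrow> real) \<Rightarrow> ('a \<Rightarrow> real) \<Rightarrow> real \<Rightarrow> (nat \<Rightarrow> 'a \<Rightarrow> real) \<Rightarrow> bool" where
  "PS_sequence V p c u \<longleftrightarrow>
     (\<forall>k. u k \<in> M p) \<and> (\<lambda>k. J V (u k)) \<longlonglongrightarrow> c \<and>
     (\<exists>\<mu> DJ DI. (\<forall>k. has_H1_derivative (J V) (DJ k) (u k) \<and>
                     has_H1_derivative (I p) (DI k) (u k)) \<and>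
        (\<lambda>k. dual_norm (\<lambda>v. DJ k v - \<mu> k * DI k v)) \<longlonglongrightarrow> 0)"

definition PS_condition ::
    "('a::euclidean_space \<Rightarrow> real) \<Rightarrow> ('a \<Rightarrow> real) \<Rightarrow> real \<Rightarrow> bool" where
  "PS_condition V p c \<longleftrightarrow> (\<forall>u. PS_sequence V p c u \<longrightarrow>
     (\<exists>r w. strict_mono r \<and> w \<in> H1 \<and>
        (\<lambda>k. H1_norm (\<lambda>x. u (r k) x - w x)) \<longlonglongrightarrow> 0))"

end

theory Submission
  imports Defs "HOL-Complex_Analysis.Great_Picard"
begin

text \<open>A Palais--Smale sequence \<open>u\<close> is bounded in \<open>H\<^sup>1\<close>: the potential is positive
  outside a ball, and inside the ball the constraint controls \<open>u\<^sup>2\<close> (\<open>coercive_on_M\<close>). Along a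
  subsequence \<open>u\<close> converges weakly and almost everywhere to some \<open>w\<close>
  (\<open>H1_weak_compactness\<close>). Put \<open>v = u - w\<close>. Testing the equation \<open>J'(u) - \<mu> I'(u) \<rightarrow> 0\<close> with \<open>u\<close>
  gives \<open>\<mu> \<rightarrow> 2 c\<close>; testing it with \<open>v\<close> gives, up to vanishing terms,
  \<open>J\<^sup>\<infinity>(v) = c Y / A\<close>, where \<open>A\<close> is the integral of \<open>|u|\<^sup>p\<close> and \<open>Y\<close> that of \<open>|v|\<close> to the power
  \<open>pinf\<close>. Indeed \<open>v\<close> contributes nothing on bounded sets, and far away \<open>V\<close> and \<open>p\<close> are close to their limits; and the
  nonlinear term splits into a part that sees only \<open>v\<close> and a part that sees only \<open>w\<close>
  (\<open>potential_term_vanishes\<close>, \<open>exponent_term_vanishes\<close>, \<open>nonlinear_term_splitting\<close>). By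
  homogeneity \<open>J\<^sup>\<infinity>(v)\<close> is at least \<open>\<lambda>\<^sub>1\<^sup>\<infinity> (Y / pinf) powr (2 / pinf)\<close>; since \<open>Y \<le> A\<close>, \<open>A\<close> is at
  least \<open>inf p\<close> on the constraint, and \<open>2 / pinf < 1\<close>, a positive limit of \<open>Y\<close> would force
  \<open>c \<ge> (inf p / pinf) powr (2 / pinf) \<lambda>\<^sub>1\<^sup>\<infinity>\<close> (\<open>energy_threshold\<close>). Hence \<open>Y\<close>, and with it \<open>J\<^sup>\<infinity>(v)\<close> and the
  \<open>H\<^sup>1\<close> norm of \<open>v\<close>, tends to zero.

  The functional analysis behind this rests on one inequality, \<open>translation_estimate\<close>: translating
  a Sobolev function by \<open>w\<close> changes it in \<open>L\<^sup>2\<close> by at most \<open>|w|\<close> times the norm of its gradient. It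
  shows that averages over balls of radius \<open>h\<close> approximate the function in \<open>L\<^sup>2\<close> at rate \<open>h\<close> and are
  Lipschitz continuous with a constant of order \<open>h powr (- N / 2)\<close>. Comparing dyadic radii
  yields the embedding into \<open>L\<^sup>q\<close> below the critical exponent (\<open>sobolev_embedding\<close>), and a
  diagonal argument for the averages yields almost everywhere convergent subsequences
  (\<open>bounded_sobolev_ae_convergent_subsequence\<close>). The weak limit of the gradients is obtained as a
  strong limit of arithmetic means (\<open>banach_saks_L2\<close>). All limits of integrals that remain are
  instances of \<open>integral_tendsto_0_epsilon_dominated\<close>, which asks for convergence almost everywhere
  only; uniform bounds in \<open>L\<^sup>q\<close> with an exponent above \<open>sup p\<close> take the place of strong local
  convergence.\<close>

section \<open>Test functions and the fundamental lemma of the calculus of variations\<close>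

lemma C_k_SucI:
  assumes "\<And>x. (f has_derivative f' x) (at x)"
    and "\<And>b. b \<in> Basis \<Longrightarrow> C_k k (\<lambda>x. f' x b)"
  shows "C_k (Suc k) f"
proof -
  have "frechet_derivative f (at x) = f' x" for x
    using frechet_derivative_at[OF assms(1)] by simp
  then show ?thesis
    using assms by (auto simp: differentiable_def)
qed

lemma C_k_Suc_imp_C_k: "C_k (Suc k) f \<Longrightarrow> C_k k f"
proof (induction k arbitrary: f)
  case 0
  then show ?case
    by (simp add: continuous_on_eq_continuous_within differentiable_imp_continuous_within)
next
  case (Suc k)
  then show ?case by simp
qed

lemma C_k_const: "C_k k (\<lambda>x. c)"
proof (induction k arbitrary: c)
  case (Suc k)
  show ?case by (rule C_k_SucI[where f' = "\<lambda>x h. 0"]) (auto intro: Suc.IH)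
qed simp

lemma C_k_add: "C_k k f \<Longrightarrow> C_k k g \<Longrightarrow> C_k k (\<lambda>x. f x + g x)"
proof (induction k arbitrary: f g)
  case 0
  then show ?case by (simp add: continuous_on_add continuous_on_mult)
next
  case (Suc k)
  let ?f = "\<lambda>x. frechet_derivative f (at x)" and ?g = "\<lambda>x. frechet_derivative g (at x)"
  have "(f has_derivative ?f x) (at x)" "(g has_derivative ?g x) (at x)" for x
    using Suc.prems by (auto simp: frechet_derivative_works)
  moreover have "C_k k (\<lambda>x. ?f x b + ?g x b)" if "b \<in> Basis" for b
    using Suc.prems that by (intro Suc.IH) auto
  ultimately show ?case
    by (intro C_k_SucI[where f' = "\<lambda>x h. ?f x h + ?g x h"]) (auto intro: has_derivative_add)
qed

lemma C_k_mult: "C_k k f \<Longrightarrow> C_k k g \<Longrightarrow> C_k k (\<lambda>x. f x * g x)"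
proof (induction k arbitrary: f g)
  case 0
  then show ?case by (simp add: continuous_on_add continuous_on_mult)
next
  case (Suc k)
  let ?f = "\<lambda>x. frechet_derivative f (at x)" and ?g = "\<lambda>x. frechet_derivative g (at x)"
  have "(f has_derivative ?f x) (at x)" "(g has_derivative ?g x) (at x)" for x
    using Suc.prems by (auto simp: frechet_derivative_works)
  moreover have "C_k k f" "C_k k g"
    using Suc.prems C_k_Suc_imp_C_k by blast+
  then have "C_k k (\<lambda>x. f x * ?g x b + ?f x b * g x)" if "b \<in> Basis" for b
    using Suc.prems that by (intro C_k_add Suc.IH) auto
  ultimately show ?case
    by (intro C_k_SucI[where f' = "\<lambda>x h. f x * ?g x h + ?f x h * g x"])
      (auto intro: has_derivative_mult)
qed

lemma C_k_prod:
  "finite S \<Longrightarrow> (\<And>i. i \<in> S \<Longrightarrow> C_k k (f i)) \<Longrightarrow> C_k k (\<lambda>x. \<Prod>i\<in>S. f i x)"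
  by (induction S rule: finite_induct) (auto intro: C_k_const C_k_mult)

text \<open>The derivative of each function of this family is a linear combination of two others; this is
  what makes all of them smooth.\<close>

definition flat_exp :: "nat \<Rightarrow> real \<Rightarrow> real" where
  "flat_exp n t = (if t > 0 then exp (- 1 / t) / t ^ n else 0)"

lemma flat_exp_tendsto_0: "(flat_exp n \<longlongrightarrow> 0) (at 0)"
proof -
  have "((\<lambda>t::real. (inverse t) ^ n / exp (inverse t)) \<longlongrightarrow> 0) (at_right 0)"
    by (rule filterlim_compose[OF tendsto_power_div_exp_0 filterlim_inverse_at_top_right])
  then have "(flat_exp n \<longlongrightarrow> 0) (at_right 0)"
    by (rule Lim_transform_eventually)
      (auto simp: flat_exp_def exp_minus field_simps eventually_at_filter)
  moreover have "(flat_exp n \<longlongrightarrow> 0) (at_left 0)"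
    by (rule tendsto_eventually) (auto simp: flat_exp_def eventually_at_filter)
  ultimately show ?thesis by (simp add: filterlim_at_split)
qed

lemma flat_exp_has_real_derivative:
  "(flat_exp n has_real_derivative (flat_exp (n + 2) t - n * flat_exp (n + 1) t)) (at t)"
proof -
  consider "t > 0" | "t < 0" | "t = 0" by linarith
  then show ?thesis
  proof cases
    case 1
    have "((\<lambda>t. exp (- 1 / t) / t ^ n) has_real_derivative
        (exp (- 1 / t) * (1 / t\<^sup>2) * t ^ n - exp (- 1 / t) * (n * t ^ (n - Suc 0)))
          / (t ^ n * t ^ n)) (at t)"
      using 1 by (auto intro!: derivative_eq_intros simp: power2_eq_square)
    also have "(exp (- 1 / t) * (1 / t\<^sup>2) * t ^ n - exp (- 1 / t) * (n * t ^ (n - Suc 0)))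
          / (t ^ n * t ^ n) = exp (- 1 / t) / t ^ (n + 2) - n * (exp (- 1 / t) / t ^ (n + 1))"
      using 1 by (cases n) (simp_all add: field_simps power2_eq_square)
    finally have "((\<lambda>t. exp (- 1 / t) / t ^ n) has_real_derivative
        (flat_exp (n + 2) t - n * flat_exp (n + 1) t)) (at t)"
      using 1 by (simp add: flat_exp_def)
    then show ?thesis
      by (rule has_field_derivative_transform_within_open[where S = "{0<..}"])
        (use 1 in \<open>auto simp: flat_exp_def\<close>)
  next
    case 2
    have "((\<lambda>t. 0) has_real_derivative (flat_exp (n + 2) t - n * flat_exp (n + 1) t)) (at t)"
      using 2 by (simp add: flat_exp_def)
    then show ?thesis
      by (rule has_field_derivative_transform_within_open[where S = "{..<0}"])
        (use 2 in \<open>auto simp: flat_exp_def\<close>)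
  next
    case 3
    have "((\<lambda>h. (flat_exp n (0 + h) - flat_exp n 0) / h) \<longlongrightarrow> 0) (at 0)"
      by (rule Lim_transform_eventually[OF flat_exp_tendsto_0[of "n + 1"]])
        (auto simp: flat_exp_def eventually_at_filter field_simps)
    then have "(flat_exp n has_real_derivative 0) (at 0)" by (simp only: DERIV_def)
    then show ?thesis using 3 by (simp add: flat_exp_def)
  qed
qed

lemma C_k_flat_exp: "C_k k (\<lambda>x. flat_exp n (x \<bullet> v + c))"
proof (induction k arbitrary: n)
  case 0
  have "continuous_on UNIV (flat_exp n)"
    by (rule DERIV_continuous_on) (rule flat_exp_has_real_derivative)
  then have "continuous_on UNIV (flat_exp n \<circ> (\<lambda>x. x \<bullet> v + c))"
    by (intro continuous_on_compose continuous_intros) (auto intro: continuous_on_subset)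
  then show ?case by (simp add: o_def)
next
  case (Suc k)
  let ?D = "\<lambda>x. flat_exp (n + 2) (x \<bullet> v + c) + (- real n) * flat_exp (n + 1) (x \<bullet> v + c)"
  show ?case
  proof (rule C_k_SucI[where f' = "\<lambda>x h. (h \<bullet> v) * ?D x"])
    fix x
    have "((\<lambda>x. x \<bullet> v + c) has_derivative (\<lambda>h. h \<bullet> v)) (at x)"
      by (auto intro!: derivative_eq_intros)
    from has_derivative_compose[OF this
        flat_exp_has_real_derivative[of n "x \<bullet> v + c", unfolded has_field_derivative_def]]
    show "((\<lambda>x. flat_exp n (x \<bullet> v + c)) has_derivative (\<lambda>h. (h \<bullet> v) * ?D x)) (at x)"
      by (simp add: mult.commute)
  next
    fix b :: 'a
    show "C_k k (\<lambda>x. (b \<bullet> v) * ?D x)"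
      by (intro C_k_mult C_k_add C_k_const Suc.IH)
  qed
qed

text \<open>Replacing the argument of the flat exponential by its \<open>n\<close>-fold keeps the support and drives the
  values inside the box to \<open>1\<close>.\<close>

definition box_bump :: "nat \<Rightarrow> 'a::euclidean_space \<Rightarrow> 'a \<Rightarrow> 'a \<Rightarrow> real" where
  "box_bump n a b x = (\<Prod>i\<in>Basis.
     flat_exp 0 (real n * ((x - a) \<bullet> i)) * flat_exp 0 (real n * ((b - x) \<bullet> i)))"

lemma flat_exp_bounds: "0 \<le> flat_exp 0 t" "flat_exp 0 t \<le> 1"
  by (auto simp: flat_exp_def)

lemma box_bump_bounds: "0 \<le> box_bump n a b x" "box_bump n a b x \<le> 1"
  unfolding box_bump_def
  by (auto intro!: prod_nonneg prod_le_1 mult_le_one flat_exp_bounds mult_nonneg_nonneg)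

lemma box_bump_eq_0: "x \<notin> box a b \<Longrightarrow> box_bump n a b x = 0"
  by (force simp: box_bump_def flat_exp_def mem_box inner_diff_left zero_less_mult_iff)

lemma box_bump_tendsto_indicator: "(\<lambda>n. box_bump n a b x) \<longlonglongrightarrow> indicator (box a b) x"
proof (cases "x \<in> box a b")
  case True
  have *: "(\<lambda>n. flat_exp 0 (real n * t)) \<longlonglongrightarrow> 1" if "t > 0" for t
  proof -
    have "(\<lambda>n. exp (- (1 / t) * (1 / real n))) \<longlonglongrightarrow> exp (- (1 / t) * 0)"
      by (intro tendsto_intros lim_1_over_n)
    then have "(\<lambda>n. exp (- (1 / t) * (1 / real n))) \<longlonglongrightarrow> 1" by simp
    then show ?thesis
      by (rule Lim_transform_eventually)
        (use that in \<open>auto simp: flat_exp_def field_simps intro!: eventually_sequentiallyI[of 1]\<close>)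
  qed
  have "(\<lambda>n. box_bump n a b x) \<longlonglongrightarrow> (\<Prod>i\<in>(Basis :: 'a set). 1 * 1)"
    unfolding box_bump_def
    by (intro tendsto_intros *) (use True in \<open>auto simp: mem_box inner_diff_left\<close>)
  then show ?thesis using True by simp
qed (simp add: box_bump_eq_0)

lemma test_function_box_bump: "test_function (box_bump n a b)"
  unfolding test_function_def
proof (intro conjI allI)
  fix k
  have "C_k k (\<lambda>x. \<Prod>i\<in>Basis. flat_exp 0 (x \<bullet> (real n *\<^sub>R i) + - (real n * (a \<bullet> i))) *
      flat_exp 0 (x \<bullet> (- real n *\<^sub>R i) + real n * (b \<bullet> i)))"
    by (intro C_k_prod C_k_mult C_k_flat_exp) auto
  then show "C_k k (box_bump n a b)"
    by (simp add: box_bump_def[abs_def] algebra_simps)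
next
  have "{x. box_bump n a b x \<noteq> 0} \<subseteq> box a b"
    using box_bump_eq_0 by blast
  then show "compact (closure {x. box_bump n a b x \<noteq> 0})"
    by (meson bounded_box bounded_subset compact_closure)
qed

text \<open>The fundamental lemma of the calculus of variations. Boxes are bounded pointwise limits of
  test functions, so the function has integral zero over every box; boxes generate the Borel
  sets and are stable under intersection, so it vanishes almost everywhere.\<close>

lemma fundamental_lemma_borel:
  fixes f :: "'a::euclidean_space \<Rightarrow> real"
  assumes [measurable]: "f \<in> borel_measurable borel"
    and loc: "\<And>K. compact K \<Longrightarrow> integrable lborel (\<lambda>x. indicator K x * f x)"
    and zero: "\<And>\<phi>. test_function \<phi> \<Longrightarrow> (LINT x|lborel. f x * \<phi> x) = 0"
  shows "AE x in lborel. f x = 0"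
proof -
  have loc_box: "integrable lborel (\<lambda>x. indicator (box a b) x * f x)" for a b
    by (rule Bochner_Integration.integrable_bound[OF loc[OF compact_cbox[of a b]]])
      (auto simp: indicator_def box_subset_cbox[THEN subsetD])
  have box0: "(LINT x|lborel. indicator (box a b) x * f x) = 0" for a b
  proof -
    have "(\<lambda>n. LINT x|lborel. f x * box_bump n a b x) \<longlonglongrightarrow>
        (LINT x|lborel. indicator (box a b) x * f x)"
    proof (rule integral_dominated_convergence[where w = "\<lambda>x. \<bar>indicator (box a b) x * f x\<bar>"])
      have "continuous_on UNIV (box_bump n a b)" for n
        using test_function_box_bump[of n a b] unfolding test_function_def
        by (metis C_k.simps(1))
      then have [measurable]: "box_bump n a b \<in> borel_measurable borel" for n
        by (intro borel_measurable_continuous_onI)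
      show "(\<lambda>x. f x * box_bump n a b x) \<in> borel_measurable lborel" for n
        by measurable
      show "AE x in lborel. (\<lambda>n. f x * box_bump n a b x) \<longlonglongrightarrow> indicator (box a b) x * f x"
        using tendsto_mult[OF tendsto_const box_bump_tendsto_indicator]
        by (intro AE_I2) (simp add: mult.commute)
      show "AE x in lborel. norm (f x * box_bump n a b x) \<le> \<bar>indicator (box a b) x * f x\<bar>" for n
        using box_bump_bounds[of n a b] box_bump_eq_0[of _ a b n]
        by (auto simp: indicator_def abs_mult mult_left_le)
    qed (use loc_box in auto)
    moreover have "(LINT x|lborel. f x * box_bump n a b x) = 0" for n
      by (rule zero[OF test_function_box_bump])
    ultimately show ?thesis by (simp add: LIMSEQ_const_iff)
  qed
  have "AE x in lborel. indicator (box (- real m *\<^sub>R One) (real m *\<^sub>R One)) x * f x = 0" for m :: nat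
  proof (rule density_unique_real)
    let ?Q = "box (- real m *\<^sub>R One) (real m *\<^sub>R One) :: 'a set"
    let ?g = "\<lambda>x. indicator ?Q x * f x"
    show g: "integrable lborel ?g" by (rule loc_box)
    have g': "integrable lborel (\<lambda>x. indicator A x * ?g x)" if "A \<in> sets borel" for A
      using integrable_mult_indicator[OF _ g, of A] that by simp
    fix A :: "'a set" assume "A \<in> sets lborel"
    then have A: "A \<in> sigma_sets UNIV (range (\<lambda>(a, b). box a b))"
      by (simp add: borel_eq_box)
    have stable: "Int_stable (range (\<lambda>(a, b). box a b :: 'a set))"
      by (auto simp: Int_stable_def box_Int_box)
    have closed: "range (\<lambda>(a, b). box a b :: 'a set) \<subseteq> Pow UNIV" by simp
    from stable closed A have "(LINT x|lborel. indicator A x * ?g x) = 0"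
    proof (induction A rule: sigma_sets_induct_disjoint)
      case (basic A)
      then obtain a b where A: "A = box a b" by auto
      have "\<exists>c d. box a b \<inter> ?Q = box c d"
        unfolding box_Int_box by blast
      then obtain c d where "A \<inter> ?Q = box c d" by (auto simp: A)
      then have "indicator A x * ?g x = indicator (box c d) x * f x" for x
        by (metis indicator_inter_arith mult.assoc)
      then show ?case by (simp only: box0)
    next
      case (compl A)
      then have A: "A \<in> sets borel" by (simp add: borel_eq_box)
      have "(\<lambda>x. indicator (UNIV - A) x * ?g x) = (\<lambda>x. ?g x - indicator A x * ?g x)"
        by (auto simp: indicator_def)
      then show ?case using g g'[OF A] compl box0 by simp
    next
      case (union A)
      then have A[measurable]: "A i \<in> sets borel" for i by (auto simp: borel_eq_box)
      have "(LINT x|lborel. indicator (\<Union>i. A i) x *\<^sub>R ?g x) =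
          (\<Sum>i. LINT x|lborel. indicator (A i) x *\<^sub>R ?g x)"
        using lebesgue_integral_countable_add[of A lborel ?g] union(1) g'[of "\<Union>i. A i"]
        by (auto simp: disjoint_family_on_def set_lebesgue_integral_def set_integrable_def)
      then show ?case using union by simp
    qed simp
    then show "(LINT x:A|lborel. ?g x) = (LINT x:A|lborel. 0)"
      by (simp add: set_lebesgue_integral_def)
  qed simp
  then have "AE x in lborel. \<forall>m. indicator (box (- real m *\<^sub>R One) (real m *\<^sub>R One)) x * f x = 0"
    unfolding AE_all_countable by blast
  then show ?thesis
  proof (rule AE_mp, intro AE_I2 impI)
    fix x :: 'a
    assume *: "\<forall>m. indicator (box (- real m *\<^sub>R One) (real m *\<^sub>R One)) x * f x = 0"
    have "x \<in> (\<Union>m::nat. box (- (real m *\<^sub>R One)) (real m *\<^sub>R One))"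
      by (simp add: UN_box_eq_UNIV)
    then obtain m :: nat where "x \<in> box (- real m *\<^sub>R One) (real m *\<^sub>R One)"
      by auto
    then show "f x = 0" using *[rule_format, of m] by simp
  qed
qed

section \<open>Tools for test functions, square integrable functions and Fubini\<close>

lemma C_k_shift: "C_k k f \<Longrightarrow> C_k k (\<lambda>x. f (x - c))"
proof (induction k arbitrary: f)
  case 0
  then have "continuous_on UNIV (f \<circ> (\<lambda>x. x - c))"
    by (intro continuous_on_compose continuous_intros) (auto intro: continuous_on_subset)
  then show ?case by (simp add: o_def)
next
  case (Suc k)
  show ?case
  proof (rule C_k_SucI)
    fix x
    have "(f has_derivative frechet_derivative f (at (x - c))) (at (x - c))"
      using Suc.prems by (simp add: frechet_derivative_works[symmetric])
    then show "((\<lambda>x. f (x - c)) has_derivative frechet_derivative f (at (x - c))) (at x)"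
      by (rule has_derivative_compose[rotated]) (auto intro!: derivative_eq_intros)
  qed (use Suc in auto)
qed

lemma test_function_has_derivative:
  assumes "test_function \<phi>"
  shows "(\<phi> has_derivative frechet_derivative \<phi> (at x)) (at x)"
proof -
  have "C_k (Suc 0) \<phi>"
    using assms by (simp only: test_function_def)
  then show ?thesis
    by (simp add: frechet_derivative_works[symmetric])
qed

lemma test_function_continuous: "test_function \<phi> \<Longrightarrow> continuous_on UNIV \<phi>"
  unfolding test_function_def by (metis C_k.simps(1))

lemma frechet_derivative_basis_expansion:
  assumes "test_function \<phi>"
  shows "frechet_derivative \<phi> (at x) w = (\<Sum>b\<in>Basis. (w \<bullet> b) * frechet_derivative \<phi> (at x) b)"
proof -
  have "linear (frechet_derivative \<phi> (at x))"
    using test_function_has_derivative[OF assms] by (rule has_derivative_linear)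
  then have "frechet_derivative \<phi> (at x) (\<Sum>b\<in>Basis. (w \<bullet> b) *\<^sub>R b) =
      (\<Sum>b\<in>Basis. (w \<bullet> b) * frechet_derivative \<phi> (at x) b)"
    by (simp add: linear_sum linear_cmul)
  then show ?thesis by (simp add: euclidean_representation)
qed

lemma test_function_derivative_continuous:
  assumes "test_function \<phi>"
  shows "continuous_on UNIV (\<lambda>x. frechet_derivative \<phi> (at x) w)"
proof -
  have "C_k (Suc 0) \<phi>"
    using assms by (simp only: test_function_def)
  then have "\<forall>b\<in>Basis. continuous_on UNIV (\<lambda>x. frechet_derivative \<phi> (at x) b)"
    by simp
  then show ?thesis
    unfolding frechet_derivative_basis_expansion[OF assms, of _ w]
    by (intro continuous_intros) auto
qed

lemma frechet_derivative_shift: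
  assumes "test_function \<phi>"
  shows "frechet_derivative (\<lambda>x. \<phi> (x - c)) (at x) = frechet_derivative \<phi> (at (x - c))"
proof -
  have "((\<lambda>x. \<phi> (x - c)) has_derivative frechet_derivative \<phi> (at (x - c))) (at x)"
    by (rule has_derivative_compose[OF _ test_function_has_derivative[OF assms]])
      (auto intro!: derivative_eq_intros)
  then show ?thesis by (rule frechet_derivative_at[symmetric])
qed

lemma test_function_support:
  assumes "test_function \<phi>"
  shows "\<exists>R. (\<forall>x. \<phi> x \<noteq> 0 \<longrightarrow> norm x \<le> R) \<and>
    (\<forall>x w. frechet_derivative \<phi> (at x) w \<noteq> 0 \<longrightarrow> norm x \<le> R)"
proof -
  have "compact (closure {x. \<phi> x \<noteq> 0})"
    using assms by (simp only: test_function_def)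
  then obtain R where R: "R > 0" "\<And>x. x \<in> closure {x. \<phi> x \<noteq> 0} \<Longrightarrow> norm x \<le> R"
    using compact_imp_bounded bounded_pos by metis
  have "frechet_derivative \<phi> (at x) w = 0" if "norm x > R" for x w
  proof -
    let ?S = "- closure {x. \<phi> x \<noteq> 0}"
    have eq: "0 = \<phi> y" if "y \<in> ?S" for y
      using that closure_subset[of "{x. \<phi> x \<noteq> 0}"] by auto
    have "x \<in> ?S"
      using R(2)[of x] \<open>norm x > R\<close> by auto
    from has_derivative_transform_within_open[OF has_derivative_const _ this eq]
    have "(\<phi> has_derivative (\<lambda>h. 0)) (at x)"
      by (simp add: open_Compl)
    then have "(\<lambda>h. 0) = frechet_derivative \<phi> (at x)"
      by (rule frechet_derivative_at)
    then show ?thesis by metis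
  qed
  moreover have "norm x \<le> R" if "\<phi> x \<noteq> 0" for x
    using R(2) that closure_subset[of "{x. \<phi> x \<noteq> 0}"] by auto
  ultimately show ?thesis
    by (intro exI[of _ R]) (auto simp: not_le[symmetric])
qed

lemma test_function_shift:
  fixes \<phi> :: "'a::euclidean_space \<Rightarrow> real"
  assumes "test_function \<phi>"
  shows "test_function (\<lambda>x. \<phi> (x - c))"
  unfolding test_function_def
proof (intro conjI allI)
  show "C_k k (\<lambda>x. \<phi> (x - c))" for k
    using assms by (intro C_k_shift) (simp add: test_function_def)
  obtain R where R: "\<And>x. \<phi> x \<noteq> 0 \<Longrightarrow> norm x \<le> R"
    using test_function_support[OF assms] by metis
  have "{x. \<phi> (x - c) \<noteq> 0} \<subseteq> cball c R"
    using R by (force simp: dist_norm norm_minus_commute)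
  then show "compact (closure {x. \<phi> (x - c) \<noteq> 0})"
    by (meson bounded_cball bounded_subset compact_closure)
qed

lemma continuous_compact_support_bounded:
  fixes f :: "'a::euclidean_space \<Rightarrow> real"
  assumes "continuous_on UNIV f" "\<And>x. f x \<noteq> 0 \<Longrightarrow> norm x \<le> R"
  obtains B where "B \<ge> 0" "\<And>x. \<bar>f x\<bar> \<le> B"
proof -
  have "compact (f ` cball 0 R)"
    using assms(1) by (intro compact_continuous_image) (auto intro: continuous_on_subset)
  then obtain B where "B > 0" "\<And>y. y \<in> f ` cball 0 R \<Longrightarrow> norm y \<le> B"
    using compact_imp_bounded bounded_pos by metis
  then have "\<bar>f x\<bar> \<le> B" for x
    using assms(2)[of x] by (cases "f x = 0") auto
  with \<open>B > 0\<close> show ?thesis using that[of B] by auto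
qed

lemma continuous_compact_support_square_integrable:
  fixes f :: "'a::euclidean_space \<Rightarrow> real"
  assumes c: "continuous_on UNIV f" and s: "\<And>x. f x \<noteq> 0 \<Longrightarrow> norm x \<le> R"
  shows "integrable lborel (\<lambda>x. (f x)\<^sup>2)"
proof -
  obtain B where B: "\<And>x. \<bar>f x\<bar> \<le> B"
    using continuous_compact_support_bounded[OF c s] by blast
  have [measurable]: "f \<in> borel_measurable borel"
    using c by (rule borel_measurable_continuous_onI)
  have "integrable lborel (\<lambda>x::'a. indicator (cball 0 R) x * B\<^sup>2 :: real)"
    by (intro integrable_mult_left integrable_real_indicator) (use emeasure_lborel_cball_finite[of "0::'a" R] in auto)
  then show ?thesis
  proof (rule Bochner_Integration.integrable_bound)
    have "(f x)\<^sup>2 \<le> indicator (cball 0 R) x * B\<^sup>2" for x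
      using B[of x] s[of x] by (cases "f x = 0") (auto simp: abs_le_square_iff[symmetric])
    then show "AE x in lborel. norm ((f x)\<^sup>2) \<le> norm (indicator (cball 0 R) x * B\<^sup>2 :: real)"
      by (auto simp: abs_mult)
  qed measurable
qed

lemma test_function_square_integrable:
  assumes "test_function \<phi>"
  shows "integrable lborel (\<lambda>x. (\<phi> x)\<^sup>2)"
    and "integrable lborel (\<lambda>x. (frechet_derivative \<phi> (at x) w)\<^sup>2)"
proof -
  obtain R where supp: "\<And>x. \<phi> x \<noteq> 0 \<Longrightarrow> norm x \<le> R"
    "\<And>x w. frechet_derivative \<phi> (at x) w \<noteq> 0 \<Longrightarrow> norm x \<le> R"
    using test_function_support[OF assms] by auto
  show "integrable lborel (\<lambda>x. (\<phi> x)\<^sup>2)"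
    by (rule continuous_compact_support_square_integrable[OF test_function_continuous[OF assms] supp(1)])
  show "integrable lborel (\<lambda>x. (frechet_derivative \<phi> (at x) w)\<^sup>2)"
    by (rule continuous_compact_support_square_integrable[
          OF test_function_derivative_continuous[OF assms] supp(2)])
qed

lemma test_function_measurable:
  assumes "test_function \<phi>"
  shows "\<phi> \<in> borel_measurable borel"
    and "(\<lambda>x. frechet_derivative \<phi> (at x) w) \<in> borel_measurable borel"
  by (rule borel_measurable_continuous_onI[OF test_function_continuous[OF assms]],
      rule borel_measurable_continuous_onI[OF test_function_derivative_continuous[OF assms]])

lemma abs_mult_le_weighted_squares:
  fixes a b \<epsilon> :: real
  assumes "\<epsilon> > 0"
  shows "2 * (\<bar>a\<bar> * \<bar>b\<bar>) \<le> \<epsilon> * a\<^sup>2 + b\<^sup>2 / \<epsilon>"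
proof -
  have "0 \<le> (sqrt \<epsilon> * \<bar>a\<bar> - \<bar>b\<bar> / sqrt \<epsilon>)\<^sup>2" by simp
  also have "\<dots> = \<epsilon> * a\<^sup>2 + b\<^sup>2 / \<epsilon> - 2 * (\<bar>a\<bar> * \<bar>b\<bar>)"
    using assms by (simp add: power2_diff power_mult_distrib power_divide)
  finally show ?thesis by simp
qed

lemma abs_mult_le_sum_squares: "\<bar>a * b\<bar> \<le> a\<^sup>2 + b\<^sup>2" for a b :: real
proof -
  have "2 * (\<bar>a\<bar> * \<bar>b\<bar>) \<le> a\<^sup>2 + b\<^sup>2"
    using abs_mult_le_weighted_squares[of 1 a b] by simp
  moreover have "0 \<le> \<bar>a\<bar> * \<bar>b\<bar>" by simp
  ultimately show ?thesis unfolding abs_mult by linarith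
qed

lemma integrable_mult_of_squares:
  fixes f g :: "'b \<Rightarrow> real"
  assumes [measurable]: "f \<in> borel_measurable N" "g \<in> borel_measurable N"
    and i: "integrable N (\<lambda>x. (f x)\<^sup>2)" "integrable N (\<lambda>x. (g x)\<^sup>2)"
  shows "integrable N (\<lambda>x. f x * g x)"
proof (rule Bochner_Integration.integrable_bound)
  show "integrable N (\<lambda>x. (f x)\<^sup>2 + (g x)\<^sup>2)" using i by simp
  show "AE x in N. norm (f x * g x) \<le> norm ((f x)\<^sup>2 + (g x)\<^sup>2)"
    using abs_mult_le_sum_squares[of "f _" "g _"] by simp
qed measurable

lemma integrable_square_add:
  fixes f g :: "'b \<Rightarrow> 'c::euclidean_space"
  assumes [measurable]: "f \<in> borel_measurable N" "g \<in> borel_measurable N"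
    and i: "integrable N (\<lambda>x. (norm (f x))\<^sup>2)" "integrable N (\<lambda>x. (norm (g x))\<^sup>2)"
  shows "integrable N (\<lambda>x. (norm (f x + g x))\<^sup>2)"
proof (rule Bochner_Integration.integrable_bound)
  show "integrable N (\<lambda>x. 2 * (norm (f x))\<^sup>2 + 2 * (norm (g x))\<^sup>2)" using i by simp
  have "(norm (a + b))\<^sup>2 \<le> 2 * (norm a)\<^sup>2 + 2 * (norm b)\<^sup>2" for a b :: 'c
  proof -
    have "(norm (a + b))\<^sup>2 \<le> (norm a + norm b)\<^sup>2"
      by (intro power_mono norm_triangle_ineq) auto
    also have "\<dots> \<le> 2 * (norm a)\<^sup>2 + 2 * (norm b)\<^sup>2"
      using sum_squares_bound[of "norm a" "norm b"] by (simp add: power2_sum)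
    finally show ?thesis .
  qed
  then show "AE x in N. norm ((norm (f x + g x))\<^sup>2) \<le> norm (2 * (norm (f x))\<^sup>2 + 2 * (norm (g x))\<^sup>2)"
    by simp
qed measurable

text \<open>The Cauchy--Schwarz inequality against the constant \<open>1\<close> on a probability measure. The
  integral on the right is an extended one: it is infinite when \<open>f\<close> fails to be square integrable.\<close>

lemma square_integral_le_nn_integral:
  fixes f :: "'b \<Rightarrow> real"
  assumes P: "emeasure P (space P) = 1" and [measurable]: "f \<in> borel_measurable P"
  shows "ennreal ((LINT x|P. f x)\<^sup>2) \<le> (\<integral>\<^sup>+ x. ennreal ((f x)\<^sup>2) \<partial>P)"
proof (cases "(\<integral>\<^sup>+ x. ennreal ((f x)\<^sup>2) \<partial>P) = \<infinity>")
  case False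
  interpret finite_measure P by (rule finite_measureI) (simp add: P)
  have f2: "integrable P (\<lambda>x. (f x)\<^sup>2)"
    using False by (intro integrableI_nonneg) (auto simp: top.not_eq_extremum)
  have f1: "integrable P f"
    using integrable_mult_of_squares[of f P "\<lambda>x. 1"] f2 by simp
  define m where "m = (LINT x|P. f x)"
  have "0 \<le> (LINT x|P. (f x - m)\<^sup>2)" by simp
  also have "(\<lambda>x. (f x - m)\<^sup>2) = (\<lambda>x. (f x)\<^sup>2 - (2 * m) * f x + m\<^sup>2)"
    by (auto simp: power2_eq_square algebra_simps)
  also have "(LINT x|P. (f x)\<^sup>2 - (2 * m) * f x + m\<^sup>2) = (LINT x|P. (f x)\<^sup>2) - (2 * m) * m + m\<^sup>2"
    using f1 f2 P by (simp add: m_def measure_def)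
  finally have "m\<^sup>2 \<le> (LINT x|P. (f x)\<^sup>2)" by (simp add: power2_eq_square)
  then show ?thesis
    using f2 by (simp add: nn_integral_eq_integral m_def)
qed simp

text \<open>With a finite measure in the second factor, a common \<open>L\<^sup>1\<close> bound for the slices in the first
  factor already gives integrability on the product.\<close>

lemma Fubini_uniformly_integrable:
  fixes f :: "'b \<Rightarrow> 'c \<Rightarrow> real"
  assumes "sigma_finite_measure N" and P: "finite_measure P"
    and meas[measurable]: "case_prod f \<in> borel_measurable (N \<Otimes>\<^sub>M P)"
    and C: "\<And>y. (\<integral>\<^sup>+ x. ennreal \<bar>f x y\<bar> \<partial>N) \<le> ennreal C"
  shows "(LINT x|N. (LINT y|P. f x y)) = (LINT y|P. (LINT x|N. f x y))"
proof -
  interpret N: sigma_finite_measure N by fact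
  interpret P: finite_measure P by fact
  interpret pair_sigma_finite N P ..
  have "(\<integral>\<^sup>+ z. ennreal (norm (case_prod f z)) \<partial>(N \<Otimes>\<^sub>M P)) = (\<integral>\<^sup>+ y. \<integral>\<^sup>+ x. ennreal \<bar>f x y\<bar> \<partial>N \<partial>P)"
    by (subst nn_integral_snd[symmetric]) (auto simp: split_beta')
  also have "\<dots> \<le> (\<integral>\<^sup>+ y. ennreal C \<partial>P)"
    by (intro nn_integral_mono C)
  also have "\<dots> < \<infinity>"
    by (simp add: P.emeasure_eq_measure ennreal_mult_less_top)
  finally have "integrable (N \<Otimes>\<^sub>M P) (case_prod f)"
    by (simp add: integrable_iff_bounded)
  then show ?thesis by (rule Fubini_integral[symmetric])
qed

lemma nn_integral_shift:
  fixes f :: "'a::euclidean_space \<Rightarrow> ennreal"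
  assumes [measurable]: "f \<in> borel_measurable borel"
  shows "(\<integral>\<^sup>+ x. f (x + c) \<partial>lborel) = (\<integral>\<^sup>+ x. f x \<partial>lborel)"
  by (subst lborel_distr_plus[of c, symmetric]) (simp add: nn_integral_distr add.commute)

lemma integral_shift:
  fixes f :: "'a::euclidean_space \<Rightarrow> real"
  assumes [measurable]: "f \<in> borel_measurable borel"
  shows "(LINT x|lborel. f (x + c)) = (LINT x|lborel. f x)"
  by (subst (2) lborel_distr_plus[of c, symmetric]) (simp add: integral_distr add.commute)

lemma integrable_shift:
  fixes f :: "'a::euclidean_space \<Rightarrow> real"
  assumes "integrable lborel f"
  shows "integrable lborel (\<lambda>x. f (x + c))"
  using assms nn_integral_shift[of "\<lambda>x. ennreal (norm (f x))" c]
    borel_measurable_integrable[OF assms] by (simp add: integrable_iff_bounded)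

lemma nn_integral_scale:
  fixes f :: "'a::euclidean_space \<Rightarrow> ennreal"
  assumes [measurable]: "f \<in> borel_measurable borel" and "h > 0"
  shows "(\<integral>\<^sup>+ x. f (h *\<^sub>R x) \<partial>lborel) = ennreal (h powr - real DIM('a)) * (\<integral>\<^sup>+ x. f x \<partial>lborel)"
proof -
  have "(\<integral>\<^sup>+ x. f x \<partial>lborel) = ennreal (h ^ DIM('a)) * (\<integral>\<^sup>+ x. f (h *\<^sub>R x) \<partial>lborel)"
    using \<open>h > 0\<close> by (subst lborel_affine[of h 0])
      (simp_all add: nn_integral_density nn_integral_distr nn_integral_cmult)
  moreover have "h powr - real DIM('a) * h ^ DIM('a) = 1"
    using \<open>h > 0\<close> by (simp add: powr_minus powr_realpow)
  ultimately show ?thesis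
    by (simp add: mult.assoc[symmetric] ennreal_mult'[symmetric])
qed

section \<open>Translations of Sobolev functions\<close>

text \<open>Representatives that are Borel measurable, not merely Lebesgue measurable: composing them with
  \<open>(x, y) \<mapsto> x + y\<close> preserves measurability on products, so that Fubini applies to averages of
  translates.\<close>

definition sobolev_pair :: "('a::euclidean_space \<Rightarrow> real) \<Rightarrow> ('a \<Rightarrow> 'a) \<Rightarrow> bool" where
  "sobolev_pair u g \<longleftrightarrow> u \<in> borel_measurable borel \<and> g \<in> borel_measurable borel \<and>
     integrable lborel (\<lambda>x. (u x)\<^sup>2) \<and> integrable lborel (\<lambda>x. (norm (g x))\<^sup>2) \<and>
     (\<forall>\<phi>. test_function \<phi> \<longrightarrow> (\<forall>b\<in>Basis.
        (LINT x|lborel. u x * frechet_derivative \<phi> (at x) b) = - (LINT x|lborel. (g x \<bullet> b) * \<phi> x)))"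

lemma sobolev_pairD:
  assumes "sobolev_pair u g"
  shows "u \<in> borel_measurable borel" "g \<in> borel_measurable borel"
    "integrable lborel (\<lambda>x. (u x)\<^sup>2)" "integrable lborel (\<lambda>x. (norm (g x))\<^sup>2)"
    "\<And>\<phi> b. test_function \<phi> \<Longrightarrow> b \<in> Basis \<Longrightarrow>
       (LINT x|lborel. u x * frechet_derivative \<phi> (at x) b) = - (LINT x|lborel. (g x \<bullet> b) * \<phi> x)"
  using assms by (auto simp: sobolev_pair_def)

lemma integrable_inner_square:
  fixes g :: "'b \<Rightarrow> 'a::euclidean_space"
  assumes [measurable]: "g \<in> borel_measurable N" and i: "integrable N (\<lambda>x. (norm (g x))\<^sup>2)"
  shows "integrable N (\<lambda>x. (g x \<bullet> w)\<^sup>2)"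
proof (rule Bochner_Integration.integrable_bound)
  show "integrable N (\<lambda>x. (norm w)\<^sup>2 * (norm (g x))\<^sup>2)" using i by simp
  have "(g x \<bullet> w)\<^sup>2 \<le> (norm w)\<^sup>2 * (norm (g x))\<^sup>2" for x
    using Cauchy_Schwarz_ineq[of "g x" w] by (simp add: power2_norm_eq_inner mult.commute)
  then show "AE x in N. norm ((g x \<bullet> w)\<^sup>2) \<le> norm ((norm w)\<^sup>2 * (norm (g x))\<^sup>2)" by simp
qed measurable

lemma sobolev_pair_direction:
  assumes s: "sobolev_pair u g" and \<phi>: "test_function \<phi>"
  shows "(LINT x|lborel. u x * frechet_derivative \<phi> (at x) w) = - (LINT x|lborel. (g x \<bullet> w) * \<phi> x)"
proof -
  note [measurable] = sobolev_pairD(1,2)[OF s] test_function_measurable[OF \<phi>]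
  have i1: "integrable lborel (\<lambda>x. u x * frechet_derivative \<phi> (at x) b)" for b
    by (intro integrable_mult_of_squares sobolev_pairD(3)[OF s] test_function_square_integrable[OF \<phi>])
      measurable
  have i2: "integrable lborel (\<lambda>x. (g x \<bullet> b) * \<phi> x)" for b
    by (intro integrable_mult_of_squares integrable_inner_square sobolev_pairD(4)[OF s]
        test_function_square_integrable[OF \<phi>]) measurable
  have "(LINT x|lborel. u x * frechet_derivative \<phi> (at x) w) =
      (LINT x|lborel. (\<Sum>b\<in>Basis. (w \<bullet> b) * (u x * frechet_derivative \<phi> (at x) b)))"
    by (subst frechet_derivative_basis_expansion[OF \<phi>]) (simp add: sum_distrib_left mult_ac)
  also have "\<dots> = (\<Sum>b\<in>Basis. (w \<bullet> b) * (LINT x|lborel. u x * frechet_derivative \<phi> (at x) b))"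
    using i1 by simp
  also have "\<dots> = - (\<Sum>b\<in>Basis. (w \<bullet> b) * (LINT x|lborel. (g x \<bullet> b) * \<phi> x))"
    by (simp add: sobolev_pairD(5)[OF s \<phi>] sum_negf)
  also have "(\<Sum>b\<in>Basis. (w \<bullet> b) * (LINT x|lborel. (g x \<bullet> b) * \<phi> x)) =
      (LINT x|lborel. (\<Sum>b\<in>Basis. (w \<bullet> b) * ((g x \<bullet> b) * \<phi> x)))"
    using i2 by simp
  also have "\<dots> = (LINT x|lborel. (g x \<bullet> w) * \<phi> x)"
    using euclidean_inner[of _ w]
    by (intro Bochner_Integration.integral_cong refl)
      (simp add: sum_distrib_left sum_distrib_right mult_ac)
  finally show ?thesis .
qed

definition unit_interval :: "real measure" where
  "unit_interval = density lborel (indicator {0..1})"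

lemma sets_unit_interval [simp, measurable_cong]: "sets unit_interval = sets borel"
  by (simp add: unit_interval_def)

lemma emeasure_unit_interval: "emeasure unit_interval (space unit_interval) = 1"
  by (simp add: unit_interval_def emeasure_density)

lemma finite_measure_unit_interval: "finite_measure unit_interval"
  by (rule finite_measureI) (simp add: emeasure_unit_interval)

lemma integral_unit_interval:
  fixes f :: "real \<Rightarrow> real"
  assumes [measurable]: "f \<in> borel_measurable borel"
  shows "(LINT s|unit_interval. f s) = (LINT s|lborel. f s * indicator {0..1} s)"
proof -
  have "unit_interval = density lborel (\<lambda>s. ennreal (indicator {0..1} s))"
    unfolding unit_interval_def by (simp add: ennreal_indicator)
  then have "(LINT s|unit_interval. f s) = (LINT s|density lborel (\<lambda>s. ennreal (indicator {0..1} s)). f s)"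
    by (rule arg_cong)
  also have "\<dots> = (LINT s|lborel. indicator {0..1} s *\<^sub>R f s)"
    by (rule integral_density) auto
  finally show ?thesis by (simp add: mult.commute)
qed

lemma test_function_difference:
  assumes \<phi>: "test_function \<phi>"
  shows "\<phi> (x - w) - \<phi> x = - (LINT s|unit_interval. frechet_derivative \<phi> (at (x - s *\<^sub>R w)) w)"
proof -
  let ?F = "\<lambda>s. \<phi> (x - s *\<^sub>R w)" and ?f = "\<lambda>s. - frechet_derivative \<phi> (at (x - s *\<^sub>R w)) w"
  have c: "continuous_on UNIV ((\<lambda>y. frechet_derivative \<phi> (at y) w) \<circ> (\<lambda>s. x - s *\<^sub>R w))"
    by (intro continuous_on_compose continuous_intros
        continuous_on_subset[OF test_function_derivative_continuous[OF \<phi>]]) auto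
  then have c: "continuous_on UNIV (\<lambda>s. frechet_derivative \<phi> (at (x - s *\<^sub>R w)) w)"
    by (simp add: o_def)
  then have [measurable]: "(\<lambda>s. frechet_derivative \<phi> (at (x - s *\<^sub>R w)) w) \<in> borel_measurable borel"
    by (rule borel_measurable_continuous_onI)
  have "(LINT s|lborel. ?f s * indicator {0..1} s) = ?F 1 - ?F 0"
  proof (rule integral_FTC_Icc_real)
    fix s :: real
    have lin: "linear (frechet_derivative \<phi> (at (x - s *\<^sub>R w)))"
      by (rule has_derivative_linear[OF test_function_has_derivative[OF \<phi>]])
    have "(?F has_derivative (\<lambda>h. frechet_derivative \<phi> (at (x - s *\<^sub>R w)) (- (h *\<^sub>R w)))) (at s)"
      by (rule has_derivative_compose[OF _ test_function_has_derivative[OF \<phi>]])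
        (auto intro!: derivative_eq_intros)
    moreover have "(\<lambda>h. frechet_derivative \<phi> (at (x - s *\<^sub>R w)) (- (h *\<^sub>R w))) = (*) (?f s)"
      by (auto simp: linear_neg[OF lin] linear_cmul[OF lin] mult.commute)
    ultimately show "(?F has_real_derivative ?f s) (at s)"
      by (simp only: has_field_derivative_def)
    show "isCont ?f s"
      using c by (simp add: continuous_on_eq_continuous_at)
  qed simp
  then show ?thesis
    by (subst integral_unit_interval) simp_all
qed

lemma integrable_compact_of_square:
  fixes f :: "'a::euclidean_space \<Rightarrow> real"
  assumes [measurable]: "f \<in> borel_measurable borel"
    and "integrable lborel (\<lambda>x. (f x)\<^sup>2)" "compact K"
  shows "integrable lborel (\<lambda>x. indicator K x * f x)"
proof (rule integrable_mult_of_squares)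
  show "integrable lborel (\<lambda>x. (indicator K x :: real)\<^sup>2)"
    using emeasure_compact_finite[OF \<open>compact K\<close>] \<open>compact K\<close>
    by (simp add: power2_eq_square indicator_inter_arith[symmetric] integrable_indicator_iff
        compact_imp_closed)
qed (use assms in \<open>auto simp: compact_imp_closed\<close>)

text \<open>Cauchy--Schwarz on each segment, then Tonelli; after that every slice is a translate.\<close>

lemma directional_average_square:
  fixes g :: "'a::euclidean_space \<Rightarrow> 'a"
  assumes [measurable]: "g \<in> borel_measurable borel"
  shows "(\<integral>\<^sup>+ x. ennreal ((LINT s|unit_interval. g (x + s *\<^sub>R w) \<bullet> w)\<^sup>2) \<partial>lborel)
    \<le> ennreal ((norm w)\<^sup>2) * (\<integral>\<^sup>+ x. ennreal ((norm (g x))\<^sup>2) \<partial>lborel)"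
proof -
  interpret U: finite_measure unit_interval by (rule finite_measure_unit_interval)
  interpret pair_sigma_finite lborel unit_interval ..
  have "(\<integral>\<^sup>+ x. ennreal ((LINT s|unit_interval. g (x + s *\<^sub>R w) \<bullet> w)\<^sup>2) \<partial>lborel)
      \<le> (\<integral>\<^sup>+ x. \<integral>\<^sup>+ s. ennreal ((g (x + s *\<^sub>R w) \<bullet> w)\<^sup>2) \<partial>unit_interval \<partial>lborel)"
    by (intro nn_integral_mono square_integral_le_nn_integral emeasure_unit_interval) measurable
  also have "\<dots> = (\<integral>\<^sup>+ s. \<integral>\<^sup>+ x. ennreal ((g (x + s *\<^sub>R w) \<bullet> w)\<^sup>2) \<partial>lborel \<partial>unit_interval)"
    by (rule Fubini'[symmetric]) measurable
  also have "\<dots> \<le> (\<integral>\<^sup>+ s. ennreal ((norm w)\<^sup>2) * (\<integral>\<^sup>+ x. ennreal ((norm (g x))\<^sup>2) \<partial>lborel) \<partial>unit_interval)"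
  proof (intro nn_integral_mono)
    fix s
    have "(\<integral>\<^sup>+ x. ennreal ((g (x + s *\<^sub>R w) \<bullet> w)\<^sup>2) \<partial>lborel) = (\<integral>\<^sup>+ x. ennreal ((g x \<bullet> w)\<^sup>2) \<partial>lborel)"
      by (rule nn_integral_shift[of "\<lambda>x. ennreal ((g x \<bullet> w)\<^sup>2)"]) measurable
    also have "\<dots> \<le> (\<integral>\<^sup>+ x. ennreal ((norm w)\<^sup>2) * ennreal ((norm (g x))\<^sup>2) \<partial>lborel)"
    proof (intro nn_integral_mono)
      fix x
      have "(g x \<bullet> w)\<^sup>2 \<le> (norm w)\<^sup>2 * (norm (g x))\<^sup>2"
        using Cauchy_Schwarz_ineq[of "g x" w] by (simp add: power2_norm_eq_inner mult.commute)
      then show "ennreal ((g x \<bullet> w)\<^sup>2) \<le> ennreal ((norm w)\<^sup>2) * ennreal ((norm (g x))\<^sup>2)"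
        by (simp add: ennreal_mult'[symmetric] ennreal_leI)
    qed
    also have "\<dots> = ennreal ((norm w)\<^sup>2) * (\<integral>\<^sup>+ x. ennreal ((norm (g x))\<^sup>2) \<partial>lborel)"
      by (rule nn_integral_cmult) measurable
    finally show "(\<integral>\<^sup>+ x. ennreal ((g (x + s *\<^sub>R w) \<bullet> w)\<^sup>2) \<partial>lborel)
      \<le> ennreal ((norm w)\<^sup>2) * (\<integral>\<^sup>+ x. ennreal ((norm (g x))\<^sup>2) \<partial>lborel)" .
  qed
  also have "\<dots> = ennreal ((norm w)\<^sup>2) * (\<integral>\<^sup>+ x. ennreal ((norm (g x))\<^sup>2) \<partial>lborel)"
    by (simp add: emeasure_unit_interval)
  finally show ?thesis .
qed

lemma measurable_directional_average [measurable]: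
  fixes g :: "'a::euclidean_space \<Rightarrow> 'a"
  assumes [measurable]: "g \<in> borel_measurable borel"
  shows "(\<lambda>x. LINT s|unit_interval. g (x + s *\<^sub>R w) \<bullet> w) \<in> borel_measurable borel"
proof -
  interpret U: finite_measure unit_interval by (rule finite_measure_unit_interval)
  show ?thesis by measurable
qed

text \<open>Both sides have the same integral against every test function: the identity holds for the test
  function itself, and Fubini together with the definition of the weak gradient moves it over to
  \<open>u\<close>. The fundamental lemma then gives equality almost everywhere.\<close>

lemma translation_identity:
  fixes u :: "'a::euclidean_space \<Rightarrow> real"
  assumes s: "sobolev_pair u g"
  shows "AE x in lborel. u (x + w) - u x = (LINT s|unit_interval. g (x + s *\<^sub>R w) \<bullet> w)"
proof -
  note [measurable] = sobolev_pairD(1,2)[OF s]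
  define G where "G x = (LINT s|unit_interval. g (x + s *\<^sub>R w) \<bullet> w)" for x
  have [measurable]: "G \<in> borel_measurable borel"
    unfolding G_def[abs_def] by measurable
  have u2: "integrable lborel (\<lambda>x. (u x)\<^sup>2)" "integrable lborel (\<lambda>x. (u (x + w))\<^sup>2)"
    using sobolev_pairD(3)[OF s] integrable_shift[of "\<lambda>x. (u x)\<^sup>2" w] by auto
  have g2: "integrable lborel (\<lambda>x. (norm (g x))\<^sup>2)" by (rule sobolev_pairD(4)[OF s])
  have G2: "integrable lborel (\<lambda>x. (G x)\<^sup>2)"
  proof (rule integrableI_nonneg)
    have "(\<integral>\<^sup>+ x. ennreal ((G x)\<^sup>2) \<partial>lborel)
        \<le> ennreal ((norm w)\<^sup>2) * (\<integral>\<^sup>+ x. ennreal ((norm (g x))\<^sup>2) \<partial>lborel)"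
      unfolding G_def by (rule directional_average_square) measurable
    also have "\<dots> < \<infinity>"
      using g2 by (simp add: nn_integral_eq_integral ennreal_mult_less_top)
    finally show "(\<integral>\<^sup>+ x. ennreal ((G x)\<^sup>2) \<partial>lborel) < \<infinity>" .
  qed auto
  have "AE x in lborel. u (x + w) - u x - G x = 0"
  proof (rule fundamental_lemma_borel)
    show "(\<lambda>x. u (x + w) - u x - G x) \<in> borel_measurable borel" by measurable
  next
    fix K :: "'a set" assume "compact K"
    then have "integrable lborel (\<lambda>x. indicator K x * u (x + w) - indicator K x * u x - indicator K x * G x)"
      using u2 G2 by (intro Bochner_Integration.integrable_diff integrable_compact_of_square) measurable
    then show "integrable lborel (\<lambda>x. indicator K x * (u (x + w) - u x - G x))"
      by (simp add: algebra_simps)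
  next
    fix \<phi> :: "'a \<Rightarrow> real" assume \<phi>: "test_function \<phi>"
    note [measurable] = test_function_measurable[OF \<phi>]
    have \<phi>2: "integrable lborel (\<lambda>x. (\<phi> x)\<^sup>2)" by (rule test_function_square_integrable[OF \<phi>])
    have i: "integrable lborel (\<lambda>x. f x * \<phi> x)"
      if "f \<in> borel_measurable borel" "integrable lborel (\<lambda>x. (f x)\<^sup>2)" for f
      using that \<phi>2 by (intro integrable_mult_of_squares) auto
    define A where "A s = (LINT x|lborel. (g (x + s *\<^sub>R w) \<bullet> w) * \<phi> x)" for s
    have "(LINT x|lborel. G x * \<phi> x) =
        (LINT x|lborel. (LINT s|unit_interval. (g (x + s *\<^sub>R w) \<bullet> w) * \<phi> x))"
      unfolding G_def by simp
    also have "\<dots> = (LINT s|unit_interval. A s)"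
      unfolding A_def
    proof (rule Fubini_uniformly_integrable[OF _ finite_measure_unit_interval])
      fix s
      have i2: "integrable lborel (\<lambda>x. (g (x + s *\<^sub>R w) \<bullet> w)\<^sup>2)"
        by (rule integrable_shift[of "\<lambda>x. (g x \<bullet> w)\<^sup>2"], rule integrable_inner_square[OF _ g2]) measurable
      have "(\<integral>\<^sup>+ x. ennreal \<bar>(g (x + s *\<^sub>R w) \<bullet> w) * \<phi> x\<bar> \<partial>lborel)
          \<le> (\<integral>\<^sup>+ x. ennreal ((g (x + s *\<^sub>R w) \<bullet> w)\<^sup>2 + (\<phi> x)\<^sup>2) \<partial>lborel)"
        by (intro nn_integral_mono ennreal_leI abs_mult_le_sum_squares)
      also have "\<dots> = ennreal (LINT x|lborel. (g (x + s *\<^sub>R w) \<bullet> w)\<^sup>2 + (\<phi> x)\<^sup>2)"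
        using i2 \<phi>2 by (intro nn_integral_eq_integral) auto
      also have "(LINT x|lborel. (g (x + s *\<^sub>R w) \<bullet> w)\<^sup>2 + (\<phi> x)\<^sup>2) =
          (LINT x|lborel. (g x \<bullet> w)\<^sup>2) + (LINT x|lborel. (\<phi> x)\<^sup>2)"
        using i2 \<phi>2 integral_shift[of "\<lambda>x. (g x \<bullet> w)\<^sup>2" "s *\<^sub>R w"] by simp
      finally show "(\<integral>\<^sup>+ x. ennreal \<bar>(g (x + s *\<^sub>R w) \<bullet> w) * \<phi> x\<bar> \<partial>lborel)
        \<le> ennreal ((LINT x|lborel. (g x \<bullet> w)\<^sup>2) + (LINT x|lborel. (\<phi> x)\<^sup>2))" .
    qed (rule lborel.sigma_finite_measure_axioms, measurable)
    finally have G\<phi>: "(LINT x|lborel. G x * \<phi> x) = (LINT s|unit_interval. A s)" .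
    obtain R where R: "\<And>x w. frechet_derivative \<phi> (at x) w \<noteq> 0 \<Longrightarrow> norm x \<le> R"
      using test_function_support[OF \<phi>] by blast
    have \<phi>': "integrable lborel (\<lambda>x. (frechet_derivative \<phi> (at x) w)\<^sup>2)"
      by (rule test_function_square_integrable[OF \<phi>])
    have "(LINT x|lborel. u (x + w) * \<phi> x) - (LINT x|lborel. u x * \<phi> x) =
        (LINT x|lborel. u x * \<phi> (x - w)) - (LINT x|lborel. u x * \<phi> x)"
      using integral_shift[of "\<lambda>x. u x * \<phi> (x - w)" w] by simp
    also have "\<dots> = (LINT x|lborel. u x * \<phi> (x - w) - u x * \<phi> x)"
    proof (rule Bochner_Integration.integral_diff[symmetric])
      show "integrable lborel (\<lambda>x. u x * \<phi> (x - w))"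
        using u2 integrable_shift[OF \<phi>2, of "- w"] by (intro integrable_mult_of_squares) auto
    qed (use i u2 in auto)
    also have "\<dots> = (LINT x|lborel. (LINT s|unit_interval. - (u x * frechet_derivative \<phi> (at (x - s *\<^sub>R w)) w)))"
      using test_function_difference[OF \<phi>, of _ w] by (simp add: right_diff_distrib[symmetric])
    also have "\<dots> = (LINT s|unit_interval. (LINT x|lborel. - (u x * frechet_derivative \<phi> (at (x - s *\<^sub>R w)) w)))"
    proof (rule Fubini_uniformly_integrable[OF _ finite_measure_unit_interval])
      have "(\<lambda>z. frechet_derivative \<phi> (at (fst z - snd z *\<^sub>R w)) w) \<in> borel_measurable (lborel \<Otimes>\<^sub>M unit_interval)"
        by (rule measurable_compose[OF _ test_function_measurable(2)[OF \<phi>]]) measurable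
      then show "(\<lambda>(x, s). - (u x * frechet_derivative \<phi> (at (x - s *\<^sub>R w)) w))
          \<in> borel_measurable (lborel \<Otimes>\<^sub>M unit_interval)"
        by (auto simp: split_beta' intro!: borel_measurable_uminus borel_measurable_times)
      fix s
      have i2: "integrable lborel (\<lambda>x. (frechet_derivative \<phi> (at (x - s *\<^sub>R w)) w)\<^sup>2)"
        using integrable_shift[OF \<phi>', of "- (s *\<^sub>R w)"] by simp
      have "(\<integral>\<^sup>+ x. ennreal \<bar>- (u x * frechet_derivative \<phi> (at (x - s *\<^sub>R w)) w)\<bar> \<partial>lborel)
          \<le> (\<integral>\<^sup>+ x. ennreal ((u x)\<^sup>2 + (frechet_derivative \<phi> (at (x - s *\<^sub>R w)) w)\<^sup>2) \<partial>lborel)"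
        unfolding abs_minus_cancel by (intro nn_integral_mono ennreal_leI abs_mult_le_sum_squares)
      also have "\<dots> = ennreal (LINT x|lborel. (u x)\<^sup>2 + (frechet_derivative \<phi> (at (x - s *\<^sub>R w)) w)\<^sup>2)"
        using i2 u2 by (intro nn_integral_eq_integral) auto
      also have "(LINT x|lborel. (u x)\<^sup>2 + (frechet_derivative \<phi> (at (x - s *\<^sub>R w)) w)\<^sup>2) =
          (LINT x|lborel. (u x)\<^sup>2) + (LINT x|lborel. (frechet_derivative \<phi> (at x) w)\<^sup>2)"
        using i2 u2 integral_shift[of "\<lambda>x. (frechet_derivative \<phi> (at x) w)\<^sup>2" "- (s *\<^sub>R w)"] by simp
      finally show "(\<integral>\<^sup>+ x. ennreal \<bar>- (u x * frechet_derivative \<phi> (at (x - s *\<^sub>R w)) w)\<bar> \<partial>lborel)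
        \<le> ennreal ((LINT x|lborel. (u x)\<^sup>2) + (LINT x|lborel. (frechet_derivative \<phi> (at x) w)\<^sup>2))" .
    qed (rule lborel.sigma_finite_measure_axioms)
    also have "\<dots> = (LINT s|unit_interval. A s)"
    proof (rule Bochner_Integration.integral_cong[OF refl])
      fix s
      have "(LINT x|lborel. u x * frechet_derivative \<phi> (at (x - s *\<^sub>R w)) w) =
          - (LINT x|lborel. (g x \<bullet> w) * \<phi> (x - s *\<^sub>R w))"
        using sobolev_pair_direction[OF s test_function_shift[OF \<phi>, of "s *\<^sub>R w"], of w]
        by (simp add: frechet_derivative_shift[OF \<phi>])
      also have "(LINT x|lborel. (g x \<bullet> w) * \<phi> (x - s *\<^sub>R w)) = A s"
        using integral_shift[of "\<lambda>x. (g x \<bullet> w) * \<phi> (x - s *\<^sub>R w)" "s *\<^sub>R w"] by (simp add: A_def)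
      finally show "(LINT x|lborel. - (u x * frechet_derivative \<phi> (at (x - s *\<^sub>R w)) w)) = A s"
        by simp
    qed
    finally have "(LINT x|lborel. u (x + w) * \<phi> x) - (LINT x|lborel. u x * \<phi> x) = (LINT s|unit_interval. A s)" .
    moreover have "(LINT x|lborel. (u (x + w) - u x - G x) * \<phi> x) =
        (LINT x|lborel. u (x + w) * \<phi> x) - (LINT x|lborel. u x * \<phi> x) - (LINT x|lborel. G x * \<phi> x)"
      using i u2 G2 by (simp add: left_diff_distrib)
    ultimately show "(LINT x|lborel. (u (x + w) - u x - G x) * \<phi> x) = 0"
      using G\<phi> by simp
  qed
  then show ?thesis by (simp add: G_def)
qed

text \<open>The only consequence of having a weak gradient in \<open>L\<^sup>2\<close> on which the embedding and the
  almost everywhere convergence below depend.\<close>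

lemma translation_estimate:
  fixes u :: "'a::euclidean_space \<Rightarrow> real"
  assumes s: "sobolev_pair u g"
  shows "(\<integral>\<^sup>+ x. ennreal ((u (x + w) - u x)\<^sup>2) \<partial>lborel)
    \<le> ennreal ((norm w)\<^sup>2 * (LINT x|lborel. (norm (g x))\<^sup>2))"
proof -
  note [measurable] = sobolev_pairD(1,2)[OF s]
  have "(\<integral>\<^sup>+ x. ennreal ((u (x + w) - u x)\<^sup>2) \<partial>lborel) =
      (\<integral>\<^sup>+ x. ennreal ((LINT s|unit_interval. g (x + s *\<^sub>R w) \<bullet> w)\<^sup>2) \<partial>lborel)"
    using translation_identity[OF s, of w] by (intro nn_integral_cong_AE) auto
  also have "\<dots> \<le> ennreal ((norm w)\<^sup>2) * (\<integral>\<^sup>+ x. ennreal ((norm (g x))\<^sup>2) \<partial>lborel)"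
    by (rule directional_average_square) measurable
  also have "\<dots> = ennreal ((norm w)\<^sup>2 * (LINT x|lborel. (norm (g x))\<^sup>2))"
    using sobolev_pairD(4)[OF s] by (simp add: nn_integral_eq_integral ennreal_mult')
  finally show ?thesis .
qed

section \<open>Averages over balls\<close>

definition ball_volume_inv :: "'a::euclidean_space itself \<Rightarrow> real" where
  "ball_volume_inv _ = 1 / measure lborel (ball (0::'a) 1)"

lemma ball_volume_inv_pos: "ball_volume_inv TYPE('a::euclidean_space) > 0"
  using content_ball_pos[of 1 "0::'a"] by (simp add: ball_volume_inv_def)

text \<open>The uniform probability measure on the unit ball. Averages over balls of any radius are
  integrals with respect to it after scaling.\<close>

definition ball_measure :: "'a::euclidean_space measure" where
  "ball_measure = density lborel (\<lambda>y. ennreal (ball_volume_inv TYPE('a) * indicator (ball 0 1) y))"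

lemma measurable_ball_density:
  "(\<lambda>y::'a::euclidean_space. ennreal (ball_volume_inv TYPE('a) * indicator (ball 0 1) y))
    \<in> borel_measurable borel"
proof -
  have [measurable]: "ball (0::'a) 1 \<in> sets borel" by simp
  show ?thesis by measurable
qed

lemma sets_ball_measure [simp, measurable_cong]: "sets ball_measure = sets borel"
  by (simp add: ball_measure_def)

lemma emeasure_ball_measure:
  "emeasure (ball_measure :: 'a::euclidean_space measure) (space ball_measure) = 1"
proof -
  let ?B = "ball (0::'a) 1"
  have "emeasure (ball_measure :: 'a measure) (space ball_measure) =
      (\<integral>\<^sup>+ y. ennreal (ball_volume_inv TYPE('a) * indicator ?B y) \<partial>lborel)"
    unfolding ball_measure_def by (subst emeasure_density) (auto simp: measurable_ball_density)
  also have "\<dots> = (\<integral>\<^sup>+ y. ennreal (ball_volume_inv TYPE('a)) * indicator ?B y \<partial>lborel)"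
    using ball_volume_inv_pos[where 'a='a]
    by (simp add: ennreal_mult' ennreal_indicator)
  also have "\<dots> = ennreal (ball_volume_inv TYPE('a)) * emeasure lborel ?B"
    by (simp add: nn_integral_cmult_indicator)
  also have "emeasure lborel ?B = ennreal (measure lborel ?B)"
    using emeasure_lborel_ball_finite[of "0::'a" 1] by (simp add: emeasure_eq_ennreal_measure)
  also have "ennreal (ball_volume_inv TYPE('a)) * ennreal (measure lborel ?B) = 1"
    using ball_volume_inv_pos[where 'a='a] by (simp add: ball_volume_inv_def ennreal_mult'[symmetric])
  finally show ?thesis .
qed

lemma finite_measure_ball_measure: "finite_measure ball_measure"
  by (rule finite_measureI) (simp add: emeasure_ball_measure)

lemma AE_ball_measure: "AE y in ball_measure. norm y < 1"
  unfolding ball_measure_def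
  by (subst AE_density, measurable) (auto simp: indicator_def split: if_splits)

text \<open>The power of \<open>h\<close> is the Jacobian of the scaling; the inequality comes from dropping the indicator of
  the ball.\<close>

lemma nn_integral_ball_measure_le:
  fixes f :: "'a::euclidean_space \<Rightarrow> ennreal"
  assumes [measurable]: "f \<in> borel_measurable borel" and "h > 0"
  shows "(\<integral>\<^sup>+ y. f (x + h *\<^sub>R y) \<partial>ball_measure)
    \<le> ennreal (ball_volume_inv TYPE('a) * h powr - real DIM('a)) * (\<integral>\<^sup>+ y. f y \<partial>lborel)"
proof -
  let ?k = "ball_volume_inv TYPE('a)"
  have "(\<integral>\<^sup>+ y. f (x + h *\<^sub>R y) \<partial>ball_measure) =
      (\<integral>\<^sup>+ y. ennreal (?k * indicator (ball 0 1) y) * f (x + h *\<^sub>R y) \<partial>lborel)"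
    unfolding ball_measure_def by (subst nn_integral_density) (auto simp: measurable_ball_density)
  also have "\<dots> \<le> (\<integral>\<^sup>+ y. ennreal ?k * f (x + h *\<^sub>R y) \<partial>lborel)"
    using ball_volume_inv_pos[where 'a='a]
    by (intro nn_integral_mono mult_right_mono ennreal_leI) (auto simp: indicator_def)
  also have "\<dots> = ennreal ?k * (\<integral>\<^sup>+ y. f (x + h *\<^sub>R y) \<partial>lborel)"
    by (rule nn_integral_cmult) measurable
  also have "(\<integral>\<^sup>+ y. f (x + h *\<^sub>R y) \<partial>lborel) = ennreal (h powr - real DIM('a)) * (\<integral>\<^sup>+ y. f (x + y) \<partial>lborel)"
    using \<open>h > 0\<close> by (intro nn_integral_scale[of "\<lambda>y. f (x + y)"]) auto
  also have "(\<integral>\<^sup>+ y. f (x + y) \<partial>lborel) = (\<integral>\<^sup>+ y. f y \<partial>lborel)"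
    using nn_integral_shift[of f x] by (simp add: add.commute)
  finally show ?thesis
    using ball_volume_inv_pos[where 'a='a] by (simp add: ennreal_mult' mult.assoc)
qed

definition ball_average :: "real \<Rightarrow> ('a::euclidean_space \<Rightarrow> real) \<Rightarrow> 'a \<Rightarrow> real" where
  "ball_average h u x = (LINT y|ball_measure. u (x + h *\<^sub>R y))"

lemma measurable_ball_average [measurable]:
  assumes [measurable]: "u \<in> borel_measurable borel"
  shows "ball_average h u \<in> borel_measurable borel"
proof -
  interpret B: finite_measure "ball_measure :: 'a measure" by (rule finite_measure_ball_measure)
  show ?thesis unfolding ball_average_def[abs_def] by measurable
qed

lemma sobolev_pair_square_nn_integral:
  assumes "sobolev_pair u g"
  shows "(\<integral>\<^sup>+ x. ennreal ((u x)\<^sup>2) \<partial>lborel) = ennreal (LINT x|lborel. (u x)\<^sup>2)"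
  using sobolev_pairD(3)[OF assms] by (intro nn_integral_eq_integral) auto

lemma ball_average_integrable:
  fixes u :: "'a::euclidean_space \<Rightarrow> real"
  assumes s: "sobolev_pair u g" and "h > 0"
  shows "integrable ball_measure (\<lambda>y. u (x + h *\<^sub>R y))"
proof -
  interpret B: finite_measure "ball_measure :: 'a measure" by (rule finite_measure_ball_measure)
  note [measurable] = sobolev_pairD(1)[OF s]
  have "integrable ball_measure (\<lambda>y. (u (x + h *\<^sub>R y))\<^sup>2)"
  proof (rule integrableI_nonneg)
    have "(\<integral>\<^sup>+ y. ennreal ((u (x + h *\<^sub>R y))\<^sup>2) \<partial>ball_measure) \<le>
        ennreal (ball_volume_inv TYPE('a) * h powr - real DIM('a)) * (\<integral>\<^sup>+ y. ennreal ((u y)\<^sup>2) \<partial>lborel)"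
      using \<open>h > 0\<close> by (intro nn_integral_ball_measure_le[of "\<lambda>z. ennreal ((u z)\<^sup>2)"]) auto
    also have "\<dots> < \<infinity>"
      by (simp add: sobolev_pair_square_nn_integral[OF s] ennreal_mult_less_top)
    finally show "(\<integral>\<^sup>+ y. ennreal ((u (x + h *\<^sub>R y))\<^sup>2) \<partial>ball_measure) < \<infinity>" .
  qed auto
  then show ?thesis
    using integrable_mult_of_squares[of "\<lambda>y. u (x + h *\<^sub>R y)" ball_measure "\<lambda>_. 1"] by simp
qed

lemma ball_average_bound:
  fixes u :: "'a::euclidean_space \<Rightarrow> real"
  assumes s: "sobolev_pair u g" and "h > 0"
  shows "(ball_average h u x)\<^sup>2
    \<le> ball_volume_inv TYPE('a) * h powr - real DIM('a) * (LINT y|lborel. (u y)\<^sup>2)"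
proof -
  note [measurable] = sobolev_pairD(1)[OF s]
  have "ennreal ((ball_average h u x)\<^sup>2) \<le> (\<integral>\<^sup>+ y. ennreal ((u (x + h *\<^sub>R y))\<^sup>2) \<partial>ball_measure)"
    unfolding ball_average_def
    by (intro square_integral_le_nn_integral emeasure_ball_measure) measurable
  also have "\<dots> \<le> ennreal (ball_volume_inv TYPE('a) * h powr - real DIM('a)) * (\<integral>\<^sup>+ y. ennreal ((u y)\<^sup>2) \<partial>lborel)"
    using \<open>h > 0\<close> by (intro nn_integral_ball_measure_le[of "\<lambda>z. ennreal ((u z)\<^sup>2)"]) auto
  also have "\<dots> = ennreal (ball_volume_inv TYPE('a) * h powr - real DIM('a) * (LINT y|lborel. (u y)\<^sup>2))"
    using ball_volume_inv_pos[where 'a='a]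
    by (simp add: sobolev_pair_square_nn_integral[OF s] ennreal_mult'[symmetric])
  finally show ?thesis
    using ball_volume_inv_pos[where 'a='a] by (subst (asm) ennreal_le_iff) auto
qed

text \<open>Averaging turns the \<open>L\<^sup>2\<close> estimate for translates into a pointwise Lipschitz bound, because the
  difference of two averages is the average of a difference of translates.\<close>

lemma ball_average_equicontinuous:
  fixes u :: "'a::euclidean_space \<Rightarrow> real"
  assumes s: "sobolev_pair u g" and "h > 0"
  shows "\<bar>ball_average h u x - ball_average h u x'\<bar>
    \<le> sqrt (ball_volume_inv TYPE('a) * (LINT y|lborel. (norm (g y))\<^sup>2)) * h powr - (real DIM('a) / 2) * norm (x - x')"
proof -
  note [measurable] = sobolev_pairD(1)[OF s]
  let ?G = "LINT y|lborel. (norm (g y))\<^sup>2" and ?k = "ball_volume_inv TYPE('a)"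
  have k: "?k > 0" by (rule ball_volume_inv_pos)
  have "ball_average h u x - ball_average h u x' = (LINT y|ball_measure. u (x + h *\<^sub>R y) - u (x' + h *\<^sub>R y))"
    unfolding ball_average_def using ball_average_integrable[OF assms] by simp
  then have "ennreal ((ball_average h u x - ball_average h u x')\<^sup>2)
      \<le> (\<integral>\<^sup>+ y. ennreal ((u (x + h *\<^sub>R y) - u (x' + h *\<^sub>R y))\<^sup>2) \<partial>ball_measure)"
    by (simp only:, intro square_integral_le_nn_integral emeasure_ball_measure) measurable
  also have "\<dots> = (\<integral>\<^sup>+ y. ennreal ((u (x' + h *\<^sub>R y + (x - x')) - u (x' + h *\<^sub>R y))\<^sup>2) \<partial>ball_measure)"
    by (simp add: algebra_simps)
  also have "\<dots> \<le> ennreal (?k * h powr - real DIM('a)) * (\<integral>\<^sup>+ y. ennreal ((u (y + (x - x')) - u y)\<^sup>2) \<partial>lborel)"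
    using \<open>h > 0\<close>
    by (intro nn_integral_ball_measure_le[of "\<lambda>z. ennreal ((u (z + (x - x')) - u z)\<^sup>2)"]) auto
  also have "\<dots> \<le> ennreal (?k * h powr - real DIM('a)) * ennreal ((norm (x - x'))\<^sup>2 * ?G)"
    by (intro mult_left_mono translation_estimate[OF s]) auto
  also have "\<dots> = ennreal (?k * h powr - real DIM('a) * ((norm (x - x'))\<^sup>2 * ?G))"
    using k by (simp add: ennreal_mult'[symmetric])
  finally have "(ball_average h u x - ball_average h u x')\<^sup>2 \<le> ?k * h powr - real DIM('a) * ((norm (x - x'))\<^sup>2 * ?G)"
    using k by (subst (asm) ennreal_le_iff) auto
  also have "h powr - real DIM('a) = (h powr - (real DIM('a) / 2))\<^sup>2"
    by (simp add: power2_eq_square powr_add[symmetric])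
  also have "?k * (h powr - (real DIM('a) / 2))\<^sup>2 * ((norm (x - x'))\<^sup>2 * ?G) =
      (sqrt (?k * ?G) * h powr - (real DIM('a) / 2) * norm (x - x'))\<^sup>2"
    using k by (simp add: power_mult_distrib)
  finally show ?thesis
    using k by (intro abs_le_square_iff[THEN iffD2, THEN order_trans[OF _ eq_refl]]) (auto simp: abs_of_nonneg)
qed

text \<open>The distance of a function to its average over balls of radius \<open>h\<close> is an average of
  translation errors of length at most \<open>h\<close>.\<close>

lemma ball_average_error:
  fixes u :: "'a::euclidean_space \<Rightarrow> real"
  assumes s: "sobolev_pair u g" and "h > 0"
  shows "(\<integral>\<^sup>+ x. ennreal ((u x - ball_average h u x)\<^sup>2) \<partial>lborel)
    \<le> ennreal (h\<^sup>2 * (LINT y|lborel. (norm (g y))\<^sup>2))"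
proof -
  interpret B: finite_measure "ball_measure :: 'a measure" by (rule finite_measure_ball_measure)
  interpret pair_sigma_finite "lborel :: 'a measure" "ball_measure :: 'a measure" ..
  note [measurable] = sobolev_pairD(1)[OF s]
  let ?G = "LINT y|lborel. (norm (g y))\<^sup>2"
  have B1: "measure (ball_measure :: 'a measure) (space ball_measure) = 1"
    by (simp add: measure_def emeasure_ball_measure)
  have "u x - ball_average h u x = (LINT y|ball_measure. u x - u (x + h *\<^sub>R y))" for x
    unfolding ball_average_def using ball_average_integrable[OF assms] B1 by simp
  then have "ennreal ((u x - ball_average h u x)\<^sup>2)
      \<le> (\<integral>\<^sup>+ y. ennreal ((u x - u (x + h *\<^sub>R y))\<^sup>2) \<partial>ball_measure)" for x
    by (simp only:, intro square_integral_le_nn_integral emeasure_ball_measure) measurable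
  then have "(\<integral>\<^sup>+ x. ennreal ((u x - ball_average h u x)\<^sup>2) \<partial>lborel)
      \<le> (\<integral>\<^sup>+ x. \<integral>\<^sup>+ y. ennreal ((u x - u (x + h *\<^sub>R y))\<^sup>2) \<partial>ball_measure \<partial>lborel)"
    by (intro nn_integral_mono)
  also have "\<dots> = (\<integral>\<^sup>+ y. \<integral>\<^sup>+ x. ennreal ((u x - u (x + h *\<^sub>R y))\<^sup>2) \<partial>lborel \<partial>ball_measure)"
    by (rule Fubini'[symmetric]) measurable
  also have "\<dots> \<le> (\<integral>\<^sup>+ y. ennreal (h\<^sup>2 * ?G) \<partial>(ball_measure :: 'a measure))"
  proof (rule nn_integral_mono_AE, rule AE_mp[OF AE_ball_measure], intro AE_I2 impI)
    fix y :: 'a assume "norm y < 1"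
    have "(\<integral>\<^sup>+ x. ennreal ((u x - u (x + h *\<^sub>R y))\<^sup>2) \<partial>lborel) \<le> ennreal ((norm (h *\<^sub>R y))\<^sup>2 * ?G)"
      using translation_estimate[OF s, of "h *\<^sub>R y"] by (simp add: power2_commute)
    also have "\<dots> \<le> ennreal (h\<^sup>2 * ?G)"
      using \<open>norm y < 1\<close> \<open>h > 0\<close>
      by (intro ennreal_leI mult_right_mono power_mono) (auto simp: mult_left_le)
    finally show "(\<integral>\<^sup>+ x. ennreal ((u x - u (x + h *\<^sub>R y))\<^sup>2) \<partial>lborel) \<le> ennreal (h\<^sup>2 * ?G)" .
  qed
  also have "\<dots> = ennreal (h\<^sup>2 * ?G)"
    by (simp add: emeasure_ball_measure)
  finally show ?thesis .
qed

lemma ball_average_commute: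
  fixes u :: "'a::euclidean_space \<Rightarrow> real"
  assumes s: "sobolev_pair u g" and "h > 0" "k > 0"
  shows "ball_average h (ball_average k u) x = ball_average k (ball_average h u) x"
proof -
  note [measurable] = sobolev_pairD(1)[OF s]
  interpret B: finite_measure "ball_measure :: 'a measure" by (rule finite_measure_ball_measure)
  let ?k = "ball_volume_inv TYPE('a)"
  have "(LINT y|ball_measure. (LINT z|ball_measure. u (x + h *\<^sub>R y + k *\<^sub>R z))) =
      (LINT z|ball_measure. (LINT y|ball_measure. u (x + h *\<^sub>R y + k *\<^sub>R z)))"
  proof (rule Fubini_uniformly_integrable[OF B.sigma_finite_measure_axioms finite_measure_ball_measure])
    show "(\<lambda>(y, z). u (x + h *\<^sub>R y + k *\<^sub>R z)) \<in> borel_measurable (ball_measure \<Otimes>\<^sub>M ball_measure)"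
      by measurable
    fix z :: 'a
    have "(\<integral>\<^sup>+ y. ennreal \<bar>u (x + h *\<^sub>R y + k *\<^sub>R z)\<bar> \<partial>ball_measure)
        \<le> (\<integral>\<^sup>+ y. 1 + ennreal ((u ((x + k *\<^sub>R z) + h *\<^sub>R y))\<^sup>2) \<partial>ball_measure)"
    proof (intro nn_integral_mono)
      fix y
      have "\<bar>a\<bar> \<le> 1 + a\<^sup>2" for a :: real
        using sum_squares_bound[of 1 "\<bar>a\<bar>"] by auto
      then have "ennreal \<bar>u (x + h *\<^sub>R y + k *\<^sub>R z)\<bar> \<le> ennreal (1 + (u (x + h *\<^sub>R y + k *\<^sub>R z))\<^sup>2)"
        by (rule ennreal_leI)
      then show "ennreal \<bar>u (x + h *\<^sub>R y + k *\<^sub>R z)\<bar> \<le> 1 + ennreal ((u ((x + k *\<^sub>R z) + h *\<^sub>R y))\<^sup>2)"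
        by (simp add: algebra_simps)
    qed
    also have "\<dots> = 1 + (\<integral>\<^sup>+ y. ennreal ((u ((x + k *\<^sub>R z) + h *\<^sub>R y))\<^sup>2) \<partial>ball_measure)"
      by (subst nn_integral_add) (auto simp: emeasure_ball_measure)
    also have "\<dots> \<le> 1 + ennreal (?k * h powr - real DIM('a)) * (\<integral>\<^sup>+ y. ennreal ((u y)\<^sup>2) \<partial>lborel)"
      using \<open>h > 0\<close> by (intro add_left_mono nn_integral_ball_measure_le[of "\<lambda>z. ennreal ((u z)\<^sup>2)"]) auto
    also have "\<dots> = ennreal (1 + ?k * h powr - real DIM('a) * (LINT y|lborel. (u y)\<^sup>2))"
      using ball_volume_inv_pos[where 'a='a]
      by (simp add: sobolev_pair_square_nn_integral[OF s] ennreal_mult'[symmetric])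
    finally show "(\<integral>\<^sup>+ y. ennreal \<bar>u (x + h *\<^sub>R y + k *\<^sub>R z)\<bar> \<partial>ball_measure)
      \<le> ennreal (1 + ?k * h powr - real DIM('a) * (LINT y|lborel. (u y)\<^sup>2))" .
  qed
  then show ?thesis
    by (simp add: ball_average_def add_ac)
qed

lemma ball_average_near:
  fixes f :: "'a::euclidean_space \<Rightarrow> real"
  assumes [measurable]: "f \<in> borel_measurable borel" and "h > 0"
    and L: "\<And>y. norm y \<le> h \<Longrightarrow> \<bar>f (x + y) - f x\<bar> \<le> L"
  shows "\<bar>ball_average h f x - f x\<bar> \<le> L"
proof -
  interpret B: finite_measure "ball_measure :: 'a measure" by (rule finite_measure_ball_measure)
  have B1: "measure (ball_measure :: 'a measure) (space ball_measure) = 1"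
    by (simp add: measure_def emeasure_ball_measure)
  have AE: "AE y in ball_measure. norm (f (x + h *\<^sub>R y) - f x) \<le> L"
  proof (rule AE_mp[OF AE_ball_measure], intro AE_I2 impI)
    fix y :: 'a assume "norm y < 1"
    then have "norm (h *\<^sub>R y) \<le> h" using \<open>h > 0\<close> by (simp add: mult_left_le)
    then show "norm (f (x + h *\<^sub>R y) - f x) \<le> L" using L[of "h *\<^sub>R y"] by simp
  qed
  have i: "integrable ball_measure (\<lambda>y. f (x + h *\<^sub>R y) - f x)"
    by (rule B.integrable_const_bound[OF AE]) measurable
  then have "integrable ball_measure (\<lambda>y. (f (x + h *\<^sub>R y) - f x) + f x)"
    by (intro Bochner_Integration.integrable_add) auto
  then have "ball_average h f x - f x = (LINT y|ball_measure. f (x + h *\<^sub>R y) - f x)"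
    unfolding ball_average_def using B1 by simp
  also have "\<bar>\<dots>\<bar> \<le> (LINT y|ball_measure. norm (f (x + h *\<^sub>R y) - f x))"
    using integral_norm_bound[of ball_measure "\<lambda>y. f (x + h *\<^sub>R y) - f x"] by simp
  also have "\<dots> \<le> (LINT y|(ball_measure :: 'a measure). L)"
    by (rule integral_mono_AE[OF _ _ AE]) (use i in auto)
  finally show ?thesis using B1 by simp
qed

section \<open>The subcritical Sobolev embedding\<close>

text \<open>Smoothing by a ball of radius \<open>k\<close> turns \<open>u\<close>
  into a Lipschitz function with constant of order \<open>k powr (- N / 2)\<close>, so averaging it again at
  scale \<open>h\<close> moves it by at most \<open>h * k powr (- N / 2)\<close>; and the two averages commute.\<close>

lemma ball_average_difference:
  fixes u :: "'a::euclidean_space \<Rightarrow> real"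
  assumes s: "sobolev_pair u g" and "h > 0" "k > 0"
  shows "\<bar>ball_average h u x - ball_average k u x\<bar>
    \<le> sqrt (ball_volume_inv TYPE('a) * (LINT y|lborel. (norm (g y))\<^sup>2))
        * (k powr - (real DIM('a) / 2) * h + h powr - (real DIM('a) / 2) * k)"
proof -
  note [measurable] = sobolev_pairD(1)[OF s]
  let ?c = "sqrt (ball_volume_inv TYPE('a) * (LINT y|lborel. (norm (g y))\<^sup>2))"
  have c: "?c \<ge> 0"
    using ball_volume_inv_pos[where 'a='a] by simp
  have near: "\<bar>ball_average h (ball_average k u) x - ball_average k u x\<bar>
      \<le> ?c * k powr - (real DIM('a) / 2) * h" if "h > 0" "k > 0" for h k
  proof (rule ball_average_near)
    fix y :: 'a assume "norm y \<le> h"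
    have "\<bar>ball_average k u (x + y) - ball_average k u x\<bar>
        \<le> ?c * k powr - (real DIM('a) / 2) * norm ((x + y) - x)"
      by (rule ball_average_equicontinuous[OF s \<open>k > 0\<close>])
    also have "\<dots> \<le> ?c * k powr - (real DIM('a) / 2) * h"
      using \<open>norm y \<le> h\<close> c by (intro mult_left_mono) auto
    finally show "\<bar>ball_average k u (x + y) - ball_average k u x\<bar>
        \<le> ?c * k powr - (real DIM('a) / 2) * h" .
  qed (use that in auto)
  have "\<bar>ball_average h u x - ball_average k u x\<bar>
      \<le> \<bar>ball_average h (ball_average k u) x - ball_average k u x\<bar> +
        \<bar>ball_average k (ball_average h u) x - ball_average h u x\<bar>"
    using ball_average_commute[OF s assms(2,3), of x] by linarith
  also have "\<dots> \<le> ?c * k powr - (real DIM('a) / 2) * h + ?c * h powr - (real DIM('a) / 2) * k"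
    by (intro add_mono near assms(2,3))
  finally show ?thesis by (simp add: algebra_simps)
qed

definition dyadic_average :: "nat \<Rightarrow> ('a::euclidean_space \<Rightarrow> real) \<Rightarrow> 'a \<Rightarrow> real" where
  "dyadic_average j = ball_average (2 powr - real j)"

text \<open>The step from one dyadic scale to the next costs a constant times \<open>2 powr (j * (N / 2 - 1))\<close>,
  and these costs add up to at most a geometric growth with any positive rate \<open>\<theta> \<ge> N / 2 - 1\<close>.\<close>

lemma dyadic_average_growth:
  fixes \<theta> R :: real
  assumes "\<theta> > 0" "\<theta> \<ge> real DIM('a::euclidean_space) / 2 - 1" "R > 0"
  obtains K where "K > 0" "\<And>u g j (x::'a). sobolev_pair u g \<Longrightarrow>
    (LINT y|lborel. (u y)\<^sup>2) \<le> R\<^sup>2 \<Longrightarrow> (LINT y|lborel. (norm (g y))\<^sup>2) \<le> R\<^sup>2 \<Longrightarrow>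
    \<bar>dyadic_average j u x\<bar> \<le> K * 2 powr (\<theta> * j)"
proof -
  define n where "n = real DIM('a) / 2"
  define b where "b = sqrt (ball_volume_inv TYPE('a)) * R"
  define C where "C = b * (2 powr n + 1)"
  \<comment> \<open>With this \<open>K\<close> the increment \<open>C * 2 powr (\<theta> * j)\<close> is at most the growth of \<open>K * 2 powr (\<theta> * j)\<close> from \<open>j\<close> to \<open>j + 1\<close>.\<close>
  define K where "K = b + C / (2 powr \<theta> - 1)"
  have k: "ball_volume_inv TYPE('a) > 0" by (rule ball_volume_inv_pos)
  have "b > 0" using k \<open>R > 0\<close> by (simp add: b_def)
  have "C > 0" using \<open>b > 0\<close> by (simp add: C_def add_pos_pos)
  have t: "2 powr \<theta> - 1 > 0" using \<open>\<theta> > 0\<close> by simp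
  have "K > 0" using \<open>b > 0\<close> \<open>C > 0\<close> t by (simp add: K_def add_pos_pos)
  moreover have "\<bar>dyadic_average j u x\<bar> \<le> K * 2 powr (\<theta> * j)"
    if s: "sobolev_pair u g" and u: "(LINT y|lborel. (u y)\<^sup>2) \<le> R\<^sup>2"
      and g: "(LINT y|lborel. (norm (g y))\<^sup>2) \<le> R\<^sup>2" for u g j and x :: 'a
  proof (induction j)
    case 0
    have "(dyadic_average 0 u x)\<^sup>2 \<le> ball_volume_inv TYPE('a) * (LINT y|lborel. (u y)\<^sup>2)"
      using ball_average_bound[OF s, of 1 x] by (simp add: dyadic_average_def)
    also have "\<dots> \<le> b\<^sup>2"
      using u k by (simp add: b_def power_mult_distrib)
    finally have "\<bar>dyadic_average 0 u x\<bar> \<le> b"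
      using \<open>b > 0\<close> by (simp add: abs_le_square_iff[symmetric])
    also have "b \<le> K" using \<open>C > 0\<close> t by (simp add: K_def)
    finally show ?case by simp
  next
    case (Suc j)
    let ?h = "2 powr - real (Suc j)" and ?k = "2 powr - real j"
    have sq: "sqrt (ball_volume_inv TYPE('a) * (LINT y|lborel. (norm (g y))\<^sup>2)) \<le> b"
    proof -
      have "sqrt (ball_volume_inv TYPE('a) * (LINT y|lborel. (norm (g y))\<^sup>2))
          \<le> sqrt (ball_volume_inv TYPE('a) * R\<^sup>2)"
        using g k by simp
      then show ?thesis using \<open>R > 0\<close> by (simp add: b_def real_sqrt_mult)
    qed
    have "\<bar>dyadic_average (Suc j) u x - dyadic_average j u x\<bar>
      \<le> sqrt (ball_volume_inv TYPE('a) * (LINT y|lborel. (norm (g y))\<^sup>2))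
          * (?k powr - n * ?h + ?h powr - n * ?k)"
      unfolding dyadic_average_def n_def by (rule ball_average_difference[OF s]) auto
    also have "\<dots> \<le> b * (?k powr - n * ?h + ?h powr - n * ?k)"
      by (intro mult_right_mono sq) simp
    also have "?k powr - n * ?h + ?h powr - n * ?k \<le> (2 powr n + 1) * 2 powr (\<theta> * j)"
    proof -
      have "?k powr - n * ?h = 2 powr (n * j - j - 1)" "?h powr - n * ?k = 2 powr n * 2 powr (n * j - j)"
        by (simp_all add: powr_powr powr_add[symmetric] algebra_simps)
      moreover have "2 powr (n * j - j - 1) \<le> 2 powr (n * j - j)" by simp
      moreover have le: "2 powr (n * j - j) \<le> 2 powr (\<theta> * j)"
      proof -
        have "(n - 1) * real j \<le> \<theta> * real j"
          using assms(2) by (intro mult_right_mono) (auto simp: n_def)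
        then show ?thesis by (simp add: algebra_simps)
      qed
      moreover have "2 powr n * 2 powr (n * j - j) \<le> 2 powr n * 2 powr (\<theta> * j)"
        by (intro mult_left_mono le) auto
      ultimately have "?k powr - n * ?h + ?h powr - n * ?k \<le> 2 powr (\<theta> * j) + 2 powr n * 2 powr (\<theta> * j)"
        by linarith
      then show ?thesis by (simp add: distrib_right)
    qed
    finally have "\<bar>dyadic_average (Suc j) u x - dyadic_average j u x\<bar> \<le> C * 2 powr (\<theta> * j)"
      using \<open>b > 0\<close> by (simp add: C_def mult.assoc)
    with Suc have "\<bar>dyadic_average (Suc j) u x\<bar> \<le> (K + C) * 2 powr (\<theta> * j)"
      by (simp add: distrib_right)
    also have "\<dots> \<le> (K * 2 powr \<theta>) * 2 powr (\<theta> * j)"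
    proof (rule mult_right_mono)
      have "C \<le> K * (2 powr \<theta> - 1)"
      proof -
        define T where "T = 2 powr \<theta> - 1"
        have "K * T = b * T + C" "T > 0"
          using t by (simp_all add: K_def T_def[symmetric] distrib_right)
        then show ?thesis
          using \<open>b > 0\<close> by (simp add: T_def)
      qed
      then show "K + C \<le> K * 2 powr \<theta>" by (simp add: algebra_simps)
    qed simp
    also have "\<dots> = K * 2 powr (\<theta> * Suc j)"
      by (simp add: powr_add[symmetric] algebra_simps)
    finally show ?case .
  qed
  ultimately show ?thesis by (rule that)
qed

lemma dyadic_average_error:
  fixes u :: "'a::euclidean_space \<Rightarrow> real"
  assumes s: "sobolev_pair u g" and g: "(LINT y|lborel. (norm (g y))\<^sup>2) \<le> R\<^sup>2"
  shows "(\<integral>\<^sup>+ x. ennreal ((u x - dyadic_average j u x)\<^sup>2) \<partial>lborel) \<le> ennreal ((1/4) ^ j * R\<^sup>2)"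
proof -
  have "(\<integral>\<^sup>+ x. ennreal ((u x - dyadic_average j u x)\<^sup>2) \<partial>lborel)
      \<le> ennreal ((2 powr - real j)\<^sup>2 * (LINT y|lborel. (norm (g y))\<^sup>2))"
    unfolding dyadic_average_def by (rule ball_average_error[OF s]) simp
  also have "(2 powr - real j)\<^sup>2 = (1/4 :: real) ^ j"
    by (simp add: powr_minus powr_realpow power2_eq_square inverse_eq_divide power_divide
        power_mult_distrib[symmetric])
  also have "ennreal ((1/4) ^ j * (LINT y|lborel. (norm (g y))\<^sup>2)) \<le> ennreal ((1/4) ^ j * R\<^sup>2)"
    using g by (intro ennreal_leI mult_left_mono) auto
  finally show ?thesis .
qed

text \<open>Where \<open>|u|\<close> lies between \<open>2 * K * 2 powr (\<theta> * j)\<close> and \<open>2 * K * 2 powr (\<theta> * (j + 1))\<close>, the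
  \<open>j\<close>-th dyadic average is at most half of \<open>|u|\<close>, hence \<open>|u|\<close> is at most twice the averaging error, whose \<open>L\<^sup>2\<close> norm decays
  like \<open>2 powr (- j)\<close>. Summing over \<open>j\<close> gives a geometric series precisely when \<open>\<theta> (q - 2) < 2\<close>, and an
  admissible positive \<open>\<theta> \<ge> N / 2 - 1\<close> with this property exists precisely below the critical exponent.\<close>

lemma sobolev_embedding:
  fixes q R :: real
  assumes q: "2 < q" "ereal q < critical_exponent DIM('a::euclidean_space)" and "R > 0"
    and N: "DIM('a) \<ge> 2"
  obtains B where "\<And>(u :: 'a \<Rightarrow> real) g. sobolev_pair u g \<Longrightarrow>
    (LINT y|lborel. (u y)\<^sup>2) \<le> R\<^sup>2 \<Longrightarrow> (LINT y|lborel. (norm (g y))\<^sup>2) \<le> R\<^sup>2 \<Longrightarrow>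
    (\<integral>\<^sup>+ x. ennreal (\<bar>u x\<bar> powr q) \<partial>lborel) \<le> ennreal B"
proof -
  define n where "n = real DIM('a) / 2 - 1"
  \<comment> \<open>In dimension two \<open>n = 0\<close>, and any small positive \<open>\<theta>\<close> will do.\<close>
  have "\<exists>\<theta>>0. \<theta> \<ge> n \<and> \<theta> * (q - 2) < 2"
  proof (cases "DIM('a) = 2")
    case True
    then show ?thesis
      using q by (intro exI[of _ "1 / (q - 2)"]) (auto simp: n_def)
  next
    case False
    then have "real DIM('a) > 2" using N by simp
    then have "q < 2 * real DIM('a) / (real DIM('a) - 2)"
      using q(2) False N by (simp add: critical_exponent_def split: if_splits)
    then have "q * (real DIM('a) - 2) < 2 * real DIM('a)"
      using \<open>real DIM('a) > 2\<close> by (simp add: pos_less_divide_eq)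
    then have "n * (q - 2) < 2" by (simp add: n_def field_simps)
    then show ?thesis
      using \<open>real DIM('a) > 2\<close> by (intro exI[of _ n]) (auto simp: n_def)
  qed
  then obtain \<theta> where \<theta>: "\<theta> > 0" "\<theta> \<ge> real DIM('a) / 2 - 1" "\<theta> * (q - 2) < 2"
    by (auto simp: n_def)
  obtain K where K: "K > 0" "\<And>u g j (x::'a). sobolev_pair u g \<Longrightarrow>
    (LINT y|lborel. (u y)\<^sup>2) \<le> R\<^sup>2 \<Longrightarrow> (LINT y|lborel. (norm (g y))\<^sup>2) \<le> R\<^sup>2 \<Longrightarrow>
    \<bar>dyadic_average j u x\<bar> \<le> K * 2 powr (\<theta> * j)"
    using dyadic_average_growth[OF \<theta>(1,2) \<open>R > 0\<close>] by metis
  \<comment> \<open>\<open>c j\<close> bounds \<open>|u| powr (q - 2)\<close> on the \<open>j\<close>-th level set, times the factor \<open>4\<close> from the squared averaging error;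
    \<open>d\<close> is the ratio of the resulting geometric series.\<close>
  define c where "c j = 4 * (2 * K * 2 powr (\<theta> * Suc j)) powr (q - 2)" for j :: nat
  define d where "d = 2 powr (\<theta> * (q - 2)) / 4"
  have "2 powr (\<theta> * (q - 2)) < 2 powr 2" using \<theta>(3) by (subst powr_less_cancel_iff) auto
  then have d: "0 \<le> d" "d < 1" by (simp_all add: d_def)
  have cd: "c j * ((1/4) ^ j * R\<^sup>2) = (c 0 * R\<^sup>2) * d ^ j" for j
  proof -
    have "c j = 4 * ((2 * K) powr (q - 2) * 2 powr (\<theta> * Suc j * (q - 2)))" for j
      using \<open>K > 0\<close> by (simp add: c_def powr_mult powr_powr)
    moreover have "2 powr (\<theta> * Suc j * (q - 2)) = 2 powr (\<theta> * (q - 2)) * (2 powr (\<theta> * (q - 2))) ^ j"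
      by (simp add: powr_realpow[symmetric] powr_powr powr_add[symmetric] algebra_simps)
    ultimately show ?thesis by (simp add: d_def power_divide field_simps)
  qed
  have c: "c j \<ge> 0" for j by (simp add: c_def)
  have sum: "summable (\<lambda>j. (c 0 * R\<^sup>2) * d ^ j)"
    using d by (intro summable_mult summable_geometric) auto
  have "(\<integral>\<^sup>+ x. ennreal (\<bar>u x\<bar> powr q) \<partial>lborel)
      \<le> ennreal ((2 * K) powr (q - 2) * R\<^sup>2 + (\<Sum>j. (c 0 * R\<^sup>2) * d ^ j))"
    if s: "sobolev_pair u g" and u: "(LINT y|lborel. (u y)\<^sup>2) \<le> R\<^sup>2"
      and g: "(LINT y|lborel. (norm (g y))\<^sup>2) \<le> R\<^sup>2" for u :: "'a \<Rightarrow> real" and g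
  proof -
    note [measurable] = sobolev_pairD(1)[OF s]
    have [measurable]: "dyadic_average j u \<in> borel_measurable borel" for j
      unfolding dyadic_average_def by measurable
    let ?e = "\<lambda>j x. ennreal (c j) * ennreal ((u x - dyadic_average j u x)\<^sup>2)"
    have pw: "ennreal (\<bar>u x\<bar> powr q)
        \<le> ennreal ((2 * K) powr (q - 2)) * ennreal ((u x)\<^sup>2) + (\<Sum>j. ?e j x)" for x
    proof -
      have split: "\<bar>u x\<bar> powr q = \<bar>u x\<bar> powr (q - 2) * (u x)\<^sup>2"
      proof (cases "u x = 0")
        case False
        then show ?thesis
          using powr_add[of "\<bar>u x\<bar>" "q - 2" 2] by simp
      qed simp
      show ?thesis
      proof (cases "\<bar>u x\<bar> \<le> 2 * K")
        case True
        then have "\<bar>u x\<bar> powr q \<le> (2 * K) powr (q - 2) * (u x)\<^sup>2"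
          unfolding split using q by (intro mult_right_mono powr_mono2) auto
        then have "ennreal (\<bar>u x\<bar> powr q) \<le> ennreal ((2 * K) powr (q - 2)) * ennreal ((u x)\<^sup>2)"
          by (simp add: ennreal_mult'[symmetric] ennreal_leI)
        then show ?thesis by (rule order_trans) simp
      next
        case False
        have "\<exists>i::nat. \<bar>u x\<bar> \<le> 2 * K * 2 powr (\<theta> * i)"
        proof -
          obtain i :: nat where i: "\<bar>u x\<bar> / (2 * K) < (2 powr \<theta>) ^ i"
            using real_arch_pow[of "2 powr \<theta>" "\<bar>u x\<bar> / (2 * K)"] \<theta>(1) by auto
          then have "\<bar>u x\<bar> < (2 powr \<theta>) ^ i * (2 * K)"
            using \<open>K > 0\<close> by (simp add: pos_divide_less_eq)
          also have "(2 powr \<theta>) ^ i = 2 powr (\<theta> * i)"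
            by (simp add: powr_realpow[symmetric] powr_powr)
          finally show ?thesis by (intro exI[of _ i]) (simp add: mult_ac)
        qed
        then obtain i :: nat where i: "\<bar>u x\<bar> \<le> 2 * K * 2 powr (\<theta> * i)"
          and least: "\<And>m::nat. m < i \<Longrightarrow> \<not> \<bar>u x\<bar> \<le> 2 * K * 2 powr (\<theta> * m)"
          using exists_least_iff[of "\<lambda>i::nat. \<bar>u x\<bar> \<le> 2 * K * 2 powr (\<theta> * i)"] by blast
        have "i \<noteq> 0" using i False by (intro notI) simp
        then obtain j where j: "i = Suc j" by (cases i) auto
        have "K * 2 powr (\<theta> * j) \<le> \<bar>u x\<bar> / 2"
          using least[of j] j by simp
        with K(2)[OF s u g, of j x] have "\<bar>dyadic_average j u x\<bar> \<le> \<bar>u x\<bar> / 2"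
          by (rule order_trans)
        then have "\<bar>u x\<bar> \<le> 2 * \<bar>u x - dyadic_average j u x\<bar>"
          using abs_triangle_ineq[of "u x - dyadic_average j u x" "dyadic_average j u x"] by simp
        then have "(u x)\<^sup>2 \<le> 4 * (u x - dyadic_average j u x)\<^sup>2"
          using power_mono[of "\<bar>u x\<bar>" "2 * \<bar>u x - dyadic_average j u x\<bar>" 2]
          by (simp add: power_mult_distrib)
        then have "\<bar>u x\<bar> powr q \<le> (2 * K * 2 powr (\<theta> * i)) powr (q - 2) * (4 * (u x - dyadic_average j u x)\<^sup>2)"
          unfolding split using i q by (intro mult_mono powr_mono2) auto
        then have "ennreal (\<bar>u x\<bar> powr q) \<le> ?e j x"
          using c[of j] by (simp add: ennreal_mult'[symmetric] ennreal_leI c_def j mult_ac)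
        also have "\<dots> = (\<Sum>j\<in>{j}. ?e j x)" by simp
        also have "\<dots> \<le> (\<Sum>j. ?e j x)" by (rule sum_le_suminf) auto
        finally show ?thesis by (rule order_trans) simp
      qed
    qed
    have "(\<integral>\<^sup>+ x. ennreal (\<bar>u x\<bar> powr q) \<partial>lborel)
        \<le> (\<integral>\<^sup>+ x. ennreal ((2 * K) powr (q - 2)) * ennreal ((u x)\<^sup>2) + (\<Sum>j. ?e j x) \<partial>lborel)"
      by (intro nn_integral_mono pw)
    also have "\<dots> = ennreal ((2 * K) powr (q - 2)) * (\<integral>\<^sup>+ x. ennreal ((u x)\<^sup>2) \<partial>lborel)
        + (\<Sum>j. \<integral>\<^sup>+ x. ?e j x \<partial>lborel)"
      by (simp add: nn_integral_add nn_integral_cmult nn_integral_suminf)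
    also have "\<dots> \<le> ennreal ((2 * K) powr (q - 2)) * ennreal (R\<^sup>2) + (\<Sum>j. ennreal ((c 0 * R\<^sup>2) * d ^ j))"
    proof (intro add_mono mult_left_mono suminf_le)
      show "(\<integral>\<^sup>+ x. ennreal ((u x)\<^sup>2) \<partial>lborel) \<le> ennreal (R\<^sup>2)"
        using u by (simp add: sobolev_pair_square_nn_integral[OF s] ennreal_leI)
      fix j
      have "(\<integral>\<^sup>+ x. ?e j x \<partial>lborel) = ennreal (c j) * (\<integral>\<^sup>+ x. ennreal ((u x - dyadic_average j u x)\<^sup>2) \<partial>lborel)"
        by (rule nn_integral_cmult) measurable
      also have "\<dots> \<le> ennreal (c j) * ennreal ((1/4) ^ j * R\<^sup>2)"
        by (intro mult_left_mono dyadic_average_error[OF s g]) auto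
      also have "\<dots> = ennreal ((c 0 * R\<^sup>2) * d ^ j)"
        by (simp only: cd[symmetric] ennreal_mult'[OF c])
      finally show "(\<integral>\<^sup>+ x. ?e j x \<partial>lborel) \<le> ennreal ((c 0 * R\<^sup>2) * d ^ j)" .
    qed auto
    also have "(\<Sum>j. ennreal ((c 0 * R\<^sup>2) * d ^ j)) = ennreal (\<Sum>j. (c 0 * R\<^sup>2) * d ^ j)"
      using sum c[of 0] d by (intro suminf_ennreal2) auto
    also have "ennreal ((2 * K) powr (q - 2)) * ennreal (R\<^sup>2) + ennreal (\<Sum>j. (c 0 * R\<^sup>2) * d ^ j) =
        ennreal ((2 * K) powr (q - 2) * R\<^sup>2 + (\<Sum>j. (c 0 * R\<^sup>2) * d ^ j))"
      using sum c[of 0] d by (subst ennreal_plus) (auto simp: ennreal_mult' intro!: suminf_nonneg)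
    finally show ?thesis .
  qed
  then show ?thesis by (rule that)
qed

section \<open>Almost everywhere convergent subsequences\<close>

lemma abs_mult_le_weighted:
  fixes w a \<delta> :: real
  assumes "0 \<le> w" "w \<le> 1" "\<delta> > 0"
  shows "w * \<bar>a\<bar> \<le> \<delta> * w + a\<^sup>2 / \<delta>"
proof -
  have "w * \<bar>a\<bar> \<le> w * (\<delta> + a\<^sup>2 / \<delta>)"
  proof (intro mult_left_mono)
    have "0 \<le> \<delta> * \<bar>a\<bar>" using assms by simp
    then have "\<delta> * \<bar>a\<bar> \<le> \<delta>\<^sup>2 + \<bar>a\<bar>\<^sup>2" using sum_squares_bound[of \<delta> "\<bar>a\<bar>"] by linarith
    then show "\<bar>a\<bar> \<le> \<delta> + a\<^sup>2 / \<delta>"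
      using \<open>\<delta> > 0\<close> by (simp add: field_simps power2_eq_square)
  qed (use assms in auto)
  also have "\<dots> \<le> \<delta> * w + a\<^sup>2 / \<delta>"
    using assms mult_right_mono[of w 1 "a\<^sup>2 / \<delta>"] by (simp add: distrib_left mult.commute)
  finally show ?thesis .
qed

text \<open>An integrable weight between \<open>0\<close> and \<open>1\<close> makes \<open>L\<^sup>2\<close> convergence imply \<open>L\<^sup>1\<close> convergence: choose
  \<open>\<delta>\<close> small first and the \<open>L\<^sup>2\<close> norm small afterwards.\<close>

lemma weighted_L1_of_L2:
  fixes f :: "'b \<Rightarrow> 'c::euclidean_space"
  assumes [measurable]: "f \<in> borel_measurable N" "\<omega> \<in> borel_measurable N"
    and f2: "integrable N (\<lambda>x. (norm (f x))\<^sup>2)"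
    and \<omega>: "\<And>x. 0 < \<omega> x" "\<And>x. \<omega> x \<le> (1::real)" "integrable N \<omega>"
  shows "integrable N (\<lambda>x. \<omega> x *\<^sub>R f x)"
    and "\<delta> > 0 \<Longrightarrow> (LINT x|N. norm (\<omega> x *\<^sub>R f x))
      \<le> \<delta> * (LINT x|N. \<omega> x) + (LINT x|N. (norm (f x))\<^sup>2) / \<delta>"
proof -
  have le: "norm (\<omega> x *\<^sub>R f x) \<le> \<delta> * \<omega> x + (norm (f x))\<^sup>2 / \<delta>" if "\<delta> > 0" for x \<delta>
    using abs_mult_le_weighted[of "\<omega> x" \<delta> "norm (f x)"] \<omega>(1)[of x] \<omega>(2)[of x] that by simp
  have i: "integrable N (\<lambda>x. \<delta> * \<omega> x + (norm (f x))\<^sup>2 / \<delta>)" for \<delta>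
    using f2 \<omega>(3) by simp
  show int: "integrable N (\<lambda>x. \<omega> x *\<^sub>R f x)"
    by (rule Bochner_Integration.integrable_bound[OF i[of 1]])
      (use le[of 1] in \<open>auto intro!: AE_I2 order_trans[OF _ abs_ge_self]\<close>)
  show "(LINT x|N. norm (\<omega> x *\<^sub>R f x)) \<le> \<delta> * (LINT x|N. \<omega> x) + (LINT x|N. (norm (f x))\<^sup>2) / \<delta>"
    if "\<delta> > 0"
  proof -
    have "(LINT x|N. norm (\<omega> x *\<^sub>R f x)) \<le> (LINT x|N. \<delta> * \<omega> x + (norm (f x))\<^sup>2 / \<delta>)"
      by (rule integral_mono[OF integrable_norm[OF int] i le[OF that]])
    then show ?thesis using f2 \<omega>(3) by simp
  qed
qed

text \<open>The averages
  at a fixed scale are bounded and equicontinuous, so a diagonal subsequence makes all of them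
  converge at every point; the averages approximate the functions uniformly in \<open>L\<^sup>2\<close>, so this
  subsequence is Cauchy in \<open>L\<^sup>1\<close> with respect to a finite measure.\<close>

lemma bounded_sobolev_ae_convergent_subsequence:
  fixes u :: "nat \<Rightarrow> 'a::euclidean_space \<Rightarrow> real"
  assumes s: "\<And>k. sobolev_pair (u k) (g k)" and "R > 0"
    and u: "\<And>k. (LINT y|lborel. (u k y)\<^sup>2) \<le> R\<^sup>2"
    and g: "\<And>k. (LINT y|lborel. (norm (g k y))\<^sup>2) \<le> R\<^sup>2"
  obtains r where "strict_mono r" "AE x in lborel. convergent (\<lambda>k. u (r k) x)"
proof -
  note [measurable] = sobolev_pairD(1)[OF s]
  have [measurable]: "dyadic_average j (u k) \<in> borel_measurable borel" for j k
    unfolding dyadic_average_def by measurable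
  let ?k = "ball_volume_inv TYPE('a)"
  have k: "?k > 0" by (rule ball_volume_inv_pos)
  define b where "b j = sqrt (?k * (2 powr - real j) powr - real DIM('a)) * R" for j :: nat
  have b: "b j > 0" for j using k \<open>R > 0\<close> by (simp add: b_def)
  have bound: "\<bar>dyadic_average j (u n) x\<bar> \<le> b j" for j n x
  proof -
    have "(dyadic_average j (u n) x)\<^sup>2 \<le> ?k * (2 powr - real j) powr - real DIM('a) * (LINT y|lborel. (u n y)\<^sup>2)"
      unfolding dyadic_average_def by (rule ball_average_bound[OF s]) simp
    also have "\<dots> \<le> ?k * (2 powr - real j) powr - real DIM('a) * R\<^sup>2"
      using k by (intro mult_left_mono u) auto
    also have "\<dots> = (b j)\<^sup>2" using k by (simp add: b_def power_mult_distrib)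
    finally show ?thesis using b[of j] by (simp add: abs_le_square_iff[symmetric])
  qed
  define l where "l j = sqrt (?k * R\<^sup>2) * (2 powr - real j) powr - (real DIM('a) / 2)" for j :: nat
  have l: "l j > 0" for j using k \<open>R > 0\<close> by (simp add: l_def)
  have lip: "\<bar>dyadic_average j (u n) x - dyadic_average j (u n) y\<bar> \<le> l j * norm (x - y)" for j n x y
  proof -
    have "\<bar>dyadic_average j (u n) x - dyadic_average j (u n) y\<bar>
      \<le> sqrt (?k * (LINT y|lborel. (norm (g n y))\<^sup>2)) * (2 powr - real j) powr - (real DIM('a) / 2) * norm (x - y)"
      unfolding dyadic_average_def by (rule ball_average_equicontinuous[OF s]) simp
    also have "\<dots> \<le> l j * norm (x - y)"
      unfolding l_def using k g by (intro mult_right_mono real_sqrt_le_mono mult_left_mono) auto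
    finally show ?thesis .
  qed
  obtain D :: "'a set" where D: "countable D" "\<And>X. open X \<Longrightarrow> X \<noteq> {} \<Longrightarrow> \<exists>d\<in>D. d \<in> X"
    using countable_dense_exists by metis
  have "countable ((UNIV :: nat set) \<times> D)" using D(1) by blast
  moreover have "norm (dyadic_average (fst z) (u n) (snd z) / b (fst z)) \<le> 1" for n z
    using bound[of "fst z" n "snd z"] b[of "fst z"] by (simp add: divide_le_eq)
  ultimately obtain r :: "nat \<Rightarrow> nat" where r: "strict_mono r" and
    conv: "\<And>z. z \<in> UNIV \<times> D \<Longrightarrow> \<exists>L. (\<lambda>n. dyadic_average (fst z) (u (r n)) (snd z) / b (fst z)) \<longlonglongrightarrow> L"
    using function_convergent_subsequence[of "UNIV \<times> D" "\<lambda>n z. dyadic_average (fst z) (u n) (snd z) / b (fst z)" 1]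
    by metis
  have convD: "Cauchy (\<lambda>n. dyadic_average j (u (r n)) d)" if "d \<in> D" for j d
  proof -
    obtain L where "(\<lambda>n. dyadic_average j (u (r n)) d / b j) \<longlonglongrightarrow> L"
      using conv[of "(j, d)"] \<open>d \<in> D\<close> by auto
    then have "(\<lambda>n. b j * (dyadic_average j (u (r n)) d / b j)) \<longlonglongrightarrow> b j * L"
      by (intro tendsto_intros)
    then show ?thesis using b[of j] by (intro LIMSEQ_imp_Cauchy) simp
  qed
  have "Cauchy (\<lambda>n. dyadic_average j (u (r n)) x)" for j x
  proof (rule metric_CauchyI)
    fix e :: real assume "e > 0"
    define d where "d = e / (3 * l j)"
    have "d > 0" using \<open>e > 0\<close> l[of j] by (simp add: d_def)
    then obtain y where y: "y \<in> D" "y \<in> ball x d"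
      using D(2)[of "ball x d"] by auto
    have near: "\<bar>dyadic_average j (u n) x - dyadic_average j (u n) y\<bar> \<le> e / 3" for n
    proof -
      have "l j * norm (x - y) \<le> l j * d"
        using y l[of j] by (intro mult_left_mono) (auto simp: dist_norm)
      also have "\<dots> = e / 3" using l[of j] by (simp add: d_def)
      finally show ?thesis using lip[of j n x y] by linarith
    qed
    obtain n0 where n0: "\<And>m n. m \<ge> n0 \<Longrightarrow> n \<ge> n0 \<Longrightarrow>
        dist (dyadic_average j (u (r m)) y) (dyadic_average j (u (r n)) y) < e / 3"
      using metric_CauchyD[OF convD[OF y(1)], of "e / 3" j] \<open>e > 0\<close> by auto
    have "dist (dyadic_average j (u (r m)) x) (dyadic_average j (u (r n)) x) < e"
      if "m \<ge> n0" "n \<ge> n0" for m n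
      using n0[OF that] near[of "r m"] near[of "r n"] unfolding dist_real_def by linarith
    then show "\<exists>n0. \<forall>m\<ge>n0. \<forall>n\<ge>n0.
        dist (dyadic_average j (u (r m)) x) (dyadic_average j (u (r n)) x) < e" by blast
  qed
  then have "\<exists>L. (\<lambda>n. dyadic_average j (u (r n)) x) \<longlonglongrightarrow> L" for j x
    by (auto simp: Cauchy_convergent_iff convergent_def)
  then obtain L where L: "\<And>j x. (\<lambda>n. dyadic_average j (u (r n)) x) \<longlonglongrightarrow> L j x"
    by metis
  have [measurable]: "L j \<in> borel_measurable borel" for j
    by (rule borel_measurable_LIMSEQ_real[OF L]) measurable
  obtain \<omega> :: "'a \<Rightarrow> real" where [measurable]: "\<omega> \<in> borel_measurable lborel"
    and \<omega>: "\<And>x. \<omega> x > 0" "\<And>x. \<omega> x \<le> 1" "integrable lborel \<omega>"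
    by (rule sigma_finite_measure.obtain_positive_integrable_function[OF sigma_finite_lborel]) blast
  let ?W = "LINT x|lborel. \<omega> x"
  have W: "?W \<ge> 0" using \<omega>(1) by (intro Bochner_Integration.integral_nonneg) (auto intro: less_imp_le)
  have iL: "integrable lborel (\<lambda>x. \<omega> x * (dyadic_average j (u (r n)) x - L j x))"
    and AL: "(\<lambda>n. LINT x|lborel. \<bar>\<omega> x * (dyadic_average j (u (r n)) x - L j x)\<bar>) \<longlonglongrightarrow> 0" for j n
  proof -
    have Lb: "\<bar>L j x\<bar> \<le> b j" for x
      by (rule LIMSEQ_le_const2[OF tendsto_rabs[OF L]]) (use bound in auto)
    have dom: "\<bar>\<omega> x * (dyadic_average j (u (r n)) x - L j x)\<bar> \<le> 2 * b j * \<omega> x" for n x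
    proof -
      have "\<bar>dyadic_average j (u (r n)) x - L j x\<bar> \<le> 2 * b j"
        using bound[of j "r n" x] Lb[of x] by linarith
      then have "\<omega> x * \<bar>dyadic_average j (u (r n)) x - L j x\<bar> \<le> \<omega> x * (2 * b j)"
        using \<omega>(1)[of x] by (intro mult_left_mono) auto
      then show ?thesis using \<omega>(1)[of x] by (simp add: abs_mult mult.commute)
    qed
    show "integrable lborel (\<lambda>x. \<omega> x * (dyadic_average j (u (r n)) x - L j x))" for n
      by (rule Bochner_Integration.integrable_bound[of _ "\<lambda>x. 2 * b j * \<omega> x"])
        (use \<omega>(3) dom in \<open>auto intro!: AE_I2 order_trans[OF dom abs_ge_self]\<close>)
    have "(\<lambda>n. LINT x|lborel. \<bar>\<omega> x * (dyadic_average j (u (r n)) x - L j x)\<bar>) \<longlonglongrightarrow> (LINT x|(lborel :: 'a measure). 0)"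
    proof (rule integral_dominated_convergence[where w = "\<lambda>x. 2 * b j * \<omega> x"])
      show "AE x in lborel. (\<lambda>n. \<bar>\<omega> x * (dyadic_average j (u (r n)) x - L j x)\<bar>) \<longlonglongrightarrow> 0"
      proof (intro AE_I2)
        fix x
        have "(\<lambda>n. \<bar>\<omega> x * (dyadic_average j (u (r n)) x - L j x)\<bar>) \<longlonglongrightarrow> \<bar>\<omega> x * (L j x - L j x)\<bar>"
          by (intro tendsto_intros L)
        then show "(\<lambda>n. \<bar>\<omega> x * (dyadic_average j (u (r n)) x - L j x)\<bar>) \<longlonglongrightarrow> 0" by simp
      qed
    qed (use \<omega>(3) dom in auto)
    then show "(\<lambda>n. LINT x|lborel. \<bar>\<omega> x * (dyadic_average j (u (r n)) x - L j x)\<bar>) \<longlonglongrightarrow> 0" by simp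
  qed
  have e2: "integrable lborel (\<lambda>x. (norm (u n x - dyadic_average j (u n) x))\<^sup>2)"
      "(LINT x|lborel. (norm (u n x - dyadic_average j (u n) x))\<^sup>2) \<le> (1/4) ^ j * R\<^sup>2" for n j
  proof -
    note E = dyadic_average_error[OF s g, of n j]
    then have "(\<integral>\<^sup>+ x. ennreal ((u n x - dyadic_average j (u n) x)\<^sup>2) \<partial>lborel) < \<infinity>"
      by (rule order_le_less_trans) simp
    then have i: "integrable lborel (\<lambda>x. (u n x - dyadic_average j (u n) x)\<^sup>2)"
      by (intro integrableI_nonneg) auto
    then show "integrable lborel (\<lambda>x. (norm (u n x - dyadic_average j (u n) x))\<^sup>2)" by simp
    have "ennreal (LINT x|lborel. (u n x - dyadic_average j (u n) x)\<^sup>2) \<le> ennreal ((1/4) ^ j * R\<^sup>2)"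
      using E i by (simp add: nn_integral_eq_integral)
    then show "(LINT x|lborel. (norm (u n x - dyadic_average j (u n) x))\<^sup>2) \<le> (1/4) ^ j * R\<^sup>2"
      by (subst (asm) ennreal_le_iff) auto
  qed
  obtain r' where r': "strict_mono r'" "AE x in lborel. Cauchy (\<lambda>i. \<omega> x * u (r (r' i)) x)"
  proof (rule cauchy_L1_AE_cauchy_subseq[where s = "\<lambda>n x. \<omega> x * u (r n) x" and M = lborel])
    show "integrable lborel (\<lambda>x. \<omega> x * u (r n) x)" for n
      using weighted_L1_of_L2(1)[of "u (r n)" lborel \<omega>] sobolev_pairD(3)[OF s] \<omega> by simp
  next
    fix e :: real assume "e > 0"
    define \<delta> where "\<delta> = e / (8 * (?W + 1))"
    have "\<delta> > 0" using \<open>e > 0\<close> W by (simp add: \<delta>_def)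
    have "\<delta> * ?W \<le> e / 8"
      using W \<open>e > 0\<close> by (simp add: \<delta>_def field_simps)
    have "\<exists>j::nat. (1/4) ^ j < \<delta> * e / (8 * R\<^sup>2)"
      using \<open>\<delta> > 0\<close> \<open>e > 0\<close> \<open>R > 0\<close> by (intro real_arch_pow_inv) auto
    then obtain j :: nat where j: "(1/4) ^ j < \<delta> * e / (8 * R\<^sup>2)" by blast
    then have "(1/4) ^ j * R\<^sup>2 / \<delta> < e / 8"
      using \<open>\<delta> > 0\<close> \<open>R > 0\<close> by (simp add: field_simps)
    let ?E = "\<lambda>n x. \<omega> x * (u (r n) x - dyadic_average j (u (r n)) x)"
    let ?F = "\<lambda>n x. \<omega> x * (dyadic_average j (u (r n)) x - L j x)"
    have iE: "integrable lborel (?E n)" for n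
      using weighted_L1_of_L2(1)[OF _ _ e2(1) \<omega>, of "r n" j] by simp
    have E: "(LINT x|lborel. \<bar>?E n x\<bar>) < e / 4" for n
    proof -
      have "(LINT x|lborel. \<bar>?E n x\<bar>) \<le> \<delta> * ?W +
          (LINT x|lborel. (norm (u (r n) x - dyadic_average j (u (r n)) x))\<^sup>2) / \<delta>"
        using weighted_L1_of_L2(2)[OF _ _ e2(1) \<omega> \<open>\<delta> > 0\<close>, of "r n" j] by simp
      also have "\<dots> \<le> \<delta> * ?W + (1/4) ^ j * R\<^sup>2 / \<delta>"
        using \<open>\<delta> > 0\<close> by (intro add_left_mono divide_right_mono e2(2)) auto
      finally show ?thesis
        using \<open>\<delta> * ?W \<le> e / 8\<close> \<open>(1/4) ^ j * R\<^sup>2 / \<delta> < e / 8\<close> by linarith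
    qed
    obtain n0 where n0: "\<And>n. n \<ge> n0 \<Longrightarrow> (LINT x|lborel. \<bar>?F n x\<bar>) < e / 4"
      using order_tendstoD(2)[OF AL[of j], of "e / 4"] \<open>e > 0\<close> by (auto simp: eventually_sequentially)
    have "(LINT x|lborel. norm (\<omega> x * u (r m) x - \<omega> x * u (r n) x)) < e" if "m \<ge> n0" "n \<ge> n0" for m n
    proof -
      have "(LINT x|lborel. norm (\<omega> x * u (r m) x - \<omega> x * u (r n) x)) =
          (LINT x|lborel. \<bar>?E m x + ?F m x - ?E n x - ?F n x\<bar>)"
        by (simp add: algebra_simps)
      also have "\<dots> \<le> (LINT x|lborel. \<bar>?E m x\<bar> + \<bar>?F m x\<bar> + \<bar>?E n x\<bar> + \<bar>?F n x\<bar>)"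
        using iE iL by (intro integral_mono) auto
      also have "\<dots> = (LINT x|lborel. \<bar>?E m x\<bar>) + (LINT x|lborel. \<bar>?F m x\<bar>)
          + (LINT x|lborel. \<bar>?E n x\<bar>) + (LINT x|lborel. \<bar>?F n x\<bar>)"
        using iE iL by simp
      also have "\<dots> < e"
        using E[of m] E[of n] n0[OF that(1)] n0[OF that(2)] by linarith
      finally show ?thesis .
    qed
    then show "\<exists>n0. \<forall>m\<ge>n0. \<forall>n\<ge>n0. (LINT x|lborel. norm (\<omega> x * u (r m) x - \<omega> x * u (r n) x)) < e"
      by blast
  qed
  have "AE x in lborel. convergent (\<lambda>k. u ((r \<circ> r') k) x)"
  proof (rule AE_mp[OF r'(2)], intro AE_I2 impI)
    fix x assume "Cauchy (\<lambda>i. \<omega> x * u (r (r' i)) x)"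
    then have "convergent (\<lambda>i. \<omega> x * u (r (r' i)) x)"
      by (simp add: Cauchy_convergent_iff)
    then have "convergent (\<lambda>i. inverse (\<omega> x) * (\<omega> x * u (r (r' i)) x))"
      by (rule convergent_mult[OF convergent_const])
    moreover have "inverse (\<omega> x) * (\<omega> x * a) = a" for a
      using \<omega>(1)[of x] by (simp add: mult.assoc[symmetric])
    ultimately show "convergent (\<lambda>k. u ((r \<circ> r') k) x)"
      by (simp only: o_def)
  qed
  then show ?thesis
    using that strict_mono_o[OF r r'(1)] by blast
qed

section \<open>Weak compactness in \<open>L\<^sup>2\<close>\<close>

definition square_integrable :: "'b measure \<Rightarrow> ('b \<Rightarrow> 'c::euclidean_space) \<Rightarrow> bool" where
  "square_integrable N f \<longleftrightarrow> f \<in> borel_measurable N \<and> integrable N (\<lambda>x. (norm (f x))\<^sup>2)"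

lemma square_integrable_add:
  "square_integrable N f \<Longrightarrow> square_integrable N g \<Longrightarrow> square_integrable N (\<lambda>x. f x + g x)"
  by (auto simp: square_integrable_def intro: integrable_square_add)

lemma square_integrable_scale:
  "square_integrable N f \<Longrightarrow> square_integrable N (\<lambda>x. a *\<^sub>R f x)"
  by (auto simp: square_integrable_def power_mult_distrib)

lemma square_integrable_diff:
  assumes "square_integrable N f" "square_integrable N g"
  shows "square_integrable N (\<lambda>x. f x - g x)"
  using square_integrable_add[OF assms(1) square_integrable_scale[OF assms(2), of "- 1"]] by simp

lemma square_integrable_zero: "square_integrable N (\<lambda>x. 0)"
  by (simp add: square_integrable_def)

lemma square_integrable_sum:
  "finite S \<Longrightarrow> (\<And>i. i \<in> S \<Longrightarrow> square_integrable N (f i)) \<Longrightarrow> square_integrable N (\<lambda>x. \<Sum>i\<in>S. f i x)"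
  by (induction S rule: finite_induct) (auto intro: square_integrable_zero square_integrable_add)

lemma integrable_inner_L2:
  assumes f: "square_integrable N f" and g: "square_integrable N g"
  shows "integrable N (\<lambda>x. f x \<bullet> g x)"
proof (rule Bochner_Integration.integrable_bound)
  show "integrable N (\<lambda>x. (norm (f x))\<^sup>2 + (norm (g x))\<^sup>2)"
    using assms by (auto simp: square_integrable_def)
  have [measurable]: "f \<in> borel_measurable N" "g \<in> borel_measurable N"
    using assms by (auto simp: square_integrable_def)
  show "(\<lambda>x. f x \<bullet> g x) \<in> borel_measurable N" by measurable
  have "\<bar>f x \<bullet> g x\<bar> \<le> (norm (f x))\<^sup>2 + (norm (g x))\<^sup>2" for x
  proof -
    have "\<bar>f x \<bullet> g x\<bar> \<le> norm (f x) * norm (g x)" by (rule Cauchy_Schwarz_ineq2)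
    moreover have "0 \<le> norm (f x) * norm (g x)" by simp
    ultimately show ?thesis
      using sum_squares_bound[of "norm (f x)" "norm (g x)"] by linarith
  qed
  then show "AE x in N. norm (f x \<bullet> g x) \<le> norm ((norm (f x))\<^sup>2 + (norm (g x))\<^sup>2)" by simp
qed

lemma Cauchy_Schwarz_L2:
  assumes f: "square_integrable N f" and g: "square_integrable N g"
  shows "\<bar>LINT x|N. f x \<bullet> g x\<bar> \<le> sqrt (LINT x|N. (norm (f x))\<^sup>2) * sqrt (LINT x|N. (norm (g x))\<^sup>2)"
proof -
  let ?a = "LINT x|N. (norm (f x))\<^sup>2" and ?b = "LINT x|N. f x \<bullet> g x" and ?c = "LINT x|N. (norm (g x))\<^sup>2"
  note i = integrable_inner_L2[OF f g] f g
  have "0 \<le> ?a + 2 * t * ?b + t\<^sup>2 * ?c" for t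
  proof -
    have "0 \<le> (LINT x|N. (norm (f x + t *\<^sub>R g x))\<^sup>2)" by simp
    also have "(\<lambda>x. (norm (f x + t *\<^sub>R g x))\<^sup>2) =
        (\<lambda>x. (norm (f x))\<^sup>2 + 2 * t * (f x \<bullet> g x) + t\<^sup>2 * (norm (g x))\<^sup>2)"
      unfolding power2_norm_eq_inner
      by (simp add: inner_add_left inner_add_right inner_commute power2_eq_square algebra_simps)
    also have "(LINT x|N. (norm (f x))\<^sup>2 + 2 * t * (f x \<bullet> g x) + t\<^sup>2 * (norm (g x))\<^sup>2) =
        ?a + 2 * t * ?b + t\<^sup>2 * ?c"
      using i by (simp add: square_integrable_def)
    finally show ?thesis .
  qed
  note quad = this
  have c0: "?c \<ge> 0" "?a \<ge> 0" by simp_all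
  have "?b\<^sup>2 \<le> ?a * ?c"
  proof (cases "?c = 0")
    case True
    have "?b = 0"
    proof (rule ccontr)
      assume "?b \<noteq> 0"
      have "0 \<le> ?a + 2 * (- (?a + 1) / (2 * ?b)) * ?b" using quad[of "- (?a + 1) / (2 * ?b)"] True by simp
      with \<open>?b \<noteq> 0\<close> show False by (simp add: field_simps)
    qed
    then show ?thesis using True by simp
  next
    case False
    then have "?c > 0" using c0(1) by linarith
    have "a + 2 * (- b / c) * b + (- b / c)\<^sup>2 * c = a - b\<^sup>2 / c" if "c \<noteq> 0" for a b c :: real
      using that by (simp add: power2_eq_square field_simps)
    from this[OF False] have "0 \<le> ?a - ?b\<^sup>2 / ?c"
      using quad[of "- ?b / ?c"] by (simp only:)
    then show ?thesis using \<open>?c > 0\<close> by (simp add: field_simps)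
  qed
  then have "sqrt (?b\<^sup>2) \<le> sqrt (?a * ?c)" by (rule real_sqrt_le_mono)
  then show ?thesis by (simp add: real_sqrt_mult)
qed

text \<open>Completeness of \<open>L\<^sup>2\<close>: a Cauchy sequence is Cauchy in \<open>L\<^sup>1\<close> for a finite equivalent measure,
  so a subsequence converges almost everywhere, and Fatou's lemma upgrades this to \<open>L\<^sup>2\<close>.\<close>

lemma L2_complete:
  fixes H :: "nat \<Rightarrow> 'b \<Rightarrow> 'c::euclidean_space"
  assumes "sigma_finite_measure N" and H: "\<And>n. square_integrable N (H n)"
    and cauchy: "\<And>e. e > 0 \<Longrightarrow> \<exists>n0. \<forall>m\<ge>n0. \<forall>n\<ge>n0. (LINT x|N. (norm (H m x - H n x))\<^sup>2) < e"
  obtains h where "square_integrable N h" "(\<lambda>n. LINT x|N. (norm (H n x - h x))\<^sup>2) \<longlonglongrightarrow> 0"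
proof -
  interpret N: sigma_finite_measure N by fact
  have [measurable]: "H n \<in> borel_measurable N" for n
    using H by (simp add: square_integrable_def)
  obtain \<omega> :: "'b \<Rightarrow> real" where [measurable]: "\<omega> \<in> borel_measurable N"
    and \<omega>: "\<And>x. \<omega> x > 0" "\<And>x. \<omega> x \<le> 1" "integrable N \<omega>"
    by (rule N.obtain_positive_integrable_function) blast
  let ?W = "LINT x|N. \<omega> x"
  have W: "?W \<ge> 0" using \<omega>(1) by (intro Bochner_Integration.integral_nonneg) (auto intro: less_imp_le)
  have d2: "integrable N (\<lambda>x. (norm (H m x - H n x))\<^sup>2)" for m n
    using square_integrable_diff[OF H H, of m n] by (simp add: square_integrable_def)
  obtain r where r: "strict_mono r" "AE x in N. Cauchy (\<lambda>i. \<omega> x *\<^sub>R H (r i) x)"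
  proof (rule cauchy_L1_AE_cauchy_subseq[where s = "\<lambda>n x. \<omega> x *\<^sub>R H n x" and M = N])
    show "integrable N (\<lambda>x. \<omega> x *\<^sub>R H n x)" for n
      using H \<omega> by (intro weighted_L1_of_L2(1)) (auto simp: square_integrable_def)
  next
    fix e :: real assume "e > 0"
    define \<delta> where "\<delta> = e / (2 * (?W + 1))"
    have "\<delta> > 0" using \<open>e > 0\<close> W by (simp add: \<delta>_def)
    have "\<delta> * ?W < e / 2"
    proof -
      have "\<delta> * ?W < \<delta> * (?W + 1)" using \<open>\<delta> > 0\<close> by simp
      also have "\<dots> = e / 2" using W by (simp add: \<delta>_def field_simps)
      finally show ?thesis .
    qed
    obtain n0 where n0: "\<And>m n. m \<ge> n0 \<Longrightarrow> n \<ge> n0 \<Longrightarrow> (LINT x|N. (norm (H m x - H n x))\<^sup>2) < \<delta> * e / 2"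
      using cauchy[of "\<delta> * e / 2"] \<open>\<delta> > 0\<close> \<open>e > 0\<close> by auto
    have "(LINT x|N. norm (\<omega> x *\<^sub>R H m x - \<omega> x *\<^sub>R H n x)) < e" if "m \<ge> n0" "n \<ge> n0" for m n
    proof -
      have "(LINT x|N. norm (\<omega> x *\<^sub>R H m x - \<omega> x *\<^sub>R H n x)) = (LINT x|N. norm (\<omega> x *\<^sub>R (H m x - H n x)))"
        by (simp add: scaleR_diff_right)
      also have "\<dots> \<le> \<delta> * ?W + (LINT x|N. (norm (H m x - H n x))\<^sup>2) / \<delta>"
        using d2 \<omega> \<open>\<delta> > 0\<close> by (intro weighted_L1_of_L2(2)) auto
      also have "(LINT x|N. (norm (H m x - H n x))\<^sup>2) / \<delta> < e / 2"
        using n0[OF that] \<open>\<delta> > 0\<close> by (simp add: field_simps)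
      finally show ?thesis using \<open>\<delta> * ?W < e / 2\<close> by linarith
    qed
    then show "\<exists>n0. \<forall>m\<ge>n0. \<forall>n\<ge>n0. (LINT x|N. norm (\<omega> x *\<^sub>R H m x - \<omega> x *\<^sub>R H n x)) < e" by blast
  qed
  define h where "h x = lim (\<lambda>i. H (r i) x)" for x
  have [measurable]: "h \<in> borel_measurable N"
    unfolding h_def[abs_def] by measurable
  have lim: "AE x in N. (\<lambda>i. H (r i) x) \<longlonglongrightarrow> h x"
  proof (rule AE_mp[OF r(2)], intro AE_I2 impI)
    fix x assume "Cauchy (\<lambda>i. \<omega> x *\<^sub>R H (r i) x)"
    then obtain y where "(\<lambda>i. \<omega> x *\<^sub>R H (r i) x) \<longlonglongrightarrow> y"
      by (auto simp: Cauchy_convergent_iff convergent_def)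
    then have "(\<lambda>i. inverse (\<omega> x) *\<^sub>R (\<omega> x *\<^sub>R H (r i) x)) \<longlonglongrightarrow> inverse (\<omega> x) *\<^sub>R y"
      by (intro tendsto_intros)
    then have "(\<lambda>i. H (r i) x) \<longlonglongrightarrow> inverse (\<omega> x) *\<^sub>R y"
      using \<omega>(1)[of x] by (simp add: less_imp_neq[symmetric])
    then show "(\<lambda>i. H (r i) x) \<longlonglongrightarrow> h x"
      unfolding h_def by (simp add: convergent_LIMSEQ_iff[symmetric] convergentI)
  qed
  have fatou: "(\<integral>\<^sup>+ x. ennreal ((norm (H n x - h x))\<^sup>2) \<partial>N) \<le> ennreal e"
    if "e > 0" and n0: "\<forall>m\<ge>n0. \<forall>n\<ge>n0. (LINT x|N. (norm (H m x - H n x))\<^sup>2) < e" and "n \<ge> n0" for n n0 e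
  proof -
    have "(\<integral>\<^sup>+ x. ennreal ((norm (H n x - h x))\<^sup>2) \<partial>N)
        = (\<integral>\<^sup>+ x. liminf (\<lambda>i. ennreal ((norm (H n x - H (r i) x))\<^sup>2)) \<partial>N)"
    proof (rule nn_integral_cong_AE, rule AE_mp[OF lim], intro AE_I2 impI)
      fix x assume "(\<lambda>i. H (r i) x) \<longlonglongrightarrow> h x"
      then have "(\<lambda>i. ennreal ((norm (H n x - H (r i) x))\<^sup>2)) \<longlonglongrightarrow> ennreal ((norm (H n x - h x))\<^sup>2)"
        by (intro tendsto_ennrealI tendsto_intros)
      then show "ennreal ((norm (H n x - h x))\<^sup>2) = liminf (\<lambda>i. ennreal ((norm (H n x - H (r i) x))\<^sup>2))"
        by (rule lim_imp_Liminf[OF trivial_limit_sequentially, symmetric])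
    qed
    also have "\<dots> \<le> liminf (\<lambda>i. \<integral>\<^sup>+ x. ennreal ((norm (H n x - H (r i) x))\<^sup>2) \<partial>N)"
      by (rule nn_integral_liminf) measurable
    also have "\<dots> \<le> liminf (\<lambda>i. ennreal e)"
    proof (rule Liminf_mono, rule eventually_sequentiallyI)
      fix i assume "n0 \<le> i"
      then have "n0 \<le> r i" using seq_suble[OF r(1), of i] by simp
      then show "(\<integral>\<^sup>+ x. ennreal ((norm (H n x - H (r i) x))\<^sup>2) \<partial>N) \<le> ennreal e"
        using n0 \<open>n \<ge> n0\<close> d2[of n "r i"] by (simp add: nn_integral_eq_integral ennreal_leI less_imp_le)
    qed
    finally show ?thesis by (simp add: Liminf_const)
  qed
  have hi: "integrable N (\<lambda>x. (norm (H n x - h x))\<^sup>2)"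
    if "e > 0" and n0: "\<forall>m\<ge>n0. \<forall>n\<ge>n0. (LINT x|N. (norm (H m x - H n x))\<^sup>2) < e" and "n \<ge> n0" for n n0 e
    using order_le_less_trans[OF fatou[OF that], of \<infinity>] by (intro integrableI_nonneg) auto
  obtain n1 where n1: "\<forall>m\<ge>n1. \<forall>n\<ge>n1. (LINT x|N. (norm (H m x - H n x))\<^sup>2) < 1"
    using cauchy[of 1] by auto
  have "square_integrable N (\<lambda>x. H n1 x - h x)"
    using hi[OF _ n1] by (simp add: square_integrable_def)
  from square_integrable_diff[OF H[of n1] this] have "square_integrable N h" by simp
  moreover have "(\<lambda>n. LINT x|N. (norm (H n x - h x))\<^sup>2) \<longlonglongrightarrow> 0"
  proof (rule LIMSEQ_I)
    fix e :: real assume "e > 0"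
    then obtain n0 where n0: "\<forall>m\<ge>n0. \<forall>n\<ge>n0. (LINT x|N. (norm (H m x - H n x))\<^sup>2) < e / 2"
      using cauchy[of "e / 2"] by auto
    have "norm ((LINT x|N. (norm (H n x - h x))\<^sup>2) - 0) < e" if "n \<ge> n0" for n
    proof -
      have "(\<integral>\<^sup>+ x. ennreal ((norm (H n x - h x))\<^sup>2) \<partial>N) \<le> ennreal (e / 2)"
        using \<open>e > 0\<close> n0 that by (intro fatou) auto
      then have "(LINT x|N. (norm (H n x - h x))\<^sup>2) \<le> e / 2"
        using hi[of "e / 2", OF _ n0 that] \<open>e > 0\<close> by (simp add: nn_integral_eq_integral)
      then show ?thesis using \<open>e > 0\<close> by simp
    qed
    then show "\<exists>n0. \<forall>n\<ge>n0. norm ((LINT x|N. (norm (H n x - h x))\<^sup>2) - 0) < e" by blast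
  qed
  ultimately show ?thesis by (rule that)
qed

text \<open>A first subsequence makes all rows converge, a second one makes their limits converge; selecting
  indices far enough apart then gives a summable rate. In the application \<open>G\<close> is a Gram matrix.\<close>

lemma gram_array_thinning:
  fixes G :: "nat \<Rightarrow> nat \<Rightarrow> real"
  assumes sym: "\<And>i j. G i j = G j i" and bound: "\<And>i j. \<bar>G i j\<bar> \<le> K"
  obtains r a where "strict_mono (r :: nat \<Rightarrow> nat)" "\<bar>a\<bar> \<le> K"
    "\<And>i j. i \<noteq> j \<Longrightarrow> \<bar>G (r i) (r j) - a\<bar> \<le> 2 * (1/2) ^ i + 2 * (1/2) ^ j"
proof -
  obtain r1 :: "nat \<Rightarrow> nat" where r1: "strict_mono r1" "\<And>i. \<exists>l. (\<lambda>n. G i (r1 n)) \<longlonglongrightarrow> l"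
  proof -
    have "norm (G i n) \<le> K" for i n using bound by simp
    then show ?thesis
      using function_convergent_subsequence[of "UNIV :: nat set" "\<lambda>n i. G i n" K] that by auto
  qed
  then obtain \<alpha> where \<alpha>: "\<And>i. (\<lambda>n. G i (r1 n)) \<longlonglongrightarrow> \<alpha> i" by metis
  have \<alpha>b: "\<bar>\<alpha> i\<bar> \<le> K" for i
    by (rule LIMSEQ_le_const2[OF tendsto_rabs[OF \<alpha>]]) (use bound in auto)
  have "bounded (range (\<lambda>i. \<alpha> (r1 i)))"
    using \<alpha>b by (intro boundedI[of _ K]) auto
  then obtain a r2 where r2: "strict_mono r2" "((\<lambda>i. \<alpha> (r1 i)) \<circ> r2) \<longlonglongrightarrow> a"
    using bounded_imp_convergent_subsequence by blast
  define t where "t = r1 \<circ> r2"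
  have t: "strict_mono t" unfolding t_def by (rule strict_mono_o[OF r1(1) r2(1)])
  have row: "(\<lambda>n. G i (t n)) \<longlonglongrightarrow> \<alpha> i" for i
    using LIMSEQ_subseq_LIMSEQ[OF \<alpha> r2(1)] by (simp add: t_def o_def)
  have lima: "(\<lambda>i. \<alpha> (t i)) \<longlonglongrightarrow> a" using r2(2) by (simp add: t_def o_def)
  have "\<bar>a\<bar> \<le> K"
    by (rule LIMSEQ_le_const2[OF tendsto_rabs[OF lima]]) (use \<alpha>b in auto)
  \<comment> \<open>\<open>?Q n x y\<close>: from index \<open>y\<close> on, all rows up to \<open>x\<close> are within \<open>(1/2) ^ n\<close> of their limits.\<close>
  let ?P = "\<lambda>n x. \<bar>\<alpha> (t x) - a\<bar> < (1/2::real) ^ n"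
  let ?Q = "\<lambda>n x y. x < y \<and> (\<forall>i\<le>x. \<forall>m\<ge>y. \<bar>G (t i) (t m) - \<alpha> (t i)\<bar> < (1/2) ^ n)"
  have evP: "\<exists>n0. \<forall>x\<ge>n0. ?P n x" for n
    using LIMSEQ_D[OF lima, of "(1/2) ^ n"] by auto
  have "\<exists>s. \<forall>n. ?P n (s n) \<and> ?Q n (s n) (s (Suc n))"
  proof (rule dependent_nat_choice)
    show "\<exists>x. ?P 0 x" using evP[of 0] by blast
  next
    fix x n
    assume "?P n x"
    obtain n0 where n0: "\<forall>y\<ge>n0. ?P (Suc n) y" using evP by blast
    have "\<exists>N. \<forall>m\<ge>N. \<bar>G (t i) (t m) - \<alpha> (t i)\<bar> < (1/2) ^ n" for i
      using LIMSEQ_D[OF row[of "t i"], of "(1/2) ^ n"] by auto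
    then obtain N where N: "\<And>i m. m \<ge> N i \<Longrightarrow> \<bar>G (t i) (t m) - \<alpha> (t i)\<bar> < (1/2) ^ n" by metis
    define y where "y = Max (insert (Suc x) (insert n0 (N ` {..x})))"
    have y: "Suc x \<le> y" "n0 \<le> y" "\<And>i. i \<le> x \<Longrightarrow> N i \<le> y"
      unfolding y_def by (rule Max_ge; auto)+
    have "?P (Suc n) y" using n0 y(2) by blast
    moreover have "?Q n x y"
      using y(1) N order_trans[OF y(3)] by (auto simp: Suc_le_eq)
    ultimately show "\<exists>y. ?P (Suc n) y \<and> ?Q n x y" by blast
  qed
  then obtain s where s: "\<And>n. ?P n (s n)" "\<And>n. ?Q n (s n) (s (Suc n))" by blast
  have mono: "strict_mono s" using s(2) by (simp add: strict_mono_Suc_iff)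
  have lt: "\<bar>G (t (s i)) (t (s j)) - a\<bar> \<le> 2 * (1/2) ^ i + 2 * (1/2) ^ j" if "i < j" for i j
  proof -
    obtain k where k: "j = Suc k" using \<open>i < j\<close> by (cases j) auto
    have "s i \<le> s k" using \<open>i < j\<close> k mono by (simp add: strict_mono_less_eq)
    then have "\<bar>G (t (s i)) (t (s j)) - \<alpha> (t (s i))\<bar> < (1/2) ^ k"
      using s(2)[of k] k by auto
    moreover have "(1/2) ^ k = 2 * (1/2::real) ^ j" by (simp add: k)
    moreover have "0 \<le> (1/2::real) ^ i" by simp
    ultimately show ?thesis using s(1)[of i] by linarith
  qed
  show ?thesis
  proof (rule that[of "t \<circ> s" a])
    show "strict_mono (t \<circ> s)" by (rule strict_mono_o[OF t mono])
    fix i j :: nat assume "i \<noteq> j"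
    then show "\<bar>G ((t \<circ> s) i) ((t \<circ> s) j) - a\<bar> \<le> 2 * (1/2) ^ i + 2 * (1/2) ^ j"
      using lt[of i j] lt[of j i] sym by (cases i j rule: linorder_cases) (auto simp: add.commute)
  qed fact
qed


lemma average_deviation:
  fixes c d :: "nat \<Rightarrow> real"
  assumes "\<And>i. i < Suc n \<Longrightarrow> \<bar>c i - l\<bar> \<le> d i"
  shows "\<bar>(\<Sum>i<Suc n. c i) / Suc n - l\<bar> \<le> (\<Sum>i<Suc n. d i) / Suc n"
proof -
  have "(\<Sum>i<Suc n. c i) / Suc n - l = (\<Sum>i<Suc n. c i - l) / Suc n"
    by (simp only: sum_subtractf) (simp add: field_simps)
  also have "\<bar>\<dots>\<bar> \<le> (\<Sum>i<Suc n. \<bar>c i - l\<bar>) / Suc n"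
    by (simp only: abs_divide) (intro divide_mono sum_abs, auto)
  also have "\<dots> \<le> (\<Sum>i<Suc n. d i) / Suc n"
    using assms by (intro divide_right_mono sum_mono) auto
  finally show ?thesis .
qed

lemma inverse_Suc_tendsto: "(\<lambda>n. C / real (Suc n)) \<longlonglongrightarrow> 0"
  using tendsto_mult[OF tendsto_const[of C] LIMSEQ_inverse_real_of_nat]
  by (simp add: divide_inverse)

lemma cesaro_mean_tendsto:
  fixes c :: "nat \<Rightarrow> real"
  assumes "c \<longlonglongrightarrow> l"
  shows "(\<lambda>n. (\<Sum>i<Suc n. c i) / Suc n) \<longlonglongrightarrow> l"
proof (rule LIMSEQ_I)
  fix e :: real assume "e > 0"
  obtain n0 where n0: "\<And>i. i \<ge> n0 \<Longrightarrow> \<bar>c i - l\<bar> < e / 2"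
    using LIMSEQ_D[OF assms, of "e / 2"] \<open>e > 0\<close> by auto
  define C where "C = (\<Sum>i<n0. \<bar>c i - l\<bar>)"
  obtain n1 where n1: "\<And>n. n \<ge> n1 \<Longrightarrow> C / real (Suc n) < e / 2"
    using order_tendstoD(2)[OF inverse_Suc_tendsto[of C], of "e / 2"] \<open>e > 0\<close>
    by (auto simp: eventually_sequentially)
  have "norm ((\<Sum>i<Suc n. c i) / Suc n - l) < e" if "n \<ge> n1" for n
  proof -
    have "\<bar>(\<Sum>i<Suc n. c i) / Suc n - l\<bar>
        \<le> (\<Sum>i<Suc n. (if i < n0 then \<bar>c i - l\<bar> else 0) + e / 2) / Suc n"
      using n0 \<open>e > 0\<close> by (intro average_deviation) (auto intro: less_imp_le simp: not_less)
    also have "(\<Sum>i<Suc n. (if i < n0 then \<bar>c i - l\<bar> else 0) + e / 2) \<le> C + real (Suc n) * (e / 2)"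
    proof -
      have "(\<Sum>i<Suc n. if i < n0 then \<bar>c i - l\<bar> else 0) = (\<Sum>i\<in>{..<Suc n} \<inter> {i. i < n0}. \<bar>c i - l\<bar>)"
        by (simp add: sum.inter_restrict)
      also have "\<dots> \<le> C"
        unfolding C_def by (intro sum_mono2) auto
      finally show ?thesis by (simp only: sum.distrib) simp
    qed
    finally have "\<bar>(\<Sum>i<Suc n. c i) / Suc n - l\<bar> \<le> (C + real (Suc n) * (e / 2)) / Suc n"
      by (simp add: divide_right_mono)
    also have "\<dots> = C / real (Suc n) + e / 2" by (simp add: field_simps)
    also have "\<dots> < e" using n1[OF that] by linarith
    finally show ?thesis by simp
  qed
  then show "\<exists>n0. \<forall>n\<ge>n0. norm ((\<Sum>i<Suc n. c i) / Suc n - l) < e" by blast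
qed

text \<open>Weak compactness in the form that is needed here. By the Banach--Saks argument the
  arithmetic means of a suitable subsequence converge strongly; their limit \<open>h\<close> agrees with the
  weak limit against every function for which the latter exists, and against \<open>h\<close> itself.\<close>

lemma banach_saks_L2:
  fixes g :: "nat \<Rightarrow> 'b \<Rightarrow> 'c::euclidean_space"
  assumes N: "sigma_finite_measure N" and g: "\<And>k. square_integrable N (g k)"
    and K: "\<And>k. (LINT x|N. (norm (g k x))\<^sup>2) \<le> K"
  obtains r h where "strict_mono (r :: nat \<Rightarrow> nat)" "square_integrable N h"
    "(\<lambda>k. LINT x|N. h x \<bullet> g (r k) x) \<longlonglongrightarrow> (LINT x|N. (norm (h x))\<^sup>2)"
    "\<And>\<psi> l. square_integrable N \<psi> \<Longrightarrow> (\<lambda>k. LINT x|N. g (r k) x \<bullet> \<psi> x) \<longlonglongrightarrow> l \<Longrightarrow>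
      (LINT x|N. h x \<bullet> \<psi> x) = l"
proof -
  define ip where "ip f1 f2 = (LINT x|N. f1 x \<bullet> f2 x)" for f1 f2 :: "'b \<Rightarrow> 'c"
  have ip_comm: "ip f1 f2 = ip f2 f1" for f1 f2
    unfolding ip_def by (simp add: inner_commute)
  have "0 \<le> (LINT x|N. (norm (g 0 x))\<^sup>2)" by simp
  then have "K \<ge> 0" using K[of 0] by linarith
  have "\<bar>ip (g i) (g j)\<bar> \<le> K" for i j
  proof -
    have "\<bar>ip (g i) (g j)\<bar> \<le> sqrt (LINT x|N. (norm (g i x))\<^sup>2) * sqrt (LINT x|N. (norm (g j x))\<^sup>2)"
      unfolding ip_def by (rule Cauchy_Schwarz_L2[OF g g])
    also have "\<dots> \<le> sqrt K * sqrt K"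
      by (intro mult_mono real_sqrt_le_mono K) (use \<open>K \<ge> 0\<close> in auto)
    finally show ?thesis using \<open>K \<ge> 0\<close> by simp
  qed
  note Gb = this
  obtain r a where r: "strict_mono (r :: nat \<Rightarrow> nat)" "\<bar>a\<bar> \<le> K"
    "\<And>i j. i \<noteq> j \<Longrightarrow> \<bar>ip (g (r i)) (g (r j)) - a\<bar> \<le> 2 * (1/2) ^ i + 2 * (1/2) ^ j"
    using gram_array_thinning[of "\<lambda>i j. ip (g i) (g j)" K] Gb ip_comm by metis
  \<comment> \<open>All inner products between means of this subsequence are close to \<open>a\<close>, so the means form a Cauchy sequence.\<close>
  define H where "H n x = (1 / real (Suc n)) *\<^sub>R (\<Sum>i<Suc n. g (r i) x)" for n x
  have H: "square_integrable N (H n)" for n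
    unfolding H_def[abs_def] by (intro square_integrable_scale square_integrable_sum g) auto
  have ipH: "ip (H n) \<psi> = (\<Sum>i<Suc n. ip (g (r i)) \<psi>) / Suc n" if "square_integrable N \<psi>" for n \<psi>
  proof -
    have "ip (H n) \<psi> = (LINT x|N. (\<Sum>i<Suc n. g (r i) x \<bullet> \<psi> x) / Suc n)"
      unfolding ip_def H_def by (simp only: inner_scaleR_left inner_sum_left) simp
    also have "\<dots> = (\<Sum>i<Suc n. ip (g (r i)) \<psi>) / Suc n"
      unfolding ip_def using integrable_inner_L2[OF g that] by (simp del: sum.lessThan_Suc)
    finally show ?thesis .
  qed
  have geo: "(\<Sum>i<n. 2 * (1/2::real) ^ i) \<le> 4" for n
  proof -
    have "(\<Sum>i<n. 2 * (1/2::real) ^ i) = 4 - 4 * (1/2) ^ n"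
      by (induction n) auto
    then show ?thesis by simp
  qed
  have E1: "\<bar>ip (H n) (g (r k)) - a\<bar> \<le> (4 + 2 * K) / Suc n + 2 * (1/2) ^ k" for n k
  proof -
    have "\<bar>ip (H n) (g (r k)) - a\<bar>
        \<le> (\<Sum>i<Suc n. 2 * (1/2) ^ i + 2 * (1/2) ^ k + (if i = k then 2 * K else 0)) / Suc n"
      unfolding ipH[OF g]
    proof (rule average_deviation)
      fix i
      show "\<bar>ip (g (r i)) (g (r k)) - a\<bar> \<le> 2 * (1/2) ^ i + 2 * (1/2) ^ k + (if i = k then 2 * K else 0)"
      proof (cases "i = k")
        case True
        have "\<bar>ip (g (r k)) (g (r k)) - a\<bar> \<le> 2 * K"
          using Gb[of "r k" "r k"] r(2) by linarith
        moreover have "0 \<le> (1/2::real) ^ k" by simp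
        ultimately show ?thesis
          unfolding True by (simp only: if_True simp_thms)
      qed (use r(3)[of i k] in simp)
    qed
    also have "(\<Sum>i<Suc n. 2 * (1/2) ^ i + 2 * (1/2) ^ k + (if i = k then 2 * K else 0))
        \<le> 4 + real (Suc n) * (2 * (1/2) ^ k) + 2 * K"
    proof -
      have "(\<Sum>i<Suc n. if i = k then 2 * K else 0) \<le> 2 * K"
        using \<open>K \<ge> 0\<close> by (simp add: sum.delta del: sum.lessThan_Suc)
      then show ?thesis
        using geo[of "Suc n"] by (simp only: sum.distrib sum_constant card_lessThan)
    qed
    finally have "\<bar>ip (H n) (g (r k)) - a\<bar> \<le> (4 + real (Suc n) * (2 * (1/2) ^ k) + 2 * K) / Suc n"
      by (simp add: divide_right_mono)
    also have "\<dots> = (4 + 2 * K) / Suc n + 2 * (1/2) ^ k"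
      by (simp add: field_simps del: of_nat_Suc)
    finally show ?thesis .
  qed
  have tail: "(\<Sum>k<Suc m. C + 2 * (1/2) ^ k) / Suc m \<le> C + 4 / Suc m" for m and C :: real
  proof -
    have "(\<Sum>k<Suc m. C + 2 * (1/2) ^ k) \<le> real (Suc m) * C + 4"
      using geo[of "Suc m"] by (simp only: sum.distrib sum_constant card_lessThan)
    then have "(\<Sum>k<Suc m. C + 2 * (1/2) ^ k) / Suc m \<le> (real (Suc m) * C + 4) / Suc m"
      by (rule divide_right_mono) simp
    then show ?thesis by (simp add: add_divide_distrib del: of_nat_Suc sum.lessThan_Suc)
  qed
  define c where "c = 4 + 2 * K"
  have "c \<ge> 4" using \<open>K \<ge> 0\<close> by (simp add: c_def)
  have E2: "\<bar>ip (H n) (H m) - a\<bar> \<le> c / Suc n + c / Suc m" for n m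
  proof -
    have "\<bar>ip (H n) (H m) - a\<bar> = \<bar>(\<Sum>k<Suc m. ip (g (r k)) (H n)) / Suc m - a\<bar>"
      using ipH[OF H, of m n] ip_comm by simp
    also have "\<dots> \<le> (\<Sum>k<Suc m. c / Suc n + 2 * (1/2) ^ k) / Suc m"
      using E1 by (intro average_deviation) (simp add: ip_comm[of _ "H n"] c_def)
    also have "\<dots> \<le> c / Suc n + 4 / Suc m" by (rule tail)
    also have "\<dots> \<le> c / Suc n + c / Suc m"
      using \<open>c \<ge> 4\<close> by (intro add_left_mono divide_right_mono) auto
    finally show ?thesis .
  qed
  have dist: "(LINT x|N. (norm (H n x - H m x))\<^sup>2) \<le> 4 * (c / Suc n) + 4 * (c / Suc m)" for n m
  proof -
    have "(LINT x|N. (norm (H n x - H m x))\<^sup>2) = (LINT x|N. H n x \<bullet> H n x - 2 * (H n x \<bullet> H m x) + H m x \<bullet> H m x)"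
      unfolding power2_norm_eq_inner
      by (simp add: inner_diff_left inner_diff_right inner_commute algebra_simps)
    also have "\<dots> = ip (H n) (H n) - 2 * ip (H n) (H m) + ip (H m) (H m)"
      unfolding ip_def using integrable_inner_L2[OF H H] by simp
    also have "\<dots> \<le> 4 * (c / Suc n) + 4 * (c / Suc m)"
      using E2[of n n] E2[of n m] E2[of m m] by linarith
    finally show ?thesis .
  qed
  obtain h where h: "square_integrable N h" "(\<lambda>n. LINT x|N. (norm (H n x - h x))\<^sup>2) \<longlonglongrightarrow> 0"
  proof (rule L2_complete[OF N H])
    fix e :: real assume "e > 0"
    obtain n0 where n0: "\<And>n. n \<ge> n0 \<Longrightarrow> c / real (Suc n) < e / 8"
      using order_tendstoD(2)[OF inverse_Suc_tendsto[of c], of "e / 8"] \<open>e > 0\<close>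
      by (auto simp: eventually_sequentially)
    have "(LINT x|N. (norm (H m x - H n x))\<^sup>2) < e" if "m \<ge> n0" "n \<ge> n0" for m n
      using dist[of m n] n0[OF that(1)] n0[OF that(2)] by linarith
    then show "\<exists>n0. \<forall>m\<ge>n0. \<forall>n\<ge>n0. (LINT x|N. (norm (H m x - H n x))\<^sup>2) < e" by blast
  qed
  have weak: "(\<lambda>n. ip (H n) \<psi>) \<longlonglongrightarrow> ip h \<psi>" if \<psi>: "square_integrable N \<psi>" for \<psi>
  proof -
    have "(\<lambda>n. ip (H n) \<psi> - ip h \<psi>) \<longlonglongrightarrow> 0"
    proof (rule Lim_null_comparison[where g = "\<lambda>n. sqrt (LINT x|N. (norm (H n x - h x))\<^sup>2) * sqrt (LINT x|N. (norm (\<psi> x))\<^sup>2)"])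
      have "ip (H n) \<psi> - ip h \<psi> = (LINT x|N. (H n x - h x) \<bullet> \<psi> x)" for n
        unfolding ip_def inner_diff_left
        using integrable_inner_L2[OF H \<psi>] integrable_inner_L2[OF h(1) \<psi>] by simp
      then show "\<forall>\<^sub>F n in sequentially. norm (ip (H n) \<psi> - ip h \<psi>)
          \<le> sqrt (LINT x|N. (norm (H n x - h x))\<^sup>2) * sqrt (LINT x|N. (norm (\<psi> x))\<^sup>2)"
        using Cauchy_Schwarz_L2[OF square_integrable_diff[OF H h(1)] \<psi>] by simp
      have "(\<lambda>n. sqrt (LINT x|N. (norm (H n x - h x))\<^sup>2) * sqrt (LINT x|N. (norm (\<psi> x))\<^sup>2))
          \<longlonglongrightarrow> sqrt 0 * sqrt (LINT x|N. (norm (\<psi> x))\<^sup>2)"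
        by (intro tendsto_intros h(2))
      then show "(\<lambda>n. sqrt (LINT x|N. (norm (H n x - h x))\<^sup>2) * sqrt (LINT x|N. (norm (\<psi> x))\<^sup>2)) \<longlonglongrightarrow> 0"
        by simp
    qed
    then show ?thesis by (simp add: LIM_zero_iff)
  qed
  have hg: "\<bar>ip h (g (r k)) - a\<bar> \<le> 2 * (1/2) ^ k" for k
  proof (rule LIMSEQ_le)
    show "(\<lambda>n. \<bar>ip (H n) (g (r k)) - a\<bar>) \<longlonglongrightarrow> \<bar>ip h (g (r k)) - a\<bar>"
      by (intro tendsto_intros weak g)
    show "(\<lambda>n. (4 + 2 * K) / real (Suc n) + 2 * (1/2) ^ k) \<longlonglongrightarrow> 2 * (1/2) ^ k"
      using tendsto_add[OF inverse_Suc_tendsto[of "4 + 2 * K"] tendsto_const[of "2 * (1/2) ^ k"]] by simp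
    show "\<exists>N. \<forall>n\<ge>N. \<bar>ip (H n) (g (r k)) - a\<bar> \<le> (4 + 2 * K) / real (Suc n) + 2 * (1/2) ^ k"
      using E1 by blast
  qed
  have lim_a: "(\<lambda>k. ip h (g (r k))) \<longlonglongrightarrow> a"
  proof -
    have "(\<lambda>k. ip h (g (r k)) - a) \<longlonglongrightarrow> 0"
      by (rule Lim_null_comparison[where g = "\<lambda>k. 2 * (1/2) ^ k"])
        (use hg in \<open>auto intro!: always_eventually tendsto_mult_right_zero LIMSEQ_realpow_zero\<close>)
    then show ?thesis by (simp add: LIM_zero_iff)
  qed
  have cesaro: "ip h \<psi> = l" if "square_integrable N \<psi>" "(\<lambda>k. ip (g (r k)) \<psi>) \<longlonglongrightarrow> l" for \<psi> l
    using LIMSEQ_unique[OF weak[OF that(1)]] cesaro_mean_tendsto[OF that(2)] ipH[OF that(1)] by simp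
  have "ip h h = a"
    using cesaro[OF h(1)] lim_a ip_comm by simp
  show ?thesis
  proof (rule that[OF r(1) h(1)])
    show "(\<lambda>k. LINT x|N. h x \<bullet> g (r k) x) \<longlonglongrightarrow> (LINT x|N. (norm (h x))\<^sup>2)"
      using lim_a \<open>ip h h = a\<close> by (simp add: ip_def power2_norm_eq_inner)
    show "(LINT x|N. h x \<bullet> \<psi> x) = l"
      if "square_integrable N \<psi>" "(\<lambda>k. LINT x|N. g (r k) x \<bullet> \<psi> x) \<longlonglongrightarrow> l" for \<psi> l
      using cesaro that by (simp add: ip_def)
  qed
qed

section \<open>Integrals that tend to zero\<close>

text \<open>The excess of \<open>|f k|\<close> over \<open>\<epsilon> * E k\<close> is dominated by a fixed integrable function, so dominated
  convergence applies to it, and the rest has integral at most \<open>\<epsilon> * K\<close>. This takes the place both of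
  the Brezis--Lieb lemma and of strong local convergence.\<close>

lemma integral_tendsto_0_epsilon_dominated:
  fixes f E :: "nat \<Rightarrow> 'b \<Rightarrow> real"
  assumes [measurable]: "\<And>k. f k \<in> borel_measurable N"
    and lim: "AE x in N. (\<lambda>k. f k x) \<longlonglongrightarrow> 0"
    and E: "\<And>k. integrable N (E k)" "\<And>k x. 0 \<le> E k x" "\<And>k. (LINT x|N. E k x) \<le> K"
    and dom: "\<And>\<epsilon>. \<epsilon> > 0 \<Longrightarrow> \<exists>C. integrable N C \<and> (\<forall>k. AE x in N. \<bar>f k x\<bar> \<le> \<epsilon> * E k x + C x)"
  shows "\<And>k. integrable N (f k)" and "(\<lambda>k. LINT x|N. \<bar>f k x\<bar>) \<longlonglongrightarrow> 0" and "(\<lambda>k. LINT x|N. f k x) \<longlonglongrightarrow> 0"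
proof -
  show int: "integrable N (f k)" for k
  proof -
    obtain C where C: "integrable N C" "\<And>k. AE x in N. \<bar>f k x\<bar> \<le> 1 * E k x + C x"
      using dom[of 1] by auto
    have "integrable N (\<lambda>x. 1 * E k x + C x)" using C(1) E(1) by simp
    then show ?thesis
      by (rule Bochner_Integration.integrable_bound) (use C(2)[of k] in auto)
  qed
  have "0 \<le> (LINT x|N. E 0 x)" using E(2) by simp
  then have "K \<ge> 0" using E(3)[of 0] by linarith
  show abs: "(\<lambda>k. LINT x|N. \<bar>f k x\<bar>) \<longlonglongrightarrow> 0"
  proof (rule LIMSEQ_I)
    fix e :: real assume "e > 0"
    define \<epsilon> where "\<epsilon> = e / (2 * (K + 1))"
    have "\<epsilon> > 0" using \<open>e > 0\<close> \<open>K \<ge> 0\<close> by (simp add: \<epsilon>_def)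
    have "\<epsilon> * K < \<epsilon> * (K + 1)" using \<open>\<epsilon> > 0\<close> by simp
    also have "\<epsilon> * (K + 1) = e / 2" using \<open>K \<ge> 0\<close> by (simp add: \<epsilon>_def field_simps)
    finally have \<epsilon>K: "\<epsilon> * K < e / 2" .
    obtain C where C: "integrable N C" "\<And>k. AE x in N. \<bar>f k x\<bar> \<le> \<epsilon> * E k x + C x"
      using dom[OF \<open>\<epsilon> > 0\<close>] by auto
    have [measurable]: "E k \<in> borel_measurable N" for k using E(1) by auto
    let ?h = "\<lambda>k x. max 0 (\<bar>f k x\<bar> - \<epsilon> * E k x)"
    have "(\<lambda>k. LINT x|N. ?h k x) \<longlonglongrightarrow> (LINT x|N. 0)"
    proof (rule integral_dominated_convergence[where w = "\<lambda>x. \<bar>C x\<bar>"])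
      show "AE x in N. (\<lambda>k. ?h k x) \<longlonglongrightarrow> 0"
      proof (rule AE_mp[OF lim], intro AE_I2 impI)
        fix x assume "(\<lambda>k. f k x) \<longlonglongrightarrow> 0"
        then have "(\<lambda>k. \<bar>f k x\<bar>) \<longlonglongrightarrow> 0" by (rule tendsto_rabs_zero)
        then show "(\<lambda>k. ?h k x) \<longlonglongrightarrow> 0"
        proof (rule Lim_null_comparison[rotated])
          show "\<forall>\<^sub>F k in sequentially. norm (?h k x) \<le> \<bar>f k x\<bar>"
            using E(2) \<open>\<epsilon> > 0\<close> by (intro always_eventually allI) (simp add: max_def mult_nonneg_nonneg less_imp_le)
        qed
      qed
      show "AE x in N. norm (?h k x) \<le> \<bar>C x\<bar>" for k
        using C(2)[of k] by eventually_elim auto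
    qed (use C(1) in auto)
    then obtain n0 where n0: "\<And>k. k \<ge> n0 \<Longrightarrow> (LINT x|N. ?h k x) < e / 2"
      using order_tendstoD(2)[of "\<lambda>k. LINT x|N. ?h k x" 0 sequentially "e / 2"] \<open>e > 0\<close>
      by (auto simp: eventually_sequentially)
    have "norm ((LINT x|N. \<bar>f k x\<bar>) - 0) < e" if "k \<ge> n0" for k
    proof -
      have ih: "integrable N (?h k)" using int[of k] E(1)[of k] by simp
      have "(LINT x|N. \<bar>f k x\<bar>) \<le> (LINT x|N. ?h k x + \<epsilon> * E k x)"
        using int[of k] E(1)[of k] ih by (intro integral_mono) auto
      also have "\<dots> = (LINT x|N. ?h k x) + \<epsilon> * (LINT x|N. E k x)"
        using ih E(1)[of k] by simp
      also have "\<dots> \<le> (LINT x|N. ?h k x) + \<epsilon> * K"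
        using \<open>\<epsilon> > 0\<close> by (intro add_left_mono mult_left_mono E(3)) auto
      also have "\<dots> < e" using n0[OF that] \<epsilon>K by linarith
      finally show ?thesis by simp
    qed
    then show "\<exists>n0. \<forall>k\<ge>n0. norm ((LINT x|N. \<bar>f k x\<bar>) - 0) < e" by blast
  qed
  show "(\<lambda>k. LINT x|N. f k x) \<longlonglongrightarrow> 0"
    by (rule Lim_null_comparison[OF always_eventually abs]) (auto intro: integral_abs_bound)
qed

section \<open>The space \<open>H\<^sup>1\<close>\<close>

lemma lebesgue_measurable_of_borel:
  "f \<in> borel_measurable borel \<Longrightarrow> f \<in> borel_measurable lebesgue"
  by (simp add: measurable_completion)

lemma borel_representative:
  fixes f :: "'b::euclidean_space \<Rightarrow> 'a::euclidean_space"
  assumes [measurable]: "f \<in> borel_measurable lebesgue"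
  obtains f' where "f' \<in> borel_measurable borel" "AE x in lebesgue. f x = f' x"
proof -
  have "\<exists>f'\<in>borel_measurable lborel. AE x in lborel. f x \<bullet> b = f' x" for b
    by (rule completion_ex_borel_measurable_real) measurable
  then obtain c where c: "\<And>b. c b \<in> borel_measurable borel" "\<And>b. AE x in lborel. f x \<bullet> b = c b x"
    by simp metis
  let ?f = "\<lambda>x. \<Sum>b\<in>Basis. c b x *\<^sub>R b"
  have "?f \<in> borel_measurable borel" using c(1) by measurable
  moreover have "AE x in lborel. \<forall>b\<in>Basis. f x \<bullet> b = c b x"
    using c(2) by (intro AE_finite_allI) auto
  then have "AE x in lborel. f x = ?f x"
  proof (rule AE_mp, intro AE_I2 impI)
    fix x assume "\<forall>b\<in>Basis. f x \<bullet> b = c b x"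
    then have "?f x = (\<Sum>b\<in>Basis. (f x \<bullet> b) *\<^sub>R b)" by simp
    then show "f x = ?f x" by (simp add: euclidean_representation)
  qed
  ultimately show ?thesis
    using that[of ?f] by (simp add: AE_completion_iff)
qed

lemma square_integrable_cong_AE:
  assumes "f \<in> borel_measurable N" "f' \<in> borel_measurable N" "AE x in N. f x = f' x"
  shows "square_integrable N f \<longleftrightarrow> square_integrable N f'"
proof -
  have "integrable N (\<lambda>x. (norm (f x))\<^sup>2) \<longleftrightarrow> integrable N (\<lambda>x. (norm (f' x))\<^sup>2)"
    using assms by (intro Bochner_Integration.integrable_cong_AE) auto
  then show ?thesis using assms by (simp add: square_integrable_def)
qed

lemma square_integrable_lborel:
  assumes "f \<in> borel_measurable borel"
  shows "square_integrable lebesgue f \<longleftrightarrow> square_integrable lborel f"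
  using assms by (simp add: square_integrable_def integrable_completion lebesgue_measurable_of_borel)

lemma test_function_L2:
  assumes "test_function \<phi>"
  shows "square_integrable lebesgue \<phi>" "square_integrable lebesgue (\<lambda>x. frechet_derivative \<phi> (at x) b)"
  using test_function_measurable[OF assms] test_function_square_integrable[OF assms]
  by (simp_all add: square_integrable_lborel, simp_all add: square_integrable_def)

lemma square_integrable_inner_const:
  assumes "square_integrable N g"
  shows "square_integrable N (\<lambda>x. g x \<bullet> b)"
proof -
  have [measurable]: "g \<in> borel_measurable N" and "integrable N (\<lambda>x. (norm (g x))\<^sup>2)"
    using assms by (auto simp: square_integrable_def)
  then have "(\<lambda>x. g x \<bullet> b) \<in> borel_measurable N" "integrable N (\<lambda>x. (g x \<bullet> b)\<^sup>2)"
    using integrable_inner_square[of g N b] by auto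
  then show ?thesis by (simp add: square_integrable_def)
qed

lemma square_integrable_local:
  fixes f :: "'b::euclidean_space \<Rightarrow> 'c::euclidean_space"
  assumes f: "square_integrable lebesgue f" and "compact K"
  shows "f absolutely_integrable_on K"
  unfolding set_integrable_def
proof (rule Bochner_Integration.integrable_bound)
  have K[measurable]: "K \<in> sets lebesgue" using borel_compact[OF \<open>compact K\<close>] by simp
  have [measurable]: "f \<in> borel_measurable lebesgue" using f by (simp add: square_integrable_def)
  show "(\<lambda>x. indicat_real K x *\<^sub>R f x) \<in> borel_measurable lebesgue" by measurable
  have "integrable lebesgue (indicat_real K)"
    using lmeasurable_compact[OF \<open>compact K\<close>] by (rule lmeasurable_iff_integrable[THEN iffD1])
  then show "integrable lebesgue (\<lambda>x. indicat_real K x + (norm (f x))\<^sup>2)"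
    using f by (simp add: square_integrable_def)
  have "norm (f x) \<le> 1 + (norm (f x))\<^sup>2" for x
    using sum_squares_bound[of 1 "norm (f x)"] norm_ge_zero[of "f x"] by (simp only: power_one)
  then show "AE x in lebesgue. norm (indicat_real K x *\<^sub>R f x) \<le> norm (indicat_real K x + (norm (f x))\<^sup>2)"
    by (intro AE_I2) (auto simp: indicator_def)
qed

lemma weak_gradient_measurable:
  assumes "weak_gradient u g"
  shows "g \<in> borel_measurable lebesgue"
proof (rule borel_measurable_LIMSEQ_metric)
  show "(\<lambda>x. indicat_real (cball 0 (real n)) x *\<^sub>R g x) \<in> borel_measurable lebesgue" for n
    using assms unfolding weak_gradient_def set_integrable_def
    by (intro borel_measurable_integrable) (auto simp: compact_cball)
  fix x :: 'a
  obtain n0 :: nat where "norm x \<le> real n0" using real_arch_simple by blast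
  then have "indicat_real (cball 0 (real n)) x *\<^sub>R g x = g x" if "n \<ge> n0" for n
    using that by (simp add: indicator_def)
  then show "(\<lambda>n. indicat_real (cball 0 (real n)) x *\<^sub>R g x) \<longlonglongrightarrow> g x"
    by (intro tendsto_eventually eventually_sequentiallyI[of n0]) auto
qed

text \<open>The difference of the two gradients has integral zero against every test function, so the
  fundamental lemma applies to each of its components.\<close>

lemma weak_gradient_unique:
  assumes g: "weak_gradient u g" and h: "weak_gradient v h" and eq: "AE x in lebesgue. u x = v x"
    and [measurable]: "u \<in> borel_measurable lebesgue" "v \<in> borel_measurable lebesgue"
  shows "AE x in lebesgue. g x = h x"
proof -
  have [measurable]: "g \<in> borel_measurable lebesgue" "h \<in> borel_measurable lebesgue"
    using weak_gradient_measurable g h by auto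
  have "AE x in lebesgue. (g x - h x) \<bullet> b = 0" if b: "b \<in> Basis" for b
  proof -
    obtain f where [measurable]: "f \<in> borel_measurable borel" and f: "AE x in lebesgue. (g x - h x) \<bullet> b = f x"
      by (rule borel_representative[of "\<lambda>x. (g x - h x) \<bullet> b"]) measurable
    note fl[measurable] = lebesgue_measurable_of_borel[OF \<open>f \<in> borel_measurable borel\<close>]
    have loc: "integrable lebesgue (\<lambda>x. indicat_real K x * (g x \<bullet> b))"
      "integrable lebesgue (\<lambda>x. indicat_real K x * (h x \<bullet> b))" if "compact K" for K
    proof -
      have "integrable lebesgue (\<lambda>x. indicat_real K x *\<^sub>R g x)" "integrable lebesgue (\<lambda>x. indicat_real K x *\<^sub>R h x)"
        using g h that by (auto simp: weak_gradient_def set_integrable_def)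
      from this[THEN integrable_inner_left, of b] show
        "integrable lebesgue (\<lambda>x. indicat_real K x * (g x \<bullet> b))"
        "integrable lebesgue (\<lambda>x. indicat_real K x * (h x \<bullet> b))" by simp_all
    qed
    have "AE x in lborel. f x = 0"
    proof (rule fundamental_lemma_borel)
      fix K :: "'a set" assume K: "compact K"
      then have [measurable]: "K \<in> sets borel" by (simp add: compact_imp_closed)
      then have [measurable]: "K \<in> sets lebesgue" by simp
      have "integrable lebesgue (\<lambda>x. indicat_real K x * (g x \<bullet> b) - indicat_real K x * (h x \<bullet> b))"
        using loc[OF K] by simp
      also have "?this \<longleftrightarrow> integrable lebesgue (\<lambda>x. indicat_real K x * f x)"
        using f by (intro Bochner_Integration.integrable_cong_AE) (auto simp: inner_diff_left algebra_simps)
      finally show "integrable lborel (\<lambda>x. indicat_real K x * f x)"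
        by (subst (asm) integrable_completion) auto
    next
      fix \<phi> :: "'a \<Rightarrow> real" assume \<phi>: "test_function \<phi>"
      note [measurable] = test_function_measurable[OF \<phi>]
        test_function_measurable[OF \<phi>, THEN lebesgue_measurable_of_borel]
      obtain R where R: "\<And>x. \<phi> x \<noteq> 0 \<Longrightarrow> norm x \<le> R"
        using test_function_support[OF \<phi>] by blast
      obtain B where B: "B \<ge> 0" "\<And>x. \<bar>\<phi> x\<bar> \<le> B"
        using continuous_compact_support_bounded[OF test_function_continuous[OF \<phi>] R] by metis
      have int: "integrable lebesgue (\<lambda>x. k x * \<phi> x)"
        if [measurable]: "k \<in> borel_measurable lebesgue"
          and "integrable lebesgue (\<lambda>x. indicat_real (cball 0 R) x * k x)" for k
      proof (rule Bochner_Integration.integrable_bound)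
        show "integrable lebesgue (\<lambda>x. B * (indicat_real (cball 0 R) x * k x))" using that by simp
        have "\<bar>k x * \<phi> x\<bar> \<le> \<bar>B * (indicat_real (cball 0 R) x * k x)\<bar>" for x
        proof (cases "\<phi> x = 0")
          case False
          have "\<bar>\<phi> x\<bar> * \<bar>k x\<bar> \<le> B * \<bar>k x\<bar>" by (intro mult_right_mono B) simp
          then show ?thesis using False R[of x] B(1) by (simp add: abs_mult mult.commute)
        qed simp
        then show "AE x in lebesgue. norm (k x * \<phi> x) \<le> norm (B * (indicat_real (cball 0 R) x * k x))"
          by simp
      qed measurable
      have "(LINT x|lborel. f x * \<phi> x) = (LINT x|lebesgue. f x * \<phi> x)"
        by (rule integral_completion[symmetric]) measurable
      also have "\<dots> = (LINT x|lebesgue. (g x \<bullet> b) * \<phi> x - (h x \<bullet> b) * \<phi> x)"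
        using f by (intro integral_cong_AE) (auto simp: inner_diff_left algebra_simps)
      also have "\<dots> = (LINT x|lebesgue. (g x \<bullet> b) * \<phi> x) - (LINT x|lebesgue. (h x \<bullet> b) * \<phi> x)"
        using loc[OF compact_cball, of 0 R] by (intro Bochner_Integration.integral_diff int) auto
      also have "\<dots> = (LINT x|lebesgue. v x * frechet_derivative \<phi> (at x) b) - (LINT x|lebesgue. u x * frechet_derivative \<phi> (at x) b)"
        using g h \<phi> b unfolding weak_gradient_def by simp
      also have "(LINT x|lebesgue. v x * frechet_derivative \<phi> (at x) b) = (LINT x|lebesgue. u x * frechet_derivative \<phi> (at x) b)"
        using eq by (intro integral_cong_AE) auto
      finally show "(LINT x|lborel. f x * \<phi> x) = 0" by simp
    qed measurable
    then have "AE x in lebesgue. f x = 0" by (simp add: AE_completion_iff)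
    then show ?thesis using f by eventually_elim simp
  qed
  then have "AE x in lebesgue. \<forall>b\<in>Basis. (g x - h x) \<bullet> b = 0"
    by (intro AE_finite_allI) auto
  then show ?thesis
    by eventually_elim (metis (no_types) euclidean_all_zero_iff eq_iff_diff_eq_0)
qed

text \<open>By uniqueness, the chosen gradient inherits square integrability from the one that membership in
  \<open>H\<^sup>1\<close> provides.\<close>

lemma H1_grad:
  assumes "u \<in> H1"
  shows "square_integrable lebesgue u" "square_integrable lebesgue (grad u)" "weak_gradient u (grad u)"
proof -
  obtain g where g: "weak_gradient u g" "integrable lebesgue (\<lambda>x. (norm (g x))\<^sup>2)"
    and u: "u \<in> borel_measurable lebesgue" "integrable lebesgue (\<lambda>x. (u x)\<^sup>2)"
    using assms by (auto simp: H1_def)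
  show w: "weak_gradient u (grad u)"
    unfolding grad_def by (rule someI[of "weak_gradient u", OF g(1)])
  show "square_integrable lebesgue u" using u by (simp add: square_integrable_def)
  have "square_integrable lebesgue g"
    using g weak_gradient_measurable by (auto simp: square_integrable_def)
  moreover have "AE x in lebesgue. grad u x = g x"
    using weak_gradient_unique[OF w g(1)] u by simp
  ultimately show "square_integrable lebesgue (grad u)"
    using square_integrable_cong_AE weak_gradient_measurable w g(1) by blast
qed

lemma H1_intro:
  assumes u: "square_integrable lebesgue u" and g: "square_integrable lebesgue g"
    and eq: "\<And>\<phi> b. test_function \<phi> \<Longrightarrow> b \<in> Basis \<Longrightarrow>
      (LINT x|lebesgue. u x * frechet_derivative \<phi> (at x) b) = - (LINT x|lebesgue. (g x \<bullet> b) * \<phi> x)"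
  shows "u \<in> H1" "AE x in lebesgue. grad u x = g x"
proof -
  have w: "weak_gradient u g"
    unfolding weak_gradient_def using square_integrable_local[OF u] square_integrable_local[OF g] eq by blast
  then show "u \<in> H1"
    using u g by (auto simp: H1_def square_integrable_def)
  from H1_grad(3)[OF this] w show "AE x in lebesgue. grad u x = g x"
    using u by (intro weak_gradient_unique) (auto simp: square_integrable_def)
qed

lemma integrable_mult_L2:
  fixes f g :: "'b \<Rightarrow> real"
  assumes "square_integrable N f" "square_integrable N g"
  shows "integrable N (\<lambda>x. f x * g x)"
  using integrable_inner_L2[OF assms] by simp

lemma H1_weak_identity:
  assumes "u \<in> H1" "test_function \<phi>" "b \<in> Basis"
  shows "(LINT x|lebesgue. u x * frechet_derivative \<phi> (at x) b) = - (LINT x|lebesgue. (grad u x \<bullet> b) * \<phi> x)"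
  using H1_grad(3)[OF assms(1)] assms(2,3) by (simp add: weak_gradient_def)

lemma H1_linear_combination:
  assumes u: "u \<in> H1" and v: "v \<in> H1"
  shows "(\<lambda>x. u x + t * v x) \<in> H1"
    and "AE x in lebesgue. grad (\<lambda>x. u x + t * v x) x = grad u x + t *\<^sub>R grad v x"
proof -
  have 1: "square_integrable lebesgue (\<lambda>x. u x + t * v x)"
    using square_integrable_add[OF H1_grad(1)[OF u] square_integrable_scale[OF H1_grad(1)[OF v], of t]] by simp
  have 2: "square_integrable lebesgue (\<lambda>x. grad u x + t *\<^sub>R grad v x)"
    using square_integrable_add[OF H1_grad(2)[OF u] square_integrable_scale[OF H1_grad(2)[OF v], of t]] .
  have 3: "(LINT x|lebesgue. (u x + t * v x) * frechet_derivative \<phi> (at x) b) =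
      - (LINT x|lebesgue. ((grad u x + t *\<^sub>R grad v x) \<bullet> b) * \<phi> x)"
    if \<phi>: "test_function \<phi>" and b: "b \<in> Basis" for \<phi> b
  proof -
    note L2 = test_function_L2[OF \<phi>]
    have "(LINT x|lebesgue. (u x + t * v x) * frechet_derivative \<phi> (at x) b) =
        (LINT x|lebesgue. u x * frechet_derivative \<phi> (at x) b) + t * (LINT x|lebesgue. v x * frechet_derivative \<phi> (at x) b)"
      using integrable_mult_L2[OF H1_grad(1)[OF u] L2(2)[of b]] integrable_mult_L2[OF H1_grad(1)[OF v] L2(2)[of b]]
      by (simp add: distrib_right mult.assoc)
    also have "\<dots> = - ((LINT x|lebesgue. (grad u x \<bullet> b) * \<phi> x) + t * (LINT x|lebesgue. (grad v x \<bullet> b) * \<phi> x))"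
      using H1_weak_identity[OF u \<phi> b] H1_weak_identity[OF v \<phi> b] by simp
    also have "(LINT x|lebesgue. (grad u x \<bullet> b) * \<phi> x) + t * (LINT x|lebesgue. (grad v x \<bullet> b) * \<phi> x) =
        (LINT x|lebesgue. ((grad u x + t *\<^sub>R grad v x) \<bullet> b) * \<phi> x)"
      using integrable_mult_L2[OF square_integrable_inner_const[OF H1_grad(2)[OF u], of b] L2(1)]
        integrable_mult_L2[OF square_integrable_inner_const[OF H1_grad(2)[OF v], of b] L2(1)]
      by (simp add: inner_add_left distrib_right mult.assoc)
    finally show ?thesis .
  qed
  show "(\<lambda>x. u x + t * v x) \<in> H1" "AE x in lebesgue. grad (\<lambda>x. u x + t * v x) x = grad u x + t *\<^sub>R grad v x"
    by (rule H1_intro[OF 1 2 3]; assumption)+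
qed

lemma H1_zero: "(\<lambda>x. 0) \<in> H1"
  by (rule H1_intro(1)[where g = "\<lambda>x. 0"]) (auto simp: square_integrable_zero)

lemma H1_norm_square:
  assumes "u \<in> H1"
  shows "(H1_norm u)\<^sup>2 = (LINT x|lebesgue. (norm (grad u x))\<^sup>2) + (LINT x|lebesgue. (u x)\<^sup>2)"
  using H1_grad[OF assms] unfolding H1_norm_def
  by (subst real_sqrt_pow2) (auto simp: square_integrable_def)

lemma H1_norm_nonneg: "H1_norm u \<ge> 0"
  by (simp add: H1_norm_def)

lemma sobolev_pair_imp_H1:
  assumes "sobolev_pair u g"
  shows "u \<in> H1" "AE x in lebesgue. grad u x = g x"
proof -
  note s = sobolev_pairD[OF assms]
  have 1: "square_integrable lebesgue u" "square_integrable lebesgue g"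
    using s by (simp_all add: square_integrable_lborel, simp_all add: square_integrable_def)
  have 2: "(LINT x|lebesgue. u x * frechet_derivative \<phi> (at x) b) = - (LINT x|lebesgue. (g x \<bullet> b) * \<phi> x)"
    if "test_function \<phi>" "b \<in> Basis" for \<phi> b
    using s(5)[OF that] s(1,2) test_function_measurable[OF that(1)] by (simp add: integral_completion)
  show "u \<in> H1" "AE x in lebesgue. grad u x = g x"
    by (rule H1_intro[OF 1 2]; assumption)+
qed

lemma H1_borel_representative:
  assumes u: "u \<in> H1"
  obtains u' g' where "sobolev_pair u' g'" "AE x in lebesgue. u x = u' x" "AE x in lebesgue. grad u x = g' x"
    "(LINT x|lborel. (u' x)\<^sup>2) \<le> (H1_norm u)\<^sup>2" "(LINT x|lborel. (norm (g' x))\<^sup>2) \<le> (H1_norm u)\<^sup>2"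
proof -
  have m[measurable]: "u \<in> borel_measurable lebesgue" "grad u \<in> borel_measurable lebesgue"
    using H1_grad[OF u] by (auto simp: square_integrable_def)
  obtain u' where u'[measurable]: "u' \<in> borel_measurable borel" and equ: "AE x in lebesgue. u x = u' x"
    by (rule borel_representative[OF m(1)])
  obtain g' where g'[measurable]: "g' \<in> borel_measurable borel" and eqg: "AE x in lebesgue. grad u x = g' x"
    by (rule borel_representative[OF m(2)])
  note ul[measurable] = lebesgue_measurable_of_borel[OF u'] lebesgue_measurable_of_borel[OF g']
  have "square_integrable lebesgue u'" "square_integrable lebesgue g'"
    using square_integrable_cong_AE[OF m(1) ul(1) equ] square_integrable_cong_AE[OF m(2) ul(2) eqg] H1_grad[OF u]
    by auto
  then have L2: "square_integrable lborel u'" "square_integrable lborel g'"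
    by (simp_all add: square_integrable_lborel)
  have eq: "(LINT x|lborel. u' x * frechet_derivative \<phi> (at x) b) = - (LINT x|lborel. (g' x \<bullet> b) * \<phi> x)"
    if \<phi>: "test_function \<phi>" and b: "b \<in> Basis" for \<phi> b
  proof -
    note [measurable] = test_function_measurable[OF \<phi>]
      test_function_measurable[OF \<phi>, THEN lebesgue_measurable_of_borel]
    have "(LINT x|lborel. u' x * frechet_derivative \<phi> (at x) b) = (LINT x|lebesgue. u' x * frechet_derivative \<phi> (at x) b)"
      by (rule integral_completion[symmetric]) measurable
    also have "\<dots> = (LINT x|lebesgue. u x * frechet_derivative \<phi> (at x) b)"
      using equ by (intro integral_cong_AE) auto
    also have "\<dots> = - (LINT x|lebesgue. (grad u x \<bullet> b) * \<phi> x)" by (rule H1_weak_identity[OF u \<phi> b])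
    also have "(LINT x|lebesgue. (grad u x \<bullet> b) * \<phi> x) = (LINT x|lebesgue. (g' x \<bullet> b) * \<phi> x)"
      using eqg by (intro integral_cong_AE) auto
    also have "\<dots> = (LINT x|lborel. (g' x \<bullet> b) * \<phi> x)"
      by (rule integral_completion) measurable
    finally show ?thesis .
  qed
  have "sobolev_pair u' g'"
    using L2 eq u' g' by (auto simp: sobolev_pair_def square_integrable_def)
  moreover have "(LINT x|lborel. (u' x)\<^sup>2) = (LINT x|lebesgue. (u x)\<^sup>2)"
    using equ by (subst integral_completion[symmetric], measurable) (intro integral_cong_AE, auto)
  moreover have "(LINT x|lborel. (norm (g' x))\<^sup>2) = (LINT x|lebesgue. (norm (grad u x))\<^sup>2)"
    using eqg by (subst integral_completion[symmetric], measurable) (intro integral_cong_AE, auto)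
  moreover have "0 \<le> (LINT x|lebesgue. (u x)\<^sup>2)" "0 \<le> (LINT x|lebesgue. (norm (grad u x))\<^sup>2)"
    by simp_all
  ultimately show ?thesis
    using that[OF _ equ eqg] H1_norm_square[OF u] by linarith
qed

lemma H1_sobolev_embedding:
  fixes q R :: real
  assumes q: "2 < q" "ereal q < critical_exponent DIM('a::euclidean_space)" and "R > 0"
    and N: "DIM('a) \<ge> 2"
  obtains B where "\<And>u :: 'a \<Rightarrow> real. u \<in> H1 \<Longrightarrow> H1_norm u \<le> R \<Longrightarrow>
    integrable lebesgue (\<lambda>x. \<bar>u x\<bar> powr q) \<and> (LINT x|lebesgue. \<bar>u x\<bar> powr q) \<le> B"
proof -
  obtain B where B: "\<And>(u :: 'a \<Rightarrow> real) g. sobolev_pair u g \<Longrightarrow>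
    (LINT y|lborel. (u y)\<^sup>2) \<le> R\<^sup>2 \<Longrightarrow> (LINT y|lborel. (norm (g y))\<^sup>2) \<le> R\<^sup>2 \<Longrightarrow>
    (\<integral>\<^sup>+ x. ennreal (\<bar>u x\<bar> powr q) \<partial>lborel) \<le> ennreal B"
    using sobolev_embedding[OF q \<open>R > 0\<close> N] by metis
  have "integrable lebesgue (\<lambda>x. \<bar>u x\<bar> powr q) \<and> (LINT x|lebesgue. \<bar>u x\<bar> powr q) \<le> max B 0"
    if u: "u \<in> H1" and "H1_norm u \<le> R" for u :: "'a \<Rightarrow> real"
  proof -
    obtain u' g' where s: "sobolev_pair u' g'" and eq: "AE x in lebesgue. u x = u' x"
      and b: "(LINT x|lborel. (u' x)\<^sup>2) \<le> (H1_norm u)\<^sup>2" "(LINT x|lborel. (norm (g' x))\<^sup>2) \<le> (H1_norm u)\<^sup>2"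
      by (rule H1_borel_representative[OF u])
    have [measurable]: "u \<in> borel_measurable lebesgue"
      using H1_grad[OF u] by (simp add: square_integrable_def)
    have "(H1_norm u)\<^sup>2 \<le> R\<^sup>2"
      using \<open>H1_norm u \<le> R\<close> H1_norm_nonneg[of u] by (intro power_mono) auto
    with b have "(\<integral>\<^sup>+ x. ennreal (\<bar>u' x\<bar> powr q) \<partial>lborel) \<le> ennreal B"
      by (intro B[OF s]) auto
    moreover have "(\<integral>\<^sup>+ x. ennreal (\<bar>u x\<bar> powr q) \<partial>lebesgue) = (\<integral>\<^sup>+ x. ennreal (\<bar>u' x\<bar> powr q) \<partial>lborel)"
      unfolding nn_integral_completion
      using eq by (intro nn_integral_cong_AE) (auto simp: AE_completion_iff)
    ultimately have le: "(\<integral>\<^sup>+ x. ennreal (\<bar>u x\<bar> powr q) \<partial>lebesgue) \<le> ennreal B" by simp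
    then have "integrable lebesgue (\<lambda>x. \<bar>u x\<bar> powr q)"
      by (intro integrableI_nonneg) (auto intro: order_le_less_trans)
    moreover from this le have "ennreal (LINT x|lebesgue. \<bar>u x\<bar> powr q) \<le> ennreal B"
      by (simp add: nn_integral_eq_integral)
    then have "(LINT x|lebesgue. \<bar>u x\<bar> powr q) \<le> max B 0"
      by (simp add: ennreal_le_iff2) linarith
    ultimately show ?thesis by blast
  qed
  then show ?thesis by (rule that)
qed

text \<open>The limit of the functions comes from the almost everywhere convergent subsequence, the
  limit of the gradients from the Banach--Saks argument; testing against \<open>\<phi> b\<close> shows that the
  second is the weak gradient of the first.\<close>

lemma H1_weak_compactness:
  fixes u :: "nat \<Rightarrow> 'a::euclidean_space \<Rightarrow> real"
  assumes u: "\<And>k. u k \<in> H1" and bound: "\<And>k. H1_norm (u k) \<le> R"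
  obtains r w where "strict_mono (r :: nat \<Rightarrow> nat)" "w \<in> H1" "AE x in lebesgue. (\<lambda>k. u (r k) x) \<longlonglongrightarrow> w x"
    "(\<lambda>k. LINT x|lebesgue. grad w x \<bullet> grad (u (r k)) x) \<longlonglongrightarrow> (LINT x|lebesgue. (norm (grad w x))\<^sup>2)"
proof -
  define S where "S = max R 1"
  have "S > 0" by (simp add: S_def)
  have S: "(H1_norm (u k))\<^sup>2 \<le> S\<^sup>2" for k
    using bound[of k] H1_norm_nonneg[of "u k"] by (intro power_mono) (auto simp: S_def)
  define P where "P k z \<longleftrightarrow> sobolev_pair (fst z) (snd z) \<and> (AE x in lebesgue. u k x = fst z x)
    \<and> (AE x in lebesgue. grad (u k) x = snd z x)
    \<and> (LINT x|lborel. (fst z x)\<^sup>2) \<le> S\<^sup>2 \<and> (LINT x|lborel. (norm (snd z x))\<^sup>2) \<le> S\<^sup>2" for k z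
  have "\<exists>z. P k z" for k
  proof -
    obtain u' g' where 1: "sobolev_pair u' g'" "AE x in lebesgue. u k x = u' x" "AE x in lebesgue. grad (u k) x = g' x"
      and 2: "(LINT x|lborel. (u' x)\<^sup>2) \<le> (H1_norm (u k))\<^sup>2" "(LINT x|lborel. (norm (g' x))\<^sup>2) \<le> (H1_norm (u k))\<^sup>2"
      by (rule H1_borel_representative[OF u])
    have "P k (u', g')"
      unfolding P_def fst_conv snd_conv by (intro conjI 1 order_trans[OF 2(1) S] order_trans[OF 2(2) S])
    then show ?thesis by blast
  qed
  then obtain z where Pz: "\<And>k. P k (z k)" by metis
  have z: "sobolev_pair (fst (z k)) (snd (z k))" "AE x in lebesgue. u k x = fst (z k) x"
    "AE x in lebesgue. grad (u k) x = snd (z k) x"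
    "(LINT x|lborel. (fst (z k) x)\<^sup>2) \<le> S\<^sup>2" "(LINT x|lborel. (norm (snd (z k) x))\<^sup>2) \<le> S\<^sup>2" for k
    using Pz[of k] unfolding P_def by blast+
  define u' g' where "u' k = fst (z k)" and "g' k = snd (z k)" for k
  note z = z[folded u'_def g'_def]
  note s = sobolev_pairD[OF z(1)]
  note [measurable] = s(1,2)
  obtain r1 where r1: "strict_mono r1" "AE x in lborel. convergent (\<lambda>k. u' (r1 k) x)"
    using bounded_sobolev_ae_convergent_subsequence[of u' g' S] z(1,4,5) \<open>S > 0\<close> by blast
  have g'L2: "square_integrable lborel (g' k)" for k
    using s(2,4) by (simp add: square_integrable_def)
  obtain r2 h where r2: "strict_mono (r2 :: nat \<Rightarrow> nat)" and h: "square_integrable lborel h"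
    and hh: "(\<lambda>k. LINT x|lborel. h x \<bullet> g' (r1 (r2 k)) x) \<longlonglongrightarrow> (LINT x|lborel. (norm (h x))\<^sup>2)"
    and weak: "\<And>\<psi> l. square_integrable lborel \<psi> \<Longrightarrow> (\<lambda>k. LINT x|lborel. g' (r1 (r2 k)) x \<bullet> \<psi> x) \<longlonglongrightarrow> l \<Longrightarrow>
      (LINT x|lborel. h x \<bullet> \<psi> x) = l"
    by (rule banach_saks_L2[of lborel "\<lambda>k. g' (r1 k)" "S\<^sup>2", OF sigma_finite_lborel g'L2 z(5)]) (rule that)
  define r where "r = r1 \<circ> r2"
  have r: "strict_mono r" unfolding r_def by (rule strict_mono_o[OF r1(1) r2])
  define w where "w x = lim (\<lambda>k. u' (r k) x)" for x
  have [measurable]: "w \<in> borel_measurable borel" unfolding w_def[abs_def] by measurable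
  have lim: "AE x in lborel. (\<lambda>k. u' (r k) x) \<longlonglongrightarrow> w x"
  proof (rule AE_mp[OF r1(2)], intro AE_I2 impI)
    fix x assume "convergent (\<lambda>k. u' (r1 k) x)"
    then have "convergent (\<lambda>k. u' (r k) x)"
      using convergent_subseq_convergent[OF _ r2, of "\<lambda>k. u' (r1 k) x"] by (simp add: r_def o_def)
    then show "(\<lambda>k. u' (r k) x) \<longlonglongrightarrow> w x" by (simp add: w_def convergent_LIMSEQ_iff)
  qed
  have w2: "integrable lborel (\<lambda>x. (w x)\<^sup>2)"
  proof (rule integrableI_nonneg)
    have "(\<integral>\<^sup>+ x. ennreal ((w x)\<^sup>2) \<partial>lborel) = (\<integral>\<^sup>+ x. liminf (\<lambda>k. ennreal ((u' (r k) x)\<^sup>2)) \<partial>lborel)"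
    proof (rule nn_integral_cong_AE, rule AE_mp[OF lim], intro AE_I2 impI)
      fix x assume "(\<lambda>k. u' (r k) x) \<longlonglongrightarrow> w x"
      then have "(\<lambda>k. ennreal ((u' (r k) x)\<^sup>2)) \<longlonglongrightarrow> ennreal ((w x)\<^sup>2)"
        by (intro tendsto_ennrealI tendsto_intros)
      then show "ennreal ((w x)\<^sup>2) = liminf (\<lambda>k. ennreal ((u' (r k) x)\<^sup>2))"
        by (rule lim_imp_Liminf[OF trivial_limit_sequentially, symmetric])
    qed
    also have "\<dots> \<le> liminf (\<lambda>k. \<integral>\<^sup>+ x. ennreal ((u' (r k) x)\<^sup>2) \<partial>lborel)"
      by (rule nn_integral_liminf) measurable
    also have "\<dots> \<le> liminf (\<lambda>k. ennreal (S\<^sup>2))"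
      using z(4) by (intro Liminf_mono always_eventually allI)
        (simp add: sobolev_pair_square_nn_integral[OF z(1)] ennreal_leI)
    also have "\<dots> < \<infinity>" by (simp add: Liminf_const)
    finally show "(\<integral>\<^sup>+ x. ennreal ((w x)\<^sup>2) \<partial>lborel) < \<infinity>" .
  qed auto
  have "sobolev_pair w h"
    unfolding sobolev_pair_def
  proof (intro conjI allI impI ballI)
    fix \<phi> :: "'a \<Rightarrow> real" and b :: 'a assume \<phi>: "test_function \<phi>" and b: "b \<in> Basis"
    note [measurable] = test_function_measurable[OF \<phi>]
    let ?d = "\<lambda>x. frechet_derivative \<phi> (at x) b"
    have d2: "integrable lborel (\<lambda>x. (?d x)\<^sup>2)" by (rule test_function_square_integrable[OF \<phi>])
    have iw: "integrable lborel (\<lambda>x. w x * ?d x)" "\<And>k. integrable lborel (\<lambda>x. u' k x * ?d x)"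
      using w2 d2 s(3) by (auto intro!: integrable_mult_of_squares)
    have "(\<lambda>k. LINT x|lborel. (u' (r k) x - w x) * ?d x) \<longlonglongrightarrow> 0"
    proof (rule integral_tendsto_0_epsilon_dominated(3)[where E = "\<lambda>k x. (u' (r k) x)\<^sup>2" and K = "S\<^sup>2"])
      show "AE x in lborel. (\<lambda>k. (u' (r k) x - w x) * ?d x) \<longlonglongrightarrow> 0"
        using lim by eventually_elim (simp add: tendsto_mult_left_zero LIM_zero)
      fix \<epsilon> :: real assume "\<epsilon> > 0"
      let ?C = "\<lambda>x. (?d x)\<^sup>2 / \<epsilon> + \<bar>w x * ?d x\<bar>"
      have "\<bar>(a - c) * d\<bar> \<le> \<epsilon> * a\<^sup>2 + (d\<^sup>2 / \<epsilon> + \<bar>c * d\<bar>)" for a c d :: real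
      proof -
        note abs_mult_le_weighted_squares[OF \<open>\<epsilon> > 0\<close>, of a d]
        moreover have "0 \<le> \<bar>a\<bar> * \<bar>d\<bar>" by simp
        moreover have "\<bar>(a - c) * d\<bar> \<le> \<bar>a\<bar> * \<bar>d\<bar> + \<bar>c * d\<bar>"
          using abs_triangle_ineq4[of "a * d" "c * d"] by (simp add: left_diff_distrib abs_mult)
        ultimately show ?thesis by linarith
      qed
      moreover have "integrable lborel ?C" using d2 iw by simp
      ultimately show "\<exists>C. integrable lborel C \<and>
          (\<forall>k. AE x in lborel. \<bar>(u' (r k) x - w x) * ?d x\<bar> \<le> \<epsilon> * (u' (r k) x)\<^sup>2 + C x)"
        by (intro exI[of _ ?C]) auto
    qed (use s(3) z(4) in auto)
    then have "(\<lambda>k. (LINT x|lborel. u' (r k) x * ?d x) - (LINT x|lborel. w x * ?d x)) \<longlonglongrightarrow> 0"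
      using iw by (simp add: left_diff_distrib)
    then have "(\<lambda>k. - (LINT x|lborel. u' (r k) x * ?d x)) \<longlonglongrightarrow> - (LINT x|lborel. w x * ?d x)"
      by (intro tendsto_intros) (simp add: LIM_zero_iff)
    then have "(\<lambda>k. LINT x|lborel. g' (r1 (r2 k)) x \<bullet> (\<phi> x *\<^sub>R b)) \<longlonglongrightarrow> - (LINT x|lborel. w x * ?d x)"
      by (simp add: s(5)[OF \<phi> b] r_def mult.commute)
    moreover have "square_integrable lborel (\<lambda>x. \<phi> x *\<^sub>R b)"
      using test_function_square_integrable(1)[OF \<phi>] b by (simp add: square_integrable_def)
    ultimately have "(LINT x|lborel. h x \<bullet> (\<phi> x *\<^sub>R b)) = - (LINT x|lborel. w x * ?d x)"
      by (intro weak)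
    then show "(LINT x|lborel. w x * ?d x) = - (LINT x|lborel. (h x \<bullet> b) * \<phi> x)"
      by (simp add: mult.commute)
  qed (use h w2 in \<open>auto simp: square_integrable_def\<close>)
  note w = sobolev_pair_imp_H1[OF this]
  have hm[measurable]: "h \<in> borel_measurable borel" using h by (simp add: square_integrable_def)
  note [measurable] = lebesgue_measurable_of_borel[OF hm] lebesgue_measurable_of_borel[OF s(2)]
  have [measurable]: "grad w \<in> borel_measurable lebesgue" "\<And>k. grad (u k) \<in> borel_measurable lebesgue"
    using H1_grad(2)[OF w(1)] H1_grad(2)[OF u] by (auto simp: square_integrable_def)
  show ?thesis
  proof (rule that[OF r w(1)])
    have "AE x in lebesgue. \<forall>k. u k x = u' k x" using z(2) by (simp add: AE_all_countable)
    moreover have "AE x in lebesgue. (\<lambda>k. u' (r k) x) \<longlonglongrightarrow> w x" using lim by (simp add: AE_completion_iff)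
    ultimately show "AE x in lebesgue. (\<lambda>k. u (r k) x) \<longlonglongrightarrow> w x" by eventually_elim simp
    have "(LINT x|lebesgue. grad w x \<bullet> grad (u (r k)) x) = (LINT x|lborel. h x \<bullet> g' (r1 (r2 k)) x)" for k
    proof -
      have "(LINT x|lebesgue. grad w x \<bullet> grad (u (r k)) x) = (LINT x|lebesgue. h x \<bullet> g' (r1 (r2 k)) x)"
      proof (rule integral_cong_AE)
        show "AE x in lebesgue. grad w x \<bullet> grad (u (r k)) x = h x \<bullet> g' (r1 (r2 k)) x"
          using w(2) z(3)[of "r k"] by eventually_elim (simp add: r_def)
      qed measurable
      also have "\<dots> = (LINT x|lborel. h x \<bullet> g' (r1 (r2 k)) x)" by (rule integral_completion) measurable
      finally show ?thesis .
    qed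
    moreover have "(LINT x|lebesgue. (norm (grad w x))\<^sup>2) = (LINT x|lborel. (norm (h x))\<^sup>2)"
    proof -
      have "(LINT x|lebesgue. (norm (grad w x))\<^sup>2) = (LINT x|lebesgue. (norm (h x))\<^sup>2)"
        using w(2) by (intro integral_cong_AE) auto
      also have "\<dots> = (LINT x|lborel. (norm (h x))\<^sup>2)" by (rule integral_completion) measurable
      finally show ?thesis .
    qed
    ultimately show "(\<lambda>k. LINT x|lebesgue. grad w x \<bullet> grad (u (r k)) x) \<longlonglongrightarrow> (LINT x|lebesgue. (norm (grad w x))\<^sup>2)"
      using hh by simp
  qed
qed

section \<open>The modular and the constraint\<close>

lemma powr_le_square_plus_powr:
  fixes a s q :: real
  assumes "0 \<le> a" "2 \<le> s" "s \<le> q"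
  shows "a powr s \<le> a\<^sup>2 + a powr q"
proof (cases "a \<le> 1")
  case True
  have "a powr s \<le> a\<^sup>2"
  proof (cases "a = 0")
    case False
    then have "a powr s \<le> a powr 2" using assms True by (intro powr_mono') auto
    then show ?thesis using assms False by simp
  qed simp
  then show ?thesis by (simp add: add_increasing2)
next
  case False
  then have "a powr s \<le> a powr q" using assms by (intro powr_mono) auto
  then show ?thesis by (simp add: add_increasing)
qed

text \<open>The derivative \<open>|a|\<^sup>s\<^sup>-\<^sup>2 a\<close> of \<open>|a|\<^sup>s / s\<close>.\<close>

definition signed_powr :: "real \<Rightarrow> real \<Rightarrow> real" where
  "signed_powr s a = \<bar>a\<bar> powr (s - 2) * a"

lemma abs_powr_minus_2_times_square:
  fixes a s :: real
  shows "\<bar>a\<bar> powr (s - 2) * a\<^sup>2 = \<bar>a\<bar> powr s"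
proof (cases "a = 0")
  case False
  then have "\<bar>a\<bar> powr s = \<bar>a\<bar> powr (s - 2) * \<bar>a\<bar> powr 2"
    using powr_add[of "\<bar>a\<bar>" "s - 2" 2] by simp
  then show ?thesis using False by simp
qed simp

lemma signed_powr_self: "signed_powr s a * a = \<bar>a\<bar> powr s"
  using abs_powr_minus_2_times_square[of a s] by (simp add: signed_powr_def power2_eq_square mult.assoc)

lemma abs_signed_powr: "\<bar>signed_powr s a\<bar> = \<bar>a\<bar> powr (s - 1)"
proof (cases "a = 0")
  case False
  then have "\<bar>a\<bar> powr (s - 1) = \<bar>a\<bar> powr (s - 2) * \<bar>a\<bar> powr 1"
    using powr_add[of "\<bar>a\<bar>" "s - 2" 1] by simp
  then show ?thesis using False by (simp add: signed_powr_def abs_mult)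
qed (simp add: signed_powr_def)

lemma tendsto_abs_powr:
  fixes f :: "'b \<Rightarrow> real"
  assumes "(f \<longlongrightarrow> a) F" "s > 0"
  shows "((\<lambda>x. \<bar>f x\<bar> powr s) \<longlongrightarrow> \<bar>a\<bar> powr s) F"
  using assms by (intro tendsto_powr' tendsto_intros) (auto intro: always_eventually)

lemma tendsto_signed_powr:
  assumes "(f \<longlongrightarrow> a) F" "s > 2"
  shows "((\<lambda>x. signed_powr s (f x)) \<longlongrightarrow> signed_powr s a) F"
  unfolding signed_powr_def using assms by (intro tendsto_mult tendsto_abs_powr) auto

lemma abs_powr_has_derivative:
  assumes "s > 2"
  shows "((\<lambda>a. \<bar>a\<bar> powr s / s) has_real_derivative signed_powr s a) (at a)"
proof -
  consider "a > 0" | "a < 0" | "a = 0" by linarith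
  then show ?thesis
  proof cases
    case 1
    have "((\<lambda>a. a powr s / s) has_real_derivative (s * a powr (s - 1)) / s) (at a)"
      using 1 by (intro DERIV_cdivide has_real_derivative_powr)
    moreover have "(s * a powr (s - 1)) / s = signed_powr s a"
      using 1 assms powr_add[of a "s - 2" 1] by (simp add: signed_powr_def)
    ultimately have "((\<lambda>a. a powr s / s) has_real_derivative signed_powr s a) (at a)" by simp
    then show ?thesis
      by (rule has_field_derivative_transform_within_open[where S = "{0<..}"]) (use 1 in auto)
  next
    case 2
    have "((\<lambda>a. (- a) powr s / s) has_real_derivative (s * (- a) powr (s - 1) * (- 1)) / s) (at a)"
      using 2 by (intro DERIV_cdivide DERIV_fun_powr) (auto intro!: derivative_eq_intros)
    moreover have "(s * (- a) powr (s - 1) * (- 1)) / s = signed_powr s a"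
      using 2 assms powr_add[of "- a" "s - 2" 1] by (simp add: signed_powr_def)
    ultimately have "((\<lambda>a. (- a) powr s / s) has_real_derivative signed_powr s a) (at a)" by simp
    then show ?thesis
      by (rule has_field_derivative_transform_within_open[where S = "{..<0}"]) (use 2 in auto)
  next
    case 3
    have "((\<lambda>h. signed_powr s h / s) \<longlongrightarrow> signed_powr s 0 / s) (at 0)"
      using assms by (intro tendsto_intros tendsto_signed_powr) auto
    then have "((\<lambda>h. (\<bar>0 + h\<bar> powr s / s - \<bar>0\<bar> powr s / s) / h) \<longlongrightarrow> 0) (at 0)"
    proof (rule Lim_transform_eventually[THEN tendsto_eq_rhs])
      show "\<forall>\<^sub>F h in at 0. signed_powr s h / s = (\<bar>0 + h\<bar> powr s / s - \<bar>0\<bar> powr s / s) / h"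
        using assms signed_powr_self[of s] by (auto simp: eventually_at_filter field_simps)
    qed (simp add: signed_powr_def)
    then have "((\<lambda>a. \<bar>a\<bar> powr s / s) has_real_derivative 0) (at 0)" by (simp only: DERIV_def)
    then show ?thesis using 3 by (simp add: signed_powr_def)
  qed
qed

text \<open>The mean value form serves two purposes at once: continuity of the derivative gives the limit of
  difference quotients, and its growth gives a majorant for them.\<close>

lemma abs_powr_mean_value:
  fixes a b s :: real
  assumes "s > 2"
  shows "\<exists>\<xi>. \<bar>\<xi> - a\<bar> \<le> \<bar>b - a\<bar> \<and> \<bar>b\<bar> powr s / s - \<bar>a\<bar> powr s / s = signed_powr s \<xi> * (b - a)"
proof -
  consider "a < b" | "b < a" | "a = b" by linarith
  then show ?thesis
  proof cases
    case 1
    then obtain \<xi> where "\<xi> > a" "\<xi> < b" "\<bar>b\<bar> powr s / s - \<bar>a\<bar> powr s / s = (b - a) * signed_powr s \<xi>"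
      using MVT2[of a b "\<lambda>a. \<bar>a\<bar> powr s / s" "signed_powr s"] abs_powr_has_derivative[OF assms] by metis
    then show ?thesis by (intro exI[of _ \<xi>]) auto
  next
    case 2
    then obtain \<xi> where "\<xi> > b" "\<xi> < a" "\<bar>a\<bar> powr s / s - \<bar>b\<bar> powr s / s = (a - b) * signed_powr s \<xi>"
      using MVT2[of b a "\<lambda>a. \<bar>a\<bar> powr s / s" "signed_powr s"] abs_powr_has_derivative[OF assms] by metis
    then show ?thesis by (intro exI[of _ \<xi>]) (auto simp: algebra_simps)
  qed (auto intro: exI[of _ a])
qed

text \<open>The auxiliary exponent \<open>q\<close> lies strictly between \<open>sup p\<close> and the critical exponent. A bound in \<open>L\<^sup>q\<close>
  makes the powers \<open>p x\<close> negligible where a function is large.\<close>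

locale variable_exponent =
  fixes p :: "'a::euclidean_space \<Rightarrow> real" and pm pp q :: real
  assumes p_cont: "continuous_on UNIV p" and p_ge: "\<And>x. pm \<le> p x" and p_le: "\<And>x. p x \<le> pp"
    and pm_gt: "2 < pm" and pp_less: "pp < q" and q_sub: "ereal q < critical_exponent DIM('a)"
    and dim: "2 \<le> DIM('a)"
begin

lemma p_bounds: "2 < p x" "p x < q" "0 < p x" "2 < q" "pm \<le> pp"
  using p_ge[of x] p_le[of x] pm_gt pp_less by auto

lemma p_simps [simp]: "0 < p x" "0 \<le> p x" "p x \<noteq> 0"
  using p_bounds(3)[of x] by auto

lemma p_measurable [measurable]: "p \<in> borel_measurable lebesgue"
  by (intro lebesgue_measurable_of_borel borel_measurable_continuous_onI p_cont)

lemma H1_measurable: "u \<in> H1 \<Longrightarrow> u \<in> borel_measurable lebesgue"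
  using H1_grad(1)[of u] by (simp add: square_integrable_def)

lemma H1_integrable_square: "u \<in> H1 \<Longrightarrow> integrable lebesgue (\<lambda>x. (u x)\<^sup>2)"
  using H1_grad(1)[of u] by (auto simp: square_integrable_def)

lemma H1_integrable_q:
  assumes u: "(u :: 'a \<Rightarrow> real) \<in> H1"
  shows "integrable lebesgue (\<lambda>x. \<bar>u x\<bar> powr q)"
proof -
  have "H1_norm u + 1 > 0" using H1_norm_nonneg[of u] by linarith
  then obtain B where "\<And>v :: 'a \<Rightarrow> real. v \<in> H1 \<Longrightarrow> H1_norm v \<le> H1_norm u + 1 \<Longrightarrow>
      integrable lebesgue (\<lambda>x. \<bar>v x\<bar> powr q) \<and> (LINT x|lebesgue. \<bar>v x\<bar> powr q) \<le> B"
    using H1_sobolev_embedding[OF _ q_sub _ dim, of "H1_norm u + 1"] p_bounds(4) by metis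
  then show ?thesis using u by auto
qed

lemma H1_integrable_powr:
  assumes u: "(u :: 'a \<Rightarrow> real) \<in> H1" and [measurable]: "s \<in> borel_measurable lebesgue"
    and s: "\<And>x. 2 \<le> s x" "\<And>x. s x \<le> q"
  shows "integrable lebesgue (\<lambda>x. \<bar>u x\<bar> powr s x)"
    and "(LINT x|lebesgue. \<bar>u x\<bar> powr s x) \<le> (LINT x|lebesgue. (u x)\<^sup>2 + \<bar>u x\<bar> powr q)"
proof -
  note [measurable] = H1_measurable[OF u]
  have i: "integrable lebesgue (\<lambda>x. (u x)\<^sup>2 + \<bar>u x\<bar> powr q)"
    using H1_integrable_square[OF u] H1_integrable_q[OF u] by simp
  have le: "\<bar>u x\<bar> powr s x \<le> (u x)\<^sup>2 + \<bar>u x\<bar> powr q" for x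
    using powr_le_square_plus_powr[of "\<bar>u x\<bar>" "s x" q] s by simp
  show int: "integrable lebesgue (\<lambda>x. \<bar>u x\<bar> powr s x)"
    by (rule Bochner_Integration.integrable_bound[OF i]) (use le in auto)
  show "(LINT x|lebesgue. \<bar>u x\<bar> powr s x) \<le> (LINT x|lebesgue. (u x)\<^sup>2 + \<bar>u x\<bar> powr q)"
    by (rule integral_mono[OF int i le])
qed

lemma H1_integrable_p: "(u :: 'a \<Rightarrow> real) \<in> H1 \<Longrightarrow> integrable lebesgue (\<lambda>x. \<bar>u x\<bar> powr p x)"
  using p_bounds by (intro H1_integrable_powr) (auto intro: less_imp_le)

definition modular :: "('a \<Rightarrow> real) \<Rightarrow> real" where
  "modular u = (LINT x|lebesgue. \<bar>u x\<bar> powr p x / p x)"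

lemma H1_divide: "u \<in> H1 \<Longrightarrow> (\<lambda>x. u x / a) \<in> H1"
  using H1_linear_combination(1)[OF H1_zero, of u "1 / a"] by simp

lemma modular_integrable: "(u :: 'a \<Rightarrow> real) \<in> H1 \<Longrightarrow> integrable lebesgue (\<lambda>x. \<bar>u x\<bar> powr p x / p x)"
proof (rule Bochner_Integration.integrable_bound[OF H1_integrable_p])
  assume u: "u \<in> H1"
  note [measurable] = H1_measurable[OF u]
  show "(\<lambda>x. \<bar>u x\<bar> powr p x / p x) \<in> borel_measurable lebesgue" by measurable
  have "\<bar>u x\<bar> powr p x / p x \<le> \<bar>u x\<bar> powr p x" for x
    using p_bounds(1)[of x] by (simp add: divide_le_eq mult_le_cancel_left1)
  then show "AE x in lebesgue. norm (\<bar>u x\<bar> powr p x / p x) \<le> norm (\<bar>u x\<bar> powr p x)"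
    using p_bounds(3) by (auto simp: less_imp_le abs_of_pos)
qed

lemma Luxemburg_set:
  assumes u: "(u :: 'a \<Rightarrow> real) \<in> H1"
  shows "I p u = Inf {\<gamma>. \<gamma> > 0 \<and> modular (\<lambda>x. u x / \<gamma>) \<le> 1}"
proof -
  have "(\<integral>\<^sup>+ x. ennreal (\<bar>u x / \<gamma>\<bar> powr p x / p x) \<partial>lebesgue) = ennreal (modular (\<lambda>x. u x / \<gamma>))" for \<gamma>
    unfolding modular_def using modular_integrable[OF H1_divide[OF u, of \<gamma>]]
    by (intro nn_integral_eq_integral) simp_all
  then show ?thesis by (simp add: I_def)
qed

lemma modular_nonneg: "0 \<le> modular u"
  unfolding modular_def by (intro Bochner_Integration.integral_nonneg) simp

lemma modular_antimono:
  assumes u: "(u :: 'a \<Rightarrow> real) \<in> H1" and "0 < \<gamma>" "\<gamma> \<le> \<delta>"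
  shows "modular (\<lambda>x. u x / \<delta>) \<le> modular (\<lambda>x. u x / \<gamma>)"
  unfolding modular_def
proof (rule integral_mono[OF modular_integrable modular_integrable])
  fix x
  have "\<bar>u x / \<delta>\<bar> \<le> \<bar>u x / \<gamma>\<bar>"
    using assms(2,3) by (simp add: abs_divide frac_le)
  then show "\<bar>u x / \<delta>\<bar> powr p x / p x \<le> \<bar>u x / \<gamma>\<bar> powr p x / p x"
    using p_bounds(3)[of x] by (intro divide_right_mono powr_mono2) auto
qed (use H1_divide[OF u] in auto)

lemma modular_continuous:
  assumes u: "(u :: 'a \<Rightarrow> real) \<in> H1" and "\<gamma> > 0" and lim: "g \<longlonglongrightarrow> \<gamma>" and ge: "\<And>n. g n \<ge> \<gamma> / 2"
  shows "(\<lambda>n. modular (\<lambda>x. u x / g n)) \<longlonglongrightarrow> modular (\<lambda>x. u x / \<gamma>)"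
  unfolding modular_def
proof (rule integral_dominated_convergence[where w = "\<lambda>x. \<bar>u x / (\<gamma> / 2)\<bar> powr p x / p x"])
  note [measurable] = H1_measurable[OF u]
  show "(\<lambda>x. \<bar>u x / \<gamma>\<bar> powr p x / p x) \<in> borel_measurable lebesgue"
    "(\<lambda>x. \<bar>u x / g n\<bar> powr p x / p x) \<in> borel_measurable lebesgue" for n by measurable
  show "integrable lebesgue (\<lambda>x. \<bar>u x / (\<gamma> / 2)\<bar> powr p x / p x)"
    by (intro modular_integrable H1_divide u)
  show "AE x in lebesgue. (\<lambda>n. \<bar>u x / g n\<bar> powr p x / p x) \<longlonglongrightarrow> \<bar>u x / \<gamma>\<bar> powr p x / p x"
    using \<open>\<gamma> > 0\<close> by (intro AE_I2 tendsto_divide tendsto_abs_powr tendsto_const lim) simp_all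
  fix n
  have "\<bar>u x / g n\<bar> powr p x / p x \<le> \<bar>u x / (\<gamma> / 2)\<bar> powr p x / p x" for x
  proof -
    have "\<bar>u x / g n\<bar> \<le> \<bar>u x / (\<gamma> / 2)\<bar>"
      using ge[of n] \<open>\<gamma> > 0\<close> unfolding abs_divide by (intro frac_le) auto
    then show ?thesis
      using p_bounds(3)[of x] by (intro divide_right_mono powr_mono2) auto
  qed
  then show "AE x in lebesgue. norm (\<bar>u x / g n\<bar> powr p x / p x) \<le> \<bar>u x / (\<gamma> / 2)\<bar> powr p x / p x"
    using p_bounds(3) by (intro AE_I2) (simp add: less_imp_le abs_of_pos)
qed

text \<open>The modular of \<open>u / \<gamma>\<close> is continuous and antitone in \<open>\<gamma>\<close>; approaching the infimum from above and
  from below gives the two inequalities.\<close>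

lemma modular_at_Luxemburg_norm:
  assumes u: "(u :: 'a \<Rightarrow> real) \<in> H1" and "I p u = \<gamma>" "\<gamma> > 0"
  shows "modular (\<lambda>x. u x / \<gamma>) = 1"
proof (rule antisym)
  define S where "S = {\<gamma>. \<gamma> > 0 \<and> modular (\<lambda>x. u x / \<gamma>) \<le> 1}"
  have Inf: "Inf S = \<gamma>" using Luxemburg_set[OF u] assms(2) by (simp add: S_def)
  have bdd: "bdd_below S" by (rule bdd_belowI[of _ 0]) (auto simp: S_def)
  have "S \<noteq> {}"
  proof -
    define \<delta> where "\<delta> = 1 + modular u"
    have "\<delta> \<ge> 1" using modular_nonneg by (simp add: \<delta>_def)
    have "modular (\<lambda>x. u x / \<delta>) \<le> (LINT x|lebesgue. \<bar>u x\<bar> powr p x / p x / \<delta>)"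
      unfolding modular_def
    proof (rule integral_mono[OF modular_integrable[OF H1_divide[OF u]] integrable_divide_zero[OF modular_integrable[OF u]]])
      fix x
      have "\<delta> powr 1 \<le> \<delta> powr p x" using \<open>\<delta> \<ge> 1\<close> p_bounds(1)[of x] by (intro powr_mono) auto
      then have "\<bar>u x\<bar> powr p x / \<delta> powr p x \<le> \<bar>u x\<bar> powr p x / \<delta>"
        using \<open>\<delta> \<ge> 1\<close> by (intro divide_left_mono) auto
      then have "\<bar>u x / \<delta>\<bar> powr p x \<le> \<bar>u x\<bar> powr p x / \<delta>"
        using \<open>\<delta> \<ge> 1\<close> by (simp add: abs_divide powr_divide)
      then have "\<bar>u x / \<delta>\<bar> powr p x / p x \<le> \<bar>u x\<bar> powr p x / \<delta> / p x"
        by (rule divide_right_mono) simp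
      then show "\<bar>u x / \<delta>\<bar> powr p x / p x \<le> \<bar>u x\<bar> powr p x / p x / \<delta>"
        by (simp only: divide_divide_eq_left mult.commute)
    qed
    also have "\<dots> = modular u / \<delta>"
      unfolding modular_def by (rule integral_divide_zero)
    also have "\<dots> \<le> 1" using \<open>\<delta> \<ge> 1\<close> by (simp add: \<delta>_def)
    finally show ?thesis using \<open>\<delta> \<ge> 1\<close> by (auto simp: S_def intro!: exI[of _ \<delta>])
  qed
  show "modular (\<lambda>x. u x / \<gamma>) \<le> 1"
  proof (rule LIMSEQ_le_const2)
    show "(\<lambda>n. modular (\<lambda>x. u x / (\<gamma> + inverse (real (Suc n))))) \<longlonglongrightarrow> modular (\<lambda>x. u x / \<gamma>)"
      using tendsto_add[OF tendsto_const[of \<gamma>] LIMSEQ_inverse_real_of_nat] \<open>\<gamma> > 0\<close>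
      by (intro modular_continuous[OF u]) (auto intro: add_increasing2)
    have "modular (\<lambda>x. u x / (\<gamma> + inverse (real (Suc n)))) \<le> 1" for n
    proof -
      have "Inf S < \<gamma> + inverse (real (Suc n))" by (simp add: Inf)
      then obtain s where "s \<in> S" "s < \<gamma> + inverse (real (Suc n))"
        using cInf_less_iff[OF \<open>S \<noteq> {}\<close> bdd] by blast
      then show ?thesis
        using modular_antimono[OF u, of s "\<gamma> + inverse (real (Suc n))"] by (auto simp: S_def)
    qed
    then show "\<exists>N. \<forall>n\<ge>N. modular (\<lambda>x. u x / (\<gamma> + inverse (real (Suc n)))) \<le> 1" by blast
  qed
  show "1 \<le> modular (\<lambda>x. u x / \<gamma>)"
  proof (rule LIMSEQ_le_const)
    let ?g = "\<lambda>n. \<gamma> - \<gamma> / 2 * inverse (real (Suc n))"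
    have g: "?g n \<ge> \<gamma> / 2" "?g n < \<gamma>" for n
    proof -
      have "\<gamma> / 2 * inverse (real (Suc n)) \<le> \<gamma> / 2 * 1"
        using \<open>\<gamma> > 0\<close> by (intro mult_left_mono) (auto simp: inverse_eq_divide)
      then show "?g n \<ge> \<gamma> / 2" by simp
      show "?g n < \<gamma>" using \<open>\<gamma> > 0\<close> by simp
    qed
    show "(\<lambda>n. modular (\<lambda>x. u x / ?g n)) \<longlonglongrightarrow> modular (\<lambda>x. u x / \<gamma>)"
      using tendsto_diff[OF tendsto_const[of \<gamma>] tendsto_mult[OF tendsto_const[of "\<gamma> / 2"] LIMSEQ_inverse_real_of_nat]]
        \<open>\<gamma> > 0\<close> g(1) by (intro modular_continuous[OF u]) auto
    have "1 \<le> modular (\<lambda>x. u x / ?g n)" for n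
    proof (rule ccontr)
      assume "\<not> 1 \<le> modular (\<lambda>x. u x / ?g n)"
      moreover have "?g n > 0" using g(1)[of n] \<open>\<gamma> > 0\<close> by linarith
      ultimately have "?g n \<in> S" by (simp add: S_def)
      then have "\<gamma> \<le> ?g n" using cInf_lower[OF _ bdd] Inf by metis
      with g(2)[of n] show False by linarith
    qed
    then show "\<exists>N. \<forall>n\<ge>N. 1 \<le> modular (\<lambda>x. u x / ?g n)" by blast
  qed
qed

lemma modular_M: "u \<in> M p \<Longrightarrow> modular u = 1"
  using modular_at_Luxemburg_norm[of u 1] by (simp add: M_def)

lemma M_integral_bounds:
  assumes "u \<in> M p"
  shows "pm \<le> (LINT x|lebesgue. \<bar>u x\<bar> powr p x)" "(LINT x|lebesgue. \<bar>u x\<bar> powr p x) \<le> pp"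
proof -
  have u: "u \<in> H1" using assms by (simp add: M_def)
  note i = modular_integrable[OF u] H1_integrable_p[OF u]
  have "pm * modular u = (LINT x|lebesgue. pm * (\<bar>u x\<bar> powr p x / p x))"
    unfolding modular_def by (rule integral_mult_right_zero[symmetric])
  also have "\<dots> \<le> (LINT x|lebesgue. \<bar>u x\<bar> powr p x)"
  proof (rule integral_mono[OF integrable_mult_right[OF i(1)] i(2)])
    fix x
    have "pm * \<bar>u x\<bar> powr p x \<le> p x * \<bar>u x\<bar> powr p x" by (intro mult_right_mono p_ge) simp
    then show "pm * (\<bar>u x\<bar> powr p x / p x) \<le> \<bar>u x\<bar> powr p x"
      by (simp add: divide_le_eq mult.commute)
  qed
  finally show "pm \<le> (LINT x|lebesgue. \<bar>u x\<bar> powr p x)" using modular_M[OF assms] by simp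
  have "(LINT x|lebesgue. \<bar>u x\<bar> powr p x) \<le> (LINT x|lebesgue. pp * (\<bar>u x\<bar> powr p x / p x))"
  proof (rule integral_mono[OF i(2) integrable_mult_right[OF i(1)]])
    fix x
    have "p x * \<bar>u x\<bar> powr p x \<le> pp * \<bar>u x\<bar> powr p x" by (intro mult_right_mono p_le) simp
    then show "\<bar>u x\<bar> powr p x \<le> pp * (\<bar>u x\<bar> powr p x / p x)"
      by (simp add: le_divide_eq mult.commute)
  qed
  also have "\<dots> = pp * modular u"
    unfolding modular_def by (rule integral_mult_right_zero)
  finally show "(LINT x|lebesgue. \<bar>u x\<bar> powr p x) \<le> pp" using modular_M[OF assms] by simp
qed

end

section \<open>Derivatives of the functionals\<close>

lemma H1_scale:
  assumes v: "v \<in> H1"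
  shows "(\<lambda>x. s * v x) \<in> H1" and "AE x in lebesgue. grad (\<lambda>x. s * v x) x = s *\<^sub>R grad v x"
proof -
  show "(\<lambda>x. s * v x) \<in> H1" using H1_linear_combination(1)[OF H1_zero v, of s] by simp
  have "AE x in lebesgue. grad (\<lambda>x. 0) x = (0 :: 'a)"
    by (rule H1_intro(2)) (auto simp: square_integrable_zero)
  with H1_linear_combination(2)[OF H1_zero v, of s]
  show "AE x in lebesgue. grad (\<lambda>x. s * v x) x = s *\<^sub>R grad v x"
    by eventually_elim simp
qed

lemma integral_grad_scale:
  assumes v: "v \<in> H1"
  shows "(LINT x|lebesgue. (norm (grad (\<lambda>x. s * v x) x))\<^sup>2) = s\<^sup>2 * (LINT x|lebesgue. (norm (grad v x))\<^sup>2)"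
proof -
  have [measurable]: "grad v \<in> borel_measurable lebesgue" "grad (\<lambda>x. s * v x) \<in> borel_measurable lebesgue"
    using H1_grad(2)[OF v] H1_grad(2)[OF H1_scale(1)[OF v]] by (auto simp: square_integrable_def)
  have "(LINT x|lebesgue. (norm (grad (\<lambda>x. s * v x) x))\<^sup>2) = (LINT x|lebesgue. s\<^sup>2 * (norm (grad v x))\<^sup>2)"
    using H1_scale(2)[OF v, of s] by (intro integral_cong_AE) (auto simp: power_mult_distrib)
  then show ?thesis by simp
qed

lemma H1_norm_scale:
  assumes v: "v \<in> H1" and "s \<ge> 0"
  shows "H1_norm (\<lambda>x. s * v x) = s * H1_norm v"
proof (rule power2_eq_imp_eq)
  show "(H1_norm (\<lambda>x. s * v x))\<^sup>2 = (s * H1_norm v)\<^sup>2"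
    unfolding power_mult_distrib H1_norm_square[OF v] H1_norm_square[OF H1_scale(1)[OF v]] integral_grad_scale[OF v]
    by (simp add: power_mult_distrib distrib_left)
qed (use \<open>s \<ge> 0\<close> in \<open>simp_all add: H1_norm_nonneg\<close>)

text \<open>Where the norm is positive this is normalisation; where it vanishes, boundedness of \<open>L\<close> forces
  \<open>L v = 0\<close>.\<close>

lemma H1_functional_bound:
  assumes L: "H1_functional L" and v: "v \<in> H1"
  shows "\<bar>L v\<bar> \<le> dual_norm L * H1_norm v"
proof -
  obtain B where "\<forall>u\<in>H1. \<bar>L u\<bar> \<le> B * H1_norm u"
    using L unfolding H1_functional_def by blast
  then have B: "\<bar>L u\<bar> \<le> B * H1_norm u" if "u \<in> H1" for u using that by blast
  show ?thesis
  proof (cases "H1_norm v = 0")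
    case True
    then show ?thesis using B[OF v] by simp
  next
    case False
    then have n: "H1_norm v > 0" using H1_norm_nonneg[of v] by linarith
    let ?v = "\<lambda>x. (1 / H1_norm v) * v x"
    have v': "?v \<in> H1" by (rule H1_scale(1)[OF v])
    have "H1_norm ?v = 1" using H1_norm_scale[OF v, of "1 / H1_norm v"] n by simp
    have "\<bar>L ?v\<bar> \<le> dual_norm L"
      unfolding dual_norm_def
    proof (rule cSUP_upper)
      show "?v \<in> {v \<in> H1. H1_norm v \<le> 1}" using v' \<open>H1_norm ?v = 1\<close> by simp
      have "\<bar>L u\<bar> \<le> max B 0" if "u \<in> {v \<in> H1. H1_norm v \<le> 1}" for u
      proof -
        have "\<bar>L u\<bar> \<le> B * H1_norm u" using that B by simp
        also have "\<dots> \<le> max B 0 * H1_norm u" using H1_norm_nonneg[of u] by (intro mult_right_mono) auto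
        also have "\<dots> \<le> max B 0 * 1" using that by (intro mult_left_mono) auto
        finally show ?thesis by simp
      qed
      then show "bdd_above ((\<lambda>v. \<bar>L v\<bar>) ` {v \<in> H1. H1_norm v \<le> 1})"
        by (intro bdd_aboveI2[of _ _ "max B 0"])
    qed
    moreover have "L ?v = (1 / H1_norm v) * L v"
      using L v unfolding H1_functional_def by blast
    ultimately have "\<bar>(1 / H1_norm v) * L v\<bar> \<le> dual_norm L" by (simp only:)
    then show ?thesis using n by (simp add: abs_mult pos_divide_le_eq)
  qed
qed

lemma H1_functional_combination:
  assumes L: "H1_functional L" and L': "H1_functional L'"
  shows "H1_functional (\<lambda>v. L v - m * L' v)"
proof -
  obtain B B' where "\<forall>u\<in>H1. \<bar>L u\<bar> \<le> B * H1_norm u" "\<forall>u\<in>H1. \<bar>L' u\<bar> \<le> B' * H1_norm u"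
    using L L' unfolding H1_functional_def by blast
  then have B: "\<bar>L u\<bar> \<le> B * H1_norm u" "\<bar>L' u\<bar> \<le> B' * H1_norm u" if "u \<in> H1" for u
    using that by blast+
  have "\<bar>L u - m * L' u\<bar> \<le> (B + \<bar>m\<bar> * B') * H1_norm u" if "u \<in> H1" for u
  proof -
    have "\<bar>L u - m * L' u\<bar> \<le> \<bar>L u\<bar> + \<bar>m\<bar> * \<bar>L' u\<bar>"
      using abs_triangle_ineq4[of "L u" "m * L' u"] by (simp add: abs_mult)
    also have "\<dots> \<le> B * H1_norm u + \<bar>m\<bar> * (B' * H1_norm u)"
      using B that by (intro add_mono mult_left_mono) auto
    finally show ?thesis by (simp add: algebra_simps)
  qed
  moreover have "L (\<lambda>x. u x + v x) - m * L' (\<lambda>x. u x + v x) = (L u - m * L' u) + (L v - m * L' v)"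
    if "u \<in> H1" "v \<in> H1" for u v
  proof -
    have "L (\<lambda>x. u x + v x) = L u + L v" "L' (\<lambda>x. u x + v x) = L' u + L' v"
      using L L' that unfolding H1_functional_def by blast+
    then show ?thesis by (simp add: algebra_simps)
  qed
  moreover have "L (\<lambda>x. a * u x) - m * L' (\<lambda>x. a * u x) = a * (L u - m * L' u)" if "u \<in> H1" for u a
  proof -
    have "L (\<lambda>x. a * u x) = a * L u" "L' (\<lambda>x. a * u x) = a * L' u"
      using L L' that unfolding H1_functional_def by blast+
    then show ?thesis by (simp add: algebra_simps)
  qed
  ultimately show ?thesis
    unfolding H1_functional_def by blast
qed

lemma H1_derivative_directional:
  assumes D: "has_H1_derivative F L u" and v: "v \<in> H1" and t: "t \<longlonglongrightarrow> 0" "\<And>n. t n > 0"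
  shows "(\<lambda>n. (F (\<lambda>x. u x + t n * v x) - F u) / t n) \<longlonglongrightarrow> L v"
proof (rule LIMSEQ_I)
  fix e :: real assume "e > 0"
  have L: "H1_functional L" using D by (simp add: has_H1_derivative_def)
  define n where "n = H1_norm v"
  have "n \<ge> 0" unfolding n_def by (rule H1_norm_nonneg)
  define e' where "e' = e / (2 * (n + 1))"
  have "e' > 0" using \<open>e > 0\<close> \<open>n \<ge> 0\<close> by (simp add: e'_def)
  then obtain d where d: "d > 0" "\<And>h. h \<in> H1 \<Longrightarrow> H1_norm h < d \<Longrightarrow> \<bar>F (\<lambda>x. u x + h x) - F u - L h\<bar> \<le> e' * H1_norm h"
    using D unfolding has_H1_derivative_def by blast
  have scale: "H1_norm (\<lambda>x. s * v x) = s * n" if "s > 0" for s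
    using H1_norm_scale[OF v, of s] that by (simp add: n_def)
  have "d / (n + 1) > 0" using d(1) \<open>n \<ge> 0\<close> by simp
  then obtain n0 where n0: "\<And>k. k \<ge> n0 \<Longrightarrow> t k < d / (n + 1)"
    using order_tendstoD(2)[OF t(1)] by (auto simp: eventually_sequentially)
  have "norm ((F (\<lambda>x. u x + t k * v x) - F u) / t k - L v) < e" if "k \<ge> n0" for k
  proof -
    have tv: "(\<lambda>x. t k * v x) \<in> H1" by (rule H1_scale(1)[OF v])
    have "t k * n \<le> t k * (n + 1)" using t(2)[of k] by simp
    also have "\<dots> < d" using n0[OF that] \<open>n \<ge> 0\<close> by (simp add: pos_less_divide_eq)
    finally have "H1_norm (\<lambda>x. t k * v x) < d" using scale[OF t(2)] by simp
    from d(2)[OF tv this] have "\<bar>F (\<lambda>x. u x + t k * v x) - F u - L (\<lambda>x. t k * v x)\<bar> \<le> e' * (t k * n)"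
      using scale[OF t(2)] by simp
    also have "L (\<lambda>x. t k * v x) = t k * L v"
      using L v unfolding H1_functional_def by blast
    finally have "\<bar>(F (\<lambda>x. u x + t k * v x) - F u) / t k - L v\<bar> \<le> e' * n"
      using t(2)[of k] by (simp add: field_simps abs_le_iff)
    also have "e' * n < e"
    proof -
      have "e' * n \<le> e' * (n + 1)" using \<open>e' > 0\<close> by simp
      also have "\<dots> = e / 2" using \<open>n \<ge> 0\<close> by (simp add: e'_def field_simps)
      finally show ?thesis using \<open>e > 0\<close> by linarith
    qed
    finally show ?thesis by simp
  qed
  then show "\<exists>n0. \<forall>k\<ge>n0. norm ((F (\<lambda>x. u x + t k * v x) - F u) / t k - L v) < e" by blast
qed

definition energy_form :: "('a::euclidean_space \<Rightarrow> real) \<Rightarrow> ('a \<Rightarrow> real) \<Rightarrow> ('a \<Rightarrow> real) \<Rightarrow> real" where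
  "energy_form V u v = (LINT x|lebesgue. grad u x \<bullet> grad v x) + (LINT x|lebesgue. V x * u x * v x)"

lemma L_infinity_mult_integrable:
  assumes V: "V \<in> L_infinity" and f: "integrable lebesgue f"
  shows "integrable lebesgue (\<lambda>x. V x * f x)"
proof -
  obtain C where C: "AE x in lebesgue. \<bar>V x\<bar> \<le> C" and [measurable]: "V \<in> borel_measurable lebesgue"
    using V by (auto simp: L_infinity_def)
  have [measurable]: "f \<in> borel_measurable lebesgue" using f by auto
  show ?thesis
  proof (rule Bochner_Integration.integrable_bound)
    show "integrable lebesgue (\<lambda>x. C * f x)" using f by simp
    show "AE x in lebesgue. norm (V x * f x) \<le> norm (C * f x)"
      using C by eventually_elim (auto simp: abs_mult intro!: mult_right_mono)
  qed measurable
qed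

lemma energy_form_integrable:
  assumes V: "V \<in> L_infinity" and u: "u \<in> H1" and v: "v \<in> H1"
  shows "integrable lebesgue (\<lambda>x. grad u x \<bullet> grad v x)" "integrable lebesgue (\<lambda>x. V x * u x * v x)"
    "integrable lebesgue (\<lambda>x. u x * v x)"
  using integrable_inner_L2[OF H1_grad(2)[OF u] H1_grad(2)[OF v]]
    integrable_mult_L2[OF H1_grad(1)[OF u] H1_grad(1)[OF v]]
    L_infinity_mult_integrable[OF V, of "\<lambda>x. u x * v x"] by (simp_all add: mult.assoc)

lemma J_eq_energy_form:
  assumes V: "V \<in> L_infinity" and u: "u \<in> H1"
  shows "J V u = energy_form V u u"
  unfolding J_def energy_form_def power2_norm_eq_inner
  unfolding power2_eq_square mult.assoc[symmetric]
  by (rule Bochner_Integration.integral_add[OF energy_form_integrable(1,2)[OF V u u]])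

lemma energy_form_combination:
  assumes V: "V \<in> L_infinity" and u: "u \<in> H1" and v: "v \<in> H1" and w: "w \<in> H1"
  shows "energy_form V (\<lambda>x. u x + t * v x) w = energy_form V u w + t * energy_form V v w"
proof -
  have uv: "(\<lambda>x. u x + t * v x) \<in> H1" by (rule H1_linear_combination(1)[OF u v])
  have [measurable]: "grad u \<in> borel_measurable lebesgue" "grad v \<in> borel_measurable lebesgue"
    "grad w \<in> borel_measurable lebesgue" "grad (\<lambda>x. u x + t * v x) \<in> borel_measurable lebesgue"
    using H1_grad(2)[OF u] H1_grad(2)[OF v] H1_grad(2)[OF w] H1_grad(2)[OF uv] by (auto simp: square_integrable_def)
  have "(LINT x|lebesgue. grad (\<lambda>x. u x + t * v x) x \<bullet> grad w x) =
      (LINT x|lebesgue. grad u x \<bullet> grad w x + t * (grad v x \<bullet> grad w x))"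
    using H1_linear_combination(2)[OF u v, of t]
    by (intro integral_cong_AE) (auto simp: inner_add_left)
  also have "\<dots> = (LINT x|lebesgue. grad u x \<bullet> grad w x) + t * (LINT x|lebesgue. grad v x \<bullet> grad w x)"
    using energy_form_integrable(1)[OF V u w] energy_form_integrable(1)[OF V v w] by simp
  finally have 1: "(LINT x|lebesgue. grad (\<lambda>x. u x + t * v x) x \<bullet> grad w x) =
      (LINT x|lebesgue. grad u x \<bullet> grad w x) + t * (LINT x|lebesgue. grad v x \<bullet> grad w x)" .
  have "(LINT x|lebesgue. V x * (u x + t * v x) * w x) = (LINT x|lebesgue. V x * u x * w x + t * (V x * v x * w x))"
    by (simp add: algebra_simps)
  also have "\<dots> = (LINT x|lebesgue. V x * u x * w x) + t * (LINT x|lebesgue. V x * v x * w x)"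
    using energy_form_integrable(2)[OF V u w] energy_form_integrable(2)[OF V v w] by simp
  finally show ?thesis
    using 1 by (simp add: energy_form_def algebra_simps)
qed

lemma energy_form_commute: "energy_form V u v = energy_form V v u"
  by (simp add: energy_form_def inner_commute mult_ac)

lemma J_derivative:
  assumes V: "V \<in> L_infinity" and u: "u \<in> H1" and D: "has_H1_derivative (J V) L u" and v: "v \<in> H1"
  shows "L v = 2 * energy_form V u v"
proof (rule LIMSEQ_unique)
  let ?t = "\<lambda>n. inverse (real (Suc n))"
  show "(\<lambda>n. (J V (\<lambda>x. u x + ?t n * v x) - J V u) / ?t n) \<longlonglongrightarrow> L v"
    by (rule H1_derivative_directional[OF D v LIMSEQ_inverse_real_of_nat]) simp
  have "(J V (\<lambda>x. u x + s * v x) - J V u) / s = 2 * energy_form V u v + s * energy_form V v v" if "s > 0" for s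
  proof -
    have uv: "(\<lambda>x. u x + s * v x) \<in> H1" by (rule H1_linear_combination(1)[OF u v])
    have "J V (\<lambda>x. u x + s * v x) = energy_form V u (\<lambda>x. u x + s * v x) + s * energy_form V v (\<lambda>x. u x + s * v x)"
      using J_eq_energy_form[OF V uv] energy_form_combination[OF V u v uv] by simp
    also have "\<dots> = J V u + s * (2 * energy_form V u v + s * energy_form V v v)"
      unfolding energy_form_commute[of V _ "\<lambda>x. u x + s * v x"]
        energy_form_combination[OF V u v u] energy_form_combination[OF V u v v] J_eq_energy_form[OF V u]
      by (simp add: energy_form_commute[of V v u] algebra_simps)
    finally show ?thesis using that by simp
  qed
  then have "(\<lambda>n. (J V (\<lambda>x. u x + ?t n * v x) - J V u) / ?t n) = (\<lambda>n. 2 * energy_form V u v + ?t n * energy_form V v v)"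
    by (intro ext) (simp del: of_nat_Suc)
  moreover have "(\<lambda>n. 2 * energy_form V u v + ?t n * energy_form V v v) \<longlonglongrightarrow> 2 * energy_form V u v + 0 * energy_form V v v"
    by (intro tendsto_intros LIMSEQ_inverse_real_of_nat)
  ultimately show "(\<lambda>n. (J V (\<lambda>x. u x + ?t n * v x) - J V u) / ?t n) \<longlonglongrightarrow> 2 * energy_form V u v"
    by simp
qed

lemma (in variable_exponent) signed_powr_integrable:
  assumes u: "(u :: 'a \<Rightarrow> real) \<in> H1" and v: "v \<in> H1"
  shows "integrable lebesgue (\<lambda>x. signed_powr (p x) (u x) * v x)"
proof -
  have [measurable]: "u \<in> borel_measurable lebesgue" "v \<in> borel_measurable lebesgue"
    using H1_measurable u v by auto
  show ?thesis
  proof (rule Bochner_Integration.integrable_bound)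
    show "integrable lebesgue (\<lambda>x. \<bar>u x\<bar> powr p x + \<bar>v x\<bar> powr p x)"
      using H1_integrable_p u v by simp
    have "\<bar>signed_powr (p x) (u x) * v x\<bar> \<le> \<bar>u x\<bar> powr p x + \<bar>v x\<bar> powr p x" for x
    proof -
      have "\<bar>signed_powr (p x) (u x) * v x\<bar> = \<bar>u x\<bar> powr (p x - 1) * \<bar>v x\<bar>"
        by (simp add: abs_mult abs_signed_powr)
      also have "\<dots> \<le> (max \<bar>u x\<bar> \<bar>v x\<bar>) powr (p x - 1) * max \<bar>u x\<bar> \<bar>v x\<bar>"
        using p_bounds(1)[of x] by (intro mult_mono powr_mono2) auto
      also have "\<dots> = (max \<bar>u x\<bar> \<bar>v x\<bar>) powr p x"
        by (cases "max \<bar>u x\<bar> \<bar>v x\<bar> = 0") (simp_all add: powr_diff)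
      also have "\<dots> \<le> \<bar>u x\<bar> powr p x + \<bar>v x\<bar> powr p x" by (simp add: max_def)
      finally show ?thesis .
    qed
    then show "AE x in lebesgue. norm (signed_powr (p x) (u x) * v x) \<le> norm (\<bar>u x\<bar> powr p x + \<bar>v x\<bar> powr p x)"
      by simp
    show "(\<lambda>x. signed_powr (p x) (u x) * v x) \<in> borel_measurable lebesgue"
      unfolding signed_powr_def by measurable
  qed
qed

text \<open>The derivative of the Luxemburg norm is found by differentiating the identity that the modular
  of \<open>(u + t v) / I (u + t v)\<close> equals \<open>1\<close> along \<open>t \<rightarrow> 0\<close>; the existence of the derivative of \<open>I\<close> is
  given, so dominated convergence of the difference quotients determines its value.\<close>

lemma (in variable_exponent) I_derivative:
  assumes uM: "u \<in> M p" and D: "has_H1_derivative (I p) L u" and v: "v \<in> H1"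
  shows "L v = (LINT x|lebesgue. signed_powr (p x) (u x) * v x) / (LINT x|lebesgue. \<bar>u x\<bar> powr p x)"
proof -
  have u: "u \<in> H1" and I1: "I p u = 1" using uM by (auto simp: M_def)
  have [measurable]: "u \<in> borel_measurable lebesgue" "v \<in> borel_measurable lebesgue"
    using H1_measurable u v by auto
  let ?t = "\<lambda>n. inverse (real (Suc n))"
  define \<gamma> where "\<gamma> n = I p (\<lambda>x. u x + ?t n * v x)" for n
  have t: "?t \<longlonglongrightarrow> 0" "\<And>n. ?t n > 0" "\<And>n. ?t n \<le> 1"
    by (rule LIMSEQ_inverse_real_of_nat) (auto simp: inverse_eq_divide)
  \<comment> \<open>\<open>b n\<close> below is chosen such that \<open>(u + t v) / \<gamma> = u + t b\<close>; it converges to \<open>v - L v * u\<close>.\<close>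
  define l where "l n = (\<gamma> n - 1) / ?t n" for n
  have l: "l \<longlonglongrightarrow> L v"
    unfolding l_def \<gamma>_def using H1_derivative_directional[OF D v t(1,2)] I1 by simp
  have \<gamma>l: "\<gamma> n = 1 + ?t n * l n" for n
    using t(2)[of n] by (simp add: l_def field_simps del: of_nat_Suc)
  have \<gamma>: "\<gamma> \<longlonglongrightarrow> 1"
    unfolding \<gamma>l[abs_def] using tendsto_add[OF tendsto_const tendsto_mult[OF t(1) l], of 1] by simp
  define A where "A = \<bar>L v\<bar> + 1"
  have "A \<ge> 1" by (simp add: A_def)
  have "eventually (\<lambda>n. \<gamma> n > 1/2 \<and> \<bar>l n\<bar> < A) sequentially"
    using order_tendstoD(1)[OF \<gamma>, of "1/2"] order_tendstoD(2)[OF tendsto_rabs[OF l], of A]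
    by (auto simp: A_def intro: eventually_conj)
  then obtain n0 where n0: "\<And>n. n \<ge> n0 \<Longrightarrow> \<gamma> n > 1/2" "\<And>n. n \<ge> n0 \<Longrightarrow> \<bar>l n\<bar> < A"
    by (auto simp: eventually_sequentially)
  define b where "b n x = (v x - l n * u x) / \<gamma> n" for n x
  have ab: "(u x + ?t n * v x) / \<gamma> n = u x + ?t n * b n x" if "n \<ge> n0" for n x
  proof -
    have "\<gamma> n \<noteq> 0" using n0(1)[OF that] by simp
    moreover have "u x * \<gamma> n = u x + ?t n * l n * u x" by (simp add: \<gamma>l algebra_simps)
    ultimately show ?thesis
      unfolding b_def by (simp add: divide_eq_eq distrib_right right_diff_distrib)
  qed
  define Dq where "Dq n x = (\<bar>u x + ?t n * b n x\<bar> powr p x / p x - \<bar>u x\<bar> powr p x / p x) / ?t n" for n x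
  have \<gamma>M[measurable]: "b n \<in> borel_measurable lebesgue" for n unfolding b_def[abs_def] by measurable
  have Dq0: "(LINT x|lebesgue. Dq n x) = 0" if "n \<ge> n0" for n
  proof -
    have w: "(\<lambda>x. u x + ?t n * v x) \<in> H1" by (rule H1_linear_combination(1)[OF u v])
    have "\<gamma> n > 0" using n0(1)[OF that] by simp
    have "modular (\<lambda>x. (u x + ?t n * v x) / \<gamma> n) = 1"
      by (rule modular_at_Luxemburg_norm[OF w]) (use \<open>\<gamma> n > 0\<close> in \<open>auto simp: \<gamma>_def\<close>)
    then have m: "modular (\<lambda>x. u x + ?t n * b n x) = 1" by (simp only: ab[OF that])
    have "(\<lambda>x. u x + ?t n * b n x) \<in> H1"
      using H1_divide[OF w, of "\<gamma> n"] by (simp only: ab[OF that])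
    note i = modular_integrable[OF this] modular_integrable[OF u]
    have "(LINT x|lebesgue. Dq n x) = (modular (\<lambda>x. u x + ?t n * b n x) - modular u) / ?t n"
      unfolding Dq_def modular_def using i by (simp del: of_nat_Suc)
    then show ?thesis using m modular_M[OF uM] by simp
  qed
  have lim: "(\<lambda>n. LINT x|lebesgue. Dq (n + n0) x) \<longlonglongrightarrow> (LINT x|lebesgue. signed_powr (p x) (u x) * (v x - L v * u x))"
  proof (rule integral_dominated_convergence[where w = "\<lambda>x. (8 * A) powr q * (\<bar>u x\<bar> powr p x + \<bar>v x\<bar> powr p x)"])
    show "integrable lebesgue (\<lambda>x. (8 * A) powr q * (\<bar>u x\<bar> powr p x + \<bar>v x\<bar> powr p x))"
      using H1_integrable_p u v by simp
    show "(\<lambda>x. signed_powr (p x) (u x) * (v x - L v * u x)) \<in> borel_measurable lebesgue"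
      unfolding signed_powr_def by measurable
    show "Dq (n + n0) \<in> borel_measurable lebesgue" for n
      unfolding Dq_def[abs_def] by measurable
    have "\<exists>\<xi>. \<bar>\<xi> - u x\<bar> \<le> ?t n * \<bar>b n x\<bar> \<and> Dq n x = signed_powr (p x) \<xi> * b n x" for n x
    proof -
      obtain \<xi> where \<xi>: "\<bar>\<xi> - u x\<bar> \<le> \<bar>(u x + ?t n * b n x) - u x\<bar>"
        "\<bar>u x + ?t n * b n x\<bar> powr p x / p x - \<bar>u x\<bar> powr p x / p x = signed_powr (p x) \<xi> * ((u x + ?t n * b n x) - u x)"
        using abs_powr_mean_value[OF p_bounds(1)[of x], of "u x" "u x + ?t n * b n x"] by blast
      have "Dq n x = signed_powr (p x) \<xi> * b n x"
        unfolding Dq_def \<xi>(2) using t(2)[of n] by simp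
      then show ?thesis using \<xi>(1) t(2)[of n] by (intro exI[of _ \<xi>]) (simp add: abs_mult)
    qed
    note ex = this
    define \<xi> where "\<xi> n x = (SOME \<xi>. \<bar>\<xi> - u x\<bar> \<le> ?t n * \<bar>b n x\<bar> \<and> Dq n x = signed_powr (p x) \<xi> * b n x)" for n x
    have \<xi>: "\<bar>\<xi> n x - u x\<bar> \<le> ?t n * \<bar>b n x\<bar>" "Dq n x = signed_powr (p x) (\<xi> n x) * b n x" for n x
      using someI_ex[OF ex[of x n]] unfolding \<xi>_def by blast+
    have blim: "(\<lambda>n. b n x) \<longlonglongrightarrow> v x - L v * u x" for x
    proof -
      have "(\<lambda>n. b n x) \<longlonglongrightarrow> (v x - L v * u x) / 1"
        unfolding b_def by (intro tendsto_intros l \<gamma>) simp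
      then show ?thesis by simp
    qed
    have "(\<lambda>n. Dq n x) \<longlonglongrightarrow> signed_powr (p x) (u x) * (v x - L v * u x)" for x
    proof -
      have "(\<lambda>n. \<xi> n x - u x) \<longlonglongrightarrow> 0"
      proof (rule Lim_null_comparison)
        show "\<forall>\<^sub>F n in sequentially. norm (\<xi> n x - u x) \<le> ?t n * \<bar>b n x\<bar>"
          unfolding real_norm_def by (intro always_eventually allI \<xi>(1))
        show "(\<lambda>n. ?t n * \<bar>b n x\<bar>) \<longlonglongrightarrow> 0"
          using tendsto_mult[OF t(1) tendsto_rabs[OF blim[of x]]] by simp
      qed
      then have "(\<lambda>n. \<xi> n x) \<longlonglongrightarrow> u x" by (simp add: LIM_zero_iff)
      then show ?thesis
        unfolding \<xi>(2) by (intro tendsto_mult tendsto_signed_powr blim p_bounds(1))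
    qed
    from LIMSEQ_ignore_initial_segment[OF this]
    show "AE x in lebesgue. (\<lambda>n. Dq (n + n0) x) \<longlonglongrightarrow> signed_powr (p x) (u x) * (v x - L v * u x)" by simp
    fix m
    show "AE x in lebesgue. norm (Dq (m + n0) x) \<le> (8 * A) powr q * (\<bar>u x\<bar> powr p x + \<bar>v x\<bar> powr p x)"
    proof (rule AE_I2)
      fix x
      define n where "n = m + n0"
      have "n \<ge> n0" by (simp add: n_def)
      define mx where "mx = max \<bar>u x\<bar> \<bar>v x\<bar>"
      have mx: "\<bar>u x\<bar> \<le> mx" "\<bar>v x\<bar> \<le> mx" "0 \<le> mx" by (auto simp: mx_def)
      have "\<bar>v x - l n * u x\<bar> \<le> \<bar>v x\<bar> + \<bar>l n\<bar> * \<bar>u x\<bar>"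
        using abs_triangle_ineq4[of "v x" "l n * u x"] by (simp add: abs_mult)
      also have "\<dots> \<le> mx + A * mx"
        using n0(2)[OF \<open>n \<ge> n0\<close>] mx by (intro add_mono mult_mono) auto
      also have "\<dots> \<le> 2 * A * mx"
        using \<open>A \<ge> 1\<close> mx(3) mult_right_mono[of 1 A mx] by simp
      finally have num: "\<bar>v x - l n * u x\<bar> \<le> 2 * A * mx" .
      have "\<bar>b n x\<bar> = \<bar>v x - l n * u x\<bar> / \<gamma> n"
        using n0(1)[OF \<open>n \<ge> n0\<close>] by (simp add: b_def)
      also have "\<dots> \<le> 2 * A * mx / (1/2)"
        using n0(1)[OF \<open>n \<ge> n0\<close>] num by (intro frac_le) auto
      finally have bb: "\<bar>b n x\<bar> \<le> 4 * A * mx" by simp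
      have "?t n * \<bar>b n x\<bar> \<le> 1 * (4 * A * mx)"
        using t(2,3)[of n] bb by (intro mult_mono) auto
      then have "\<bar>\<xi> n x\<bar> \<le> mx + 4 * A * mx"
        using \<xi>(1)[of n x] mx(1) by linarith
      also have "\<dots> \<le> 8 * A * mx"
        using \<open>A \<ge> 1\<close> mx(3) mult_right_mono[of 1 A mx] by simp
      finally have \<xi>b: "\<bar>\<xi> n x\<bar> \<le> 8 * A * mx" .
      have "norm (Dq n x) = \<bar>\<xi> n x\<bar> powr (p x - 1) * \<bar>b n x\<bar>"
        unfolding \<xi>(2) by (simp add: abs_mult abs_signed_powr)
      also have "\<dots> \<le> (8 * A * mx) powr (p x - 1) * (8 * A * mx)"
      proof (intro mult_mono powr_mono2)
        have "0 \<le> A * mx" using \<open>A \<ge> 1\<close> mx(3) by simp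
        then show "\<bar>b n x\<bar> \<le> 8 * A * mx" using bb by simp
      qed (use \<xi>b p_bounds(1)[of x] in auto)
      also have "\<dots> = (8 * A * mx) powr p x"
        using \<open>A \<ge> 1\<close> mx(3) powr_mult_base[of "8 * A * mx" "p x - 1"] by (simp add: mult.commute)
      also have "\<dots> = (8 * A) powr p x * mx powr p x"
        using \<open>A \<ge> 1\<close> mx(3) by (simp add: powr_mult)
      also have "\<dots> \<le> (8 * A) powr q * (\<bar>u x\<bar> powr p x + \<bar>v x\<bar> powr p x)"
      proof (intro mult_mono powr_mono)
        show "mx powr p x \<le> \<bar>u x\<bar> powr p x + \<bar>v x\<bar> powr p x" by (simp add: mx_def max_def)
      qed (use \<open>A \<ge> 1\<close> p_bounds(2)[of x] in auto)
      finally show "norm (Dq (m + n0) x) \<le> (8 * A) powr q * (\<bar>u x\<bar> powr p x + \<bar>v x\<bar> powr p x)"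
        by (simp add: n_def)
    qed
  qed
  have "(LINT x|lebesgue. signed_powr (p x) (u x) * (v x - L v * u x)) = 0"
    using lim Dq0 by (simp add: LIMSEQ_const_iff)
  moreover have "(LINT x|lebesgue. signed_powr (p x) (u x) * (v x - L v * u x)) =
      (LINT x|lebesgue. signed_powr (p x) (u x) * v x) - L v * (LINT x|lebesgue. \<bar>u x\<bar> powr p x)"
  proof -
    have "signed_powr (p x) (u x) * (v x - L v * u x) = signed_powr (p x) (u x) * v x - L v * \<bar>u x\<bar> powr p x" for x
      using signed_powr_self[of "p x" "u x"] by (simp add: algebra_simps)
    then show ?thesis
      using signed_powr_integrable[OF u v] H1_integrable_p[OF u] by simp
  qed
  moreover have "(LINT x|lebesgue. \<bar>u x\<bar> powr p x) > 0"
    using M_integral_bounds(1)[OF uM] pm_gt by linarith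
  ultimately show ?thesis by (simp add: field_simps)
qed

section \<open>Asymptotics along vanishing sequences\<close>

text \<open>Either \<open>b \<le> \<delta> a\<close>, and the product is a small multiple of \<open>a powr s\<close>, or \<open>a\<close> is at most a multiple of
  \<open>b\<close>.\<close>

lemma powr_young:
  fixes \<epsilon> S :: real
  assumes "\<epsilon> > 0" "S \<ge> 0"
  obtains C where "C \<ge> 0" "\<And>a b s. 0 \<le> a \<Longrightarrow> 0 \<le> b \<Longrightarrow> 1 < s \<Longrightarrow> s \<le> S \<Longrightarrow>
    a powr (s - 1) * b \<le> \<epsilon> * a powr s + C * b powr s"
proof -
  define \<delta> where "\<delta> = min \<epsilon> 1"
  have \<delta>: "0 < \<delta>" "\<delta> \<le> 1" "\<delta> \<le> \<epsilon>" using \<open>\<epsilon> > 0\<close> by (auto simp: \<delta>_def)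
  have "a powr (s - 1) * b \<le> \<epsilon> * a powr s + (1 / \<delta>) powr S * b powr s"
    if "0 \<le> a" "0 \<le> b" "1 < s" "s \<le> S" for a b s
  proof (cases "b \<le> \<delta> * a")
    case True
    have "a powr (s - 1) * b \<le> a powr (s - 1) * (\<delta> * a)" using True by (intro mult_left_mono) auto
    also have "\<dots> = \<delta> * a powr s"
      using powr_mult_base[OF \<open>0 \<le> a\<close>, of "s - 1"] by (simp add: mult_ac)
    also have "\<dots> \<le> \<epsilon> * a powr s" using \<delta> by (intro mult_right_mono) auto
    finally show ?thesis by (simp add: add_increasing2)
  next
    case False
    then have "a \<le> (1 / \<delta>) * b" using \<delta>(1) by (simp add: field_simps)
    then have "a powr (s - 1) * b \<le> ((1 / \<delta>) * b) powr (s - 1) * b"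
      using that by (intro mult_right_mono powr_mono2) auto
    also have "\<dots> = (1 / \<delta>) powr (s - 1) * b powr s"
      using powr_mult_base[OF \<open>0 \<le> b\<close>, of "s - 1"] \<delta>(1) that by (simp add: powr_mult powr_divide mult_ac)
    also have "\<dots> \<le> (1 / \<delta>) powr S * b powr s"
      using \<delta> that by (intro mult_right_mono powr_mono) auto
    finally show ?thesis using \<open>\<epsilon> > 0\<close> by (simp add: add_increasing)
  qed
  then show ?thesis using that[of "(1 / \<delta>) powr S"] by simp
qed

text \<open>If \<open>|b|\<close> is small compared with \<open>|a|\<close>, homogeneity reduces the estimate to continuity of
  powers at \<open>1\<close>; otherwise everything is controlled by \<open>|b|\<^sup>s\<close>.\<close>

lemma signed_powr_perturbation:
  fixes \<epsilon> S :: real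
  assumes "\<epsilon> > 0" "S \<ge> 0"
  obtains C where "C \<ge> 0" "\<And>a b s. 2 < s \<Longrightarrow> s \<le> S \<Longrightarrow>
    \<bar>signed_powr s (a + b) * a - \<bar>a\<bar> powr s\<bar> \<le> \<epsilon> * \<bar>a\<bar> powr s + C * \<bar>b\<bar> powr s"
proof -
  have "((\<lambda>x. x powr S) \<longlongrightarrow> 1 powr S) (nhds (1::real))"
    by (intro tendsto_intros) (auto simp: filterlim_ident)
  then have "\<forall>\<^sub>F x in nhds (1::real). dist (x powr S) 1 < \<epsilon>"
    using tendstoD[of "\<lambda>x. x powr S" 1 "nhds 1" \<epsilon>] \<open>\<epsilon> > 0\<close> by simp
  then obtain d where d: "d > 0" "\<And>x. dist x (1::real) < d \<Longrightarrow> dist (x powr S) 1 < \<epsilon>"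
    by (auto simp: eventually_nhds_metric)
  define \<delta> where "\<delta> = min (d / 2) (1 / 2)"
  have \<delta>: "0 < \<delta>" "\<delta> \<le> 1 / 2" using d(1) by (auto simp: \<delta>_def)
  have "dist (1 + \<delta>) 1 < d" "dist (1 - \<delta>) 1 < d" using d(1) \<delta>(1) by (auto simp: dist_real_def \<delta>_def)
  from this[THEN d(2)] have S: "(1 + \<delta>) powr S < 1 + \<epsilon>" "(1 - \<delta>) powr S > 1 - \<epsilon>"
    by (auto simp: dist_real_def abs_less_iff)
  define B where "B = 1 / \<delta> + 1"
  have "B \<ge> 1" using \<delta> by (simp add: B_def)
  have "\<bar>signed_powr s (a + b) * a - \<bar>a\<bar> powr s\<bar> \<le> \<epsilon> * \<bar>a\<bar> powr s + 2 * B powr S * \<bar>b\<bar> powr s"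
    if s: "2 < s" "s \<le> S" for a b s
  proof (cases "\<bar>b\<bar> \<le> \<delta> * \<bar>a\<bar>")
    case True
    show ?thesis
    proof (cases "a = 0")
      case False
      define \<tau> where "\<tau> = b / a"
      have \<tau>: "\<bar>\<tau>\<bar> \<le> \<delta>" using True False by (simp add: \<tau>_def abs_divide pos_divide_le_eq)
      have "a + b = a * (1 + \<tau>)" using False by (simp add: \<tau>_def field_simps)
      then have "signed_powr s (a + b) * a = (\<bar>a\<bar> powr (s - 2) * a\<^sup>2) * ((1 + \<tau>) powr (s - 2) * (1 + \<tau>))"
        using \<tau> \<delta> by (simp add: signed_powr_def abs_mult powr_mult power2_eq_square)
      also have "(1 + \<tau>) powr (s - 2) * (1 + \<tau>) = (1 + \<tau>) powr (s - 1)"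
        using powr_mult_base[of "1 + \<tau>" "s - 2"] \<tau> \<delta> by (simp add: mult.commute)
      also have "\<bar>a\<bar> powr (s - 2) * a\<^sup>2 = \<bar>a\<bar> powr s"
        by (rule abs_powr_minus_2_times_square)
      finally have eq: "signed_powr s (a + b) * a - \<bar>a\<bar> powr s = \<bar>a\<bar> powr s * ((1 + \<tau>) powr (s - 1) - 1)"
        by (simp add: algebra_simps)
      have "(1 + \<tau>) powr (s - 1) \<le> (1 + \<delta>) powr (s - 1)"
        using \<tau> \<delta> s by (intro powr_mono2) auto
      also have "\<dots> \<le> (1 + \<delta>) powr S" using \<delta> s by (intro powr_mono) auto
      finally have "(1 + \<tau>) powr (s - 1) - 1 \<le> \<epsilon>" using S by linarith
      moreover have "(1 - \<delta>) powr S \<le> (1 - \<delta>) powr (s - 1)" using \<delta> s by (intro powr_mono') auto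
      moreover have "(1 - \<delta>) powr (s - 1) \<le> (1 + \<tau>) powr (s - 1)"
        using \<tau> \<delta> s by (intro powr_mono2) auto
      ultimately have "\<bar>(1 + \<tau>) powr (s - 1) - 1\<bar> \<le> \<epsilon>" using S by linarith
      then have "\<bar>a\<bar> powr s * \<bar>(1 + \<tau>) powr (s - 1) - 1\<bar> \<le> \<bar>a\<bar> powr s * \<epsilon>" by (intro mult_left_mono) auto
      then show ?thesis unfolding eq by (simp add: abs_mult mult.commute add_increasing2)
    qed simp
  next
    case False
    then have a: "\<bar>a\<bar> \<le> (1 / \<delta>) * \<bar>b\<bar>" using \<delta>(1) by (simp add: field_simps)
    then have aB: "\<bar>a\<bar> \<le> B * \<bar>b\<bar>" "\<bar>a + b\<bar> \<le> B * \<bar>b\<bar>"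
      using abs_triangle_ineq[of a b] by (simp_all add: B_def distrib_right)
    have Bb: "(B * \<bar>b\<bar>) powr s \<le> B powr S * \<bar>b\<bar> powr s"
      using \<open>B \<ge> 1\<close> s by (auto simp: powr_mult intro!: mult_right_mono powr_mono)
    have "\<bar>signed_powr s (a + b) * a\<bar> = \<bar>a + b\<bar> powr (s - 1) * \<bar>a\<bar>"
      by (simp add: abs_mult abs_signed_powr)
    also have "\<dots> \<le> (B * \<bar>b\<bar>) powr (s - 1) * (B * \<bar>b\<bar>)"
      using aB s by (intro mult_mono powr_mono2) auto
    also have "\<dots> = (B * \<bar>b\<bar>) powr s"
      using powr_mult_base[of "B * \<bar>b\<bar>" "s - 1"] \<open>B \<ge> 1\<close> by (simp add: mult.commute)
    finally have 1: "\<bar>signed_powr s (a + b) * a\<bar> \<le> B powr S * \<bar>b\<bar> powr s" using Bb by linarith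
    have "\<bar>a\<bar> powr s \<le> (B * \<bar>b\<bar>) powr s" using aB s by (intro powr_mono2) auto
    then have 2: "\<bar>a\<bar> powr s \<le> B powr S * \<bar>b\<bar> powr s" using Bb by linarith
    have "0 \<le> \<epsilon> * \<bar>a\<bar> powr s" using \<open>\<epsilon> > 0\<close> by simp
    then show ?thesis
      using 1 2 abs_triangle_ineq4[of "signed_powr s (a + b) * a" "\<bar>a\<bar> powr s"] by simp
  qed
  then show ?thesis using that[of "2 * B powr S"] by simp
qed

text \<open>By the mean value theorem in the exponent the difference is at most \<open>|s - t|\<close> times
  \<open>|ln a| * a powr \<xi>\<close>; the gaps between \<open>S\<close> and \<open>q\<close> and between \<open>2\<close> and \<open>m\<close> absorb the logarithm for large
  and for small \<open>a\<close>.\<close>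

lemma powr_exponent_difference:
  fixes m S q :: real
  assumes "2 < m" "S < q"
  obtains C where "C \<ge> 0" "\<And>a s t. 0 \<le> a \<Longrightarrow> m \<le> s \<Longrightarrow> s \<le> S \<Longrightarrow> m \<le> t \<Longrightarrow> t \<le> S \<Longrightarrow>
    \<bar>a powr s - a powr t\<bar> \<le> C * \<bar>s - t\<bar> * (a\<^sup>2 + a powr q)"
proof -
  define C where "C = 1 / (q - S) + 1 / (m - 2)"
  have C: "C \<ge> 0" "1 / (q - S) \<le> C" "1 / (m - 2) \<le> C" using assms by (auto simp: C_def)
  have log: "\<bar>ln a\<bar> * a powr \<xi> \<le> C * (a\<^sup>2 + a powr q)" if "a > 0" "m \<le> \<xi>" "\<xi> \<le> S" for a \<xi> :: real
  proof (cases "a \<ge> 1")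
    case True
    have "\<bar>ln a\<bar> * a powr \<xi> \<le> (a powr (q - S) / (q - S)) * a powr S"
      using True that assms ln_powr_bound[of a "q - S"] by (intro mult_mono powr_mono) auto
    also have "\<dots> = (1 / (q - S)) * a powr q" using that by (simp add: powr_diff)
    also have "\<dots> \<le> C * (a\<^sup>2 + a powr q)" using C by (intro mult_mono) auto
    finally show ?thesis .
  next
    case False
    have "ln (1 / a) \<le> (1 / a) powr (m - 2) / (m - 2)"
      using False that assms by (intro ln_powr_bound) auto
    then have "\<bar>ln a\<bar> \<le> a powr (2 - m) / (m - 2)"
      using False that by (simp add: ln_div powr_divide powr_diff)
    then have "\<bar>ln a\<bar> * a powr \<xi> \<le> (a powr (2 - m) / (m - 2)) * a powr m"
      using False that assms by (intro mult_mono powr_mono') auto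
    also have "\<dots> = (1 / (m - 2)) * a\<^sup>2" using that by (simp add: powr_diff)
    also have "\<dots> \<le> C * (a\<^sup>2 + a powr q)" using C by (intro mult_mono) auto
    finally show ?thesis .
  qed
  have less: "\<bar>a powr s - a powr t\<bar> \<le> C * \<bar>s - t\<bar> * (a\<^sup>2 + a powr q)"
    if "a > 0" "m \<le> s" "s < t" "t \<le> S" for a s t
  proof -
    obtain \<xi> where \<xi>: "s < \<xi>" "\<xi> < t" "a powr t - a powr s = (t - s) * (a powr \<xi> * ln a)"
    proof -
      have "((\<lambda>y. a powr y) has_real_derivative a powr y * ln a) (at y)" for y
        using \<open>a > 0\<close> by (auto intro!: derivative_eq_intros simp: powr_def)
      then show ?thesis
        using MVT2[OF \<open>s < t\<close>, of "\<lambda>y. a powr y" "\<lambda>y. a powr y * ln a"] that by blast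
    qed
    have "\<bar>a powr s - a powr t\<bar> = \<bar>s - t\<bar> * (\<bar>ln a\<bar> * a powr \<xi>)"
      using \<xi>(3) by (simp add: abs_minus_commute[of "a powr s"] abs_minus_commute[of s] abs_mult)
    also have "\<dots> \<le> \<bar>s - t\<bar> * (C * (a\<^sup>2 + a powr q))"
      using \<xi> that by (intro mult_left_mono log) auto
    finally show ?thesis by (simp add: mult_ac)
  qed
  have "\<bar>a powr s - a powr t\<bar> \<le> C * \<bar>s - t\<bar> * (a\<^sup>2 + a powr q)"
    if "0 \<le> a" "m \<le> s" "s \<le> S" "m \<le> t" "t \<le> S" for a s t
    using less[of a s t] less[of a t s] that
    by (cases "a = 0"; cases s t rule: linorder_cases) (auto simp: abs_minus_commute)
  with C(1) show ?thesis by (rule that)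
qed

text \<open>The constant \<open>T\<close> is harmless on sets of finite measure, so on a ball every power below \<open>q\<close> becomes
  negligible once the function tends to zero almost everywhere.\<close>

lemma powr_subcritical:
  fixes \<epsilon> S q :: real
  assumes "\<epsilon> > 0" "S < q"
  obtains T where "T \<ge> 0" "\<And>a s. 0 \<le> a \<Longrightarrow> 0 < s \<Longrightarrow> s \<le> S \<Longrightarrow> a powr s \<le> \<epsilon> * a powr q + T"
proof -
  define t where "t = max 1 ((1 / \<epsilon>) powr (1 / (q - S)))"
  have "t \<ge> 1" by (simp add: t_def)
  have t: "t powr (S - q) \<le> \<epsilon>"
  proof -
    have "((1 / \<epsilon>) powr (1 / (q - S))) powr (q - S) \<le> t powr (q - S)"
      using assms by (intro powr_mono2) (auto simp: t_def)
    then have "1 / \<epsilon> \<le> t powr (q - S)" using assms by (simp add: powr_powr)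
    then have "1 \<le> \<epsilon> * t powr (q - S)" using \<open>\<epsilon> > 0\<close> by (simp add: pos_divide_le_eq mult.commute)
    then have "t powr (S - q) * 1 \<le> t powr (S - q) * (\<epsilon> * t powr (q - S))"
      by (intro mult_left_mono) auto
    also have "\<dots> = \<epsilon> * (t powr (S - q) * t powr (q - S))" by simp
    also have "t powr (S - q) * t powr (q - S) = 1"
      using \<open>t \<ge> 1\<close> by (simp add: powr_add[symmetric])
    finally show ?thesis by simp
  qed
  have "a powr s \<le> \<epsilon> * a powr q + t powr S" if "0 \<le> a" "0 < s" "s \<le> S" for a s
  proof (cases "a \<ge> t")
    case True
    have "a powr s \<le> a powr S" using True \<open>t \<ge> 1\<close> that by (intro powr_mono) auto
    also have "\<dots> = a powr (S - q) * a powr q" using powr_add[of a "S - q" q] by simp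
    also have "\<dots> \<le> t powr (S - q) * a powr q"
      using True \<open>t \<ge> 1\<close> assms by (intro mult_right_mono powr_mono2') auto
    also have "\<dots> \<le> \<epsilon> * a powr q" by (intro mult_right_mono t) simp
    finally show ?thesis by (simp add: add_increasing2)
  next
    case False
    have "a powr s \<le> t powr s" using False that by (intro powr_mono2) auto
    also have "\<dots> \<le> t powr S" using \<open>t \<ge> 1\<close> that by (intro powr_mono) auto
    finally show ?thesis using assms by (simp add: add_increasing)
  qed
  then show ?thesis using that[of "t powr S"] by simp
qed

lemma integrable_indicator_cball: "integrable lebesgue (\<lambda>x::'a::euclidean_space. c * indicat_real (cball 0 r) x)"
proof -
  have "integrable lebesgue (indicat_real (cball (0::'a) r))"
    using lmeasurable_compact[OF compact_cball, of "0::'a" r] by (rule lmeasurable_iff_integrable[THEN iffD1])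
  then show ?thesis by simp
qed

context variable_exponent
begin

lemma H1_bounded_energy:
  assumes "R \<ge> 0"
  shows "\<exists>K. \<forall>u :: 'a \<Rightarrow> real. u \<in> H1 \<longrightarrow> H1_norm u \<le> R \<longrightarrow>
    integrable lebesgue (\<lambda>x. (u x)\<^sup>2 + \<bar>u x\<bar> powr q) \<and> (LINT x|lebesgue. (u x)\<^sup>2 + \<bar>u x\<bar> powr q) \<le> K"
proof (rule H1_sobolev_embedding[OF p_bounds(4) q_sub _ dim, of "R + 1"])
  show "R + 1 > 0" using \<open>R \<ge> 0\<close> by simp
  fix B assume B: "\<And>u :: 'a \<Rightarrow> real. u \<in> H1 \<Longrightarrow> H1_norm u \<le> R + 1 \<Longrightarrow>
      integrable lebesgue (\<lambda>x. \<bar>u x\<bar> powr q) \<and> (LINT x|lebesgue. \<bar>u x\<bar> powr q) \<le> B"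
  have "integrable lebesgue (\<lambda>x. (u x)\<^sup>2 + \<bar>u x\<bar> powr q) \<and> (LINT x|lebesgue. (u x)\<^sup>2 + \<bar>u x\<bar> powr q) \<le> R\<^sup>2 + B"
    if u: "u \<in> H1" and "H1_norm u \<le> R" for u :: "'a \<Rightarrow> real"
  proof -
    have "0 \<le> (LINT x|lebesgue. (norm (grad u x))\<^sup>2)" by simp
    then have "(LINT x|lebesgue. (u x)\<^sup>2) \<le> (H1_norm u)\<^sup>2" using H1_norm_square[OF u] by linarith
    also have "\<dots> \<le> R\<^sup>2" using that H1_norm_nonneg by (intro power_mono) auto
    finally show ?thesis using B[OF u] that H1_integrable_square[OF u] by simp
  qed
  then show ?thesis by blast
qed

end

text \<open>A bounded sequence in \<open>H\<^sup>1\<close> that tends to zero almost everywhere; below it is the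
  difference between a Palais--Smale sequence and its weak limit.\<close>

locale vanishing_sequence = variable_exponent +
  fixes v :: "nat \<Rightarrow> 'a \<Rightarrow> real" and R :: real
  assumes v: "\<And>k. v k \<in> H1" and R: "\<And>k. H1_norm (v k) \<le> R"
    and v_lim: "AE x in lebesgue. (\<lambda>k. v k x) \<longlonglongrightarrow> 0"
begin

lemma v_measurable [measurable]: "v k \<in> borel_measurable lebesgue"
  by (rule H1_measurable[OF v])

lemma energy_bound: "\<exists>K. \<forall>k. (LINT x|lebesgue. (v k x)\<^sup>2 + \<bar>v k x\<bar> powr q) \<le> K"
proof -
  have "R \<ge> 0" using H1_norm_nonneg[of "v 0"] R[of 0] by linarith
  from H1_bounded_energy[OF this] show ?thesis using v R by blast
qed

lemma vanishing_integral:
  assumes "\<And>k. f k \<in> borel_measurable lebesgue" "AE x in lebesgue. (\<lambda>k. f k x) \<longlonglongrightarrow> 0"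
    and "\<And>\<epsilon>. \<epsilon> > 0 \<Longrightarrow> \<exists>C. integrable lebesgue C \<and>
      (\<forall>k. AE x in lebesgue. \<bar>f k x\<bar> \<le> \<epsilon> * ((v k x)\<^sup>2 + \<bar>v k x\<bar> powr q) + C x)"
  shows "(\<lambda>k. LINT x|lebesgue. f k x) \<longlonglongrightarrow> 0"
proof -
  obtain K where "\<And>k. (LINT x|lebesgue. (v k x)\<^sup>2 + \<bar>v k x\<bar> powr q) \<le> K"
    using energy_bound by blast
  then show ?thesis
    using assms H1_integrable_square[OF v] H1_integrable_q[OF v]
    by (intro integral_tendsto_0_epsilon_dominated(3)[where E = "\<lambda>k x. (v k x)\<^sup>2 + \<bar>v k x\<bar> powr q" and K = K])
      auto
qed

text \<open>Far out \<open>V - Vinf\<close> is small; on the remaining ball \<open>v\<^sup>2\<close> is negligible by \<open>powr_subcritical\<close>.\<close>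

lemma potential_term_vanishes:
  assumes V: "V \<in> L_infinity" "ess_tendsto_at_infinity V Vinf"
  shows "(\<lambda>k. LINT x|lebesgue. (V x - Vinf) * (v k x)\<^sup>2) \<longlonglongrightarrow> 0"
proof -
  obtain B where B: "AE x in lebesgue. \<bar>V x\<bar> \<le> B" and [measurable]: "V \<in> borel_measurable lebesgue"
    using V(1) by (auto simp: L_infinity_def)
  define A where "A = \<bar>B\<bar> + \<bar>Vinf\<bar> + 1"
  have A: "A > 0" by (simp add: A_def add_nonneg_pos)
  have VA: "AE x in lebesgue. \<bar>V x - Vinf\<bar> \<le> A"
    using B by eventually_elim (auto simp: A_def)
  show ?thesis
  proof (rule vanishing_integral)
    show "AE x in lebesgue. (\<lambda>k. (V x - Vinf) * (v k x)\<^sup>2) \<longlonglongrightarrow> 0"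
      using v_lim
    proof eventually_elim
      case (elim x)
      from tendsto_mult[OF tendsto_const tendsto_power[OF elim, of 2], of "V x - Vinf"] show ?case by simp
    qed
    fix \<epsilon> :: real assume "\<epsilon> > 0"
    obtain r where r: "AE x in lebesgue. r \<le> norm x \<longrightarrow> \<bar>V x - Vinf\<bar> < \<epsilon>"
      using V(2) \<open>\<epsilon> > 0\<close> unfolding ess_tendsto_at_infinity_def by blast
    obtain T where T: "T \<ge> 0" "\<And>a s. 0 \<le> a \<Longrightarrow> 0 < s \<Longrightarrow> s \<le> 2 \<Longrightarrow> a powr s \<le> \<epsilon> / A * a powr q + T"
      using powr_subcritical[of "\<epsilon> / A" 2 q] \<open>\<epsilon> > 0\<close> A p_bounds(4) by auto
    have "AE x in lebesgue. \<bar>(V x - Vinf) * (v k x)\<^sup>2\<bar>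
        \<le> \<epsilon> * ((v k x)\<^sup>2 + \<bar>v k x\<bar> powr q) + (A * T) * indicat_real (cball 0 r) x" for k
      using r VA
    proof eventually_elim
      case (elim x)
      have q0: "0 \<le> \<epsilon> * \<bar>v k x\<bar> powr q" "0 \<le> \<epsilon> * (v k x)\<^sup>2" using \<open>\<epsilon> > 0\<close> by auto
      show ?case
      proof (cases "norm x \<le> r")
        case True
        have "(v k x)\<^sup>2 \<le> \<epsilon> / A * \<bar>v k x\<bar> powr q + T" using T(2)[of "\<bar>v k x\<bar>" 2] by (cases "v k x = 0") (auto simp: T(1))
        then have "\<bar>V x - Vinf\<bar> * (v k x)\<^sup>2 \<le> A * (\<epsilon> / A * \<bar>v k x\<bar> powr q + T)"
          using elim(2) A by (intro mult_mono) auto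
        also have "\<dots> = \<epsilon> * \<bar>v k x\<bar> powr q + A * T" using A by (simp add: distrib_left)
        finally show ?thesis using True q0 by (simp add: abs_mult distrib_left)
      next
        case False
        then have "\<bar>V x - Vinf\<bar> * (v k x)\<^sup>2 \<le> \<epsilon> * (v k x)\<^sup>2" using elim(1) by (intro mult_right_mono) auto
        then show ?thesis using False q0 by (simp add: abs_mult distrib_left)
      qed
    qed
    then show "\<exists>C. integrable lebesgue C \<and> (\<forall>k. AE x in lebesgue. \<bar>(V x - Vinf) * (v k x)\<^sup>2\<bar>
        \<le> \<epsilon> * ((v k x)\<^sup>2 + \<bar>v k x\<bar> powr q) + C x)"
      using integrable_indicator_cball by blast
  qed measurable
qed

text \<open>The same division of space: far out the exponents are close, and on the ball both powers are
  negligible.\<close>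

lemma exponent_term_vanishes:
  assumes lim: "(p \<longlongrightarrow> pinf) at_infinity" and pinf: "pm \<le> pinf" "pinf \<le> pp"
  shows "(\<lambda>k. LINT x|lebesgue. \<bar>v k x\<bar> powr p x - \<bar>v k x\<bar> powr pinf) \<longlonglongrightarrow> 0"
proof -
  obtain C where C: "C \<ge> 0" "\<And>a s t. 0 \<le> a \<Longrightarrow> pm \<le> s \<Longrightarrow> s \<le> pp \<Longrightarrow> pm \<le> t \<Longrightarrow> t \<le> pp \<Longrightarrow>
    \<bar>a powr s - a powr t\<bar> \<le> C * \<bar>s - t\<bar> * (a\<^sup>2 + a powr q)"
    using powr_exponent_difference[OF pm_gt pp_less] by metis
  show ?thesis
  proof (rule vanishing_integral)
    show "AE x in lebesgue. (\<lambda>k. \<bar>v k x\<bar> powr p x - \<bar>v k x\<bar> powr pinf) \<longlonglongrightarrow> 0"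
      using v_lim
    proof eventually_elim
      case (elim x)
      from tendsto_diff[OF tendsto_abs_powr[OF elim p_bounds(3)[of x]] tendsto_abs_powr[OF elim, of pinf]]
      show ?case using pinf pm_gt by simp
    qed
    fix \<epsilon> :: real assume "\<epsilon> > 0"
    obtain r where r: "\<And>x. norm x \<ge> r \<Longrightarrow> \<bar>p x - pinf\<bar> < \<epsilon> / (C + 1)"
      using tendstoD[OF lim, of "\<epsilon> / (C + 1)"] \<open>\<epsilon> > 0\<close> C(1)
      by (auto simp: eventually_at_infinity dist_real_def)
    obtain T where T: "T \<ge> 0" "\<And>a s. 0 \<le> a \<Longrightarrow> 0 < s \<Longrightarrow> s \<le> pp \<Longrightarrow> a powr s \<le> \<epsilon> * a powr q + T"
      using powr_subcritical[OF \<open>\<epsilon> > 0\<close> pp_less] by auto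
    have "\<bar>\<bar>v k x\<bar> powr p x - \<bar>v k x\<bar> powr pinf\<bar>
        \<le> \<epsilon> * ((v k x)\<^sup>2 + \<bar>v k x\<bar> powr q) + T * indicat_real (cball 0 r) x" for k x
    proof (cases "norm x \<le> r")
      case True
      have "\<bar>v k x\<bar> powr p x \<le> \<epsilon> * \<bar>v k x\<bar> powr q + T" "\<bar>v k x\<bar> powr pinf \<le> \<epsilon> * \<bar>v k x\<bar> powr q + T"
        using T(2) p_le[of x] pinf pm_gt by auto
      moreover have "0 \<le> \<bar>v k x\<bar> powr p x" "0 \<le> \<bar>v k x\<bar> powr pinf" by simp_all
      ultimately have "\<bar>\<bar>v k x\<bar> powr p x - \<bar>v k x\<bar> powr pinf\<bar> \<le> \<epsilon> * \<bar>v k x\<bar> powr q + T" by linarith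
      moreover have "0 \<le> \<epsilon> * (v k x)\<^sup>2" using \<open>\<epsilon> > 0\<close> by simp
      ultimately show ?thesis using True by (simp add: distrib_left)
    next
      case False
      have "\<bar>\<bar>v k x\<bar> powr p x - \<bar>v k x\<bar> powr pinf\<bar> \<le> C * \<bar>p x - pinf\<bar> * ((v k x)\<^sup>2 + \<bar>v k x\<bar> powr q)"
        using C(2)[of "\<bar>v k x\<bar>" "p x" pinf] p_ge p_le pinf by simp
      also have "\<dots> \<le> \<epsilon> * ((v k x)\<^sup>2 + \<bar>v k x\<bar> powr q)"
      proof (intro mult_right_mono)
        have "C * \<bar>p x - pinf\<bar> \<le> (C + 1) * (\<epsilon> / (C + 1))"
          using r[of x] False C(1) by (intro mult_mono) auto
        then show "C * \<bar>p x - pinf\<bar> \<le> \<epsilon>" using C(1) by simp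
      qed (simp add: add_nonneg_nonneg)
      finally show ?thesis using False by simp
    qed
    then have "\<forall>k. AE x in lebesgue. \<bar>\<bar>v k x\<bar> powr p x - \<bar>v k x\<bar> powr pinf\<bar>
        \<le> \<epsilon> * ((v k x)\<^sup>2 + \<bar>v k x\<bar> powr q) + T * indicat_real (cball 0 r) x" by simp
    then show "\<exists>D. integrable lebesgue D \<and> (\<forall>k. AE x in lebesgue. \<bar>\<bar>v k x\<bar> powr p x - \<bar>v k x\<bar> powr pinf\<bar>
        \<le> \<epsilon> * ((v k x)\<^sup>2 + \<bar>v k x\<bar> powr q) + D x)"
      using integrable_indicator_cball by blast
  qed measurable
qed

lemma mixed_potential_term_vanishes:
  assumes V: "V \<in> L_infinity" and w: "w \<in> H1"
  shows "(\<lambda>k. LINT x|lebesgue. V x * w x * v k x) \<longlonglongrightarrow> 0"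
proof -
  obtain B where B: "AE x in lebesgue. \<bar>V x\<bar> \<le> B" and [measurable]: "V \<in> borel_measurable lebesgue"
    using V by (auto simp: L_infinity_def)
  have [measurable]: "w \<in> borel_measurable lebesgue" by (rule H1_measurable[OF w])
  show ?thesis
  proof (rule vanishing_integral)
    show "AE x in lebesgue. (\<lambda>k. V x * w x * v k x) \<longlonglongrightarrow> 0"
      using v_lim by eventually_elim (simp add: tendsto_mult_right_zero)
    fix \<epsilon> :: real assume "\<epsilon> > 0"
    have "AE x in lebesgue. \<bar>V x * w x * v k x\<bar>
        \<le> \<epsilon> * ((v k x)\<^sup>2 + \<bar>v k x\<bar> powr q) + B\<^sup>2 / \<epsilon> * (w x)\<^sup>2" for k
      using B
    proof eventually_elim
      case (elim x)
      have "2 * (B * \<bar>w x\<bar> * \<bar>v k x\<bar>) \<le> \<epsilon> * (v k x)\<^sup>2 + B\<^sup>2 / \<epsilon> * (w x)\<^sup>2"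
        using abs_mult_le_weighted_squares[OF \<open>\<epsilon> > 0\<close>, of "v k x" "B * w x"] elim
        by (simp add: abs_mult power_mult_distrib mult_ac)
      moreover have "\<bar>V x * w x * v k x\<bar> \<le> B * \<bar>w x\<bar> * \<bar>v k x\<bar>"
        unfolding abs_mult using elim by (intro mult_right_mono) auto
      moreover have "0 \<le> \<bar>V x * w x * v k x\<bar>" by simp
      moreover have "0 \<le> \<epsilon> * \<bar>v k x\<bar> powr q" using \<open>\<epsilon> > 0\<close> by simp
      ultimately show ?case unfolding distrib_left by linarith
    qed
    moreover have "integrable lebesgue (\<lambda>x. B\<^sup>2 / \<epsilon> * (w x)\<^sup>2)" using H1_integrable_square[OF w] by simp
    ultimately show "\<exists>C. integrable lebesgue C \<and> (\<forall>k. AE x in lebesgue. \<bar>V x * w x * v k x\<bar>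
        \<le> \<epsilon> * ((v k x)\<^sup>2 + \<bar>v k x\<bar> powr q) + C x)" by blast
  qed measurable
qed

text \<open>The pointwise errors are dominated by a small multiple of the \<open>p\<close>-th power of \<open>v\<close> plus a multiple
  of that of \<open>w\<close>: this is \<open>signed_powr_perturbation\<close> for the first limit and \<open>powr_young\<close> for the
  second.\<close>

lemma nonlinear_term_splitting:
  assumes w: "w \<in> H1"
  shows "(\<lambda>k. LINT x|lebesgue. signed_powr (p x) (v k x + w x) * v k x - \<bar>v k x\<bar> powr p x) \<longlonglongrightarrow> 0"
    and "(\<lambda>k. LINT x|lebesgue. signed_powr (p x) (v k x + w x) * w x) \<longlonglongrightarrow> (LINT x|lebesgue. \<bar>w x\<bar> powr p x)"
proof -
  have [measurable]: "w \<in> borel_measurable lebesgue" by (rule H1_measurable[OF w])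
  have [measurable]: "(\<lambda>x. signed_powr (p x) (v k x + w x)) \<in> borel_measurable lebesgue" for k
    unfolding signed_powr_def by measurable
  have sp: "(\<lambda>k. signed_powr (p x) (v k x + w x)) \<longlonglongrightarrow> signed_powr (p x) (w x)" if "(\<lambda>k. v k x) \<longlonglongrightarrow> 0" for x
    using tendsto_signed_powr[OF tendsto_add[OF that tendsto_const[of "w x"]] p_bounds(1)[of x]] by simp
  have ple: "\<bar>a\<bar> powr p x \<le> a\<^sup>2 + \<bar>a\<bar> powr q" for a x
    using powr_le_square_plus_powr[of "\<bar>a\<bar>" "p x" q] p_bounds(1,2)[of x] by simp
  have pp0: "pp \<ge> 0" using p_bounds(5) pm_gt by linarith
  note wi = H1_integrable_p[OF w]
  show "(\<lambda>k. LINT x|lebesgue. signed_powr (p x) (v k x + w x) * v k x - \<bar>v k x\<bar> powr p x) \<longlonglongrightarrow> 0"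
  proof (rule vanishing_integral)
    show "AE x in lebesgue. (\<lambda>k. signed_powr (p x) (v k x + w x) * v k x - \<bar>v k x\<bar> powr p x) \<longlonglongrightarrow> 0"
      using v_lim
    proof eventually_elim
      case (elim x)
      from tendsto_diff[OF tendsto_mult[OF sp[OF elim] elim] tendsto_abs_powr[OF elim p_bounds(3)[of x]]]
      show ?case by simp
    qed
    fix \<epsilon> :: real assume "\<epsilon> > 0"
    obtain C where C: "C \<ge> 0" "\<And>a b s. 2 < s \<Longrightarrow> s \<le> pp \<Longrightarrow>
        \<bar>signed_powr s (a + b) * a - \<bar>a\<bar> powr s\<bar> \<le> \<epsilon> * \<bar>a\<bar> powr s + C * \<bar>b\<bar> powr s"
      using signed_powr_perturbation[OF \<open>\<epsilon> > 0\<close> pp0] by metis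
    have "\<bar>signed_powr (p x) (v k x + w x) * v k x - \<bar>v k x\<bar> powr p x\<bar>
        \<le> \<epsilon> * ((v k x)\<^sup>2 + \<bar>v k x\<bar> powr q) + C * \<bar>w x\<bar> powr p x" for k x
      using C(2)[OF p_bounds(1)[of x] p_le[of x], of "v k x" "w x"]
        mult_left_mono[OF ple[of "v k x" x], of \<epsilon>] \<open>\<epsilon> > 0\<close> by linarith
    then show "\<exists>D. integrable lebesgue D \<and> (\<forall>k. AE x in lebesgue.
        \<bar>signed_powr (p x) (v k x + w x) * v k x - \<bar>v k x\<bar> powr p x\<bar> \<le> \<epsilon> * ((v k x)\<^sup>2 + \<bar>v k x\<bar> powr q) + D x)"
      using wi by (intro exI[of _ "\<lambda>x. C * \<bar>w x\<bar> powr p x"]) auto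
  qed measurable
  have u: "(\<lambda>x. v k x + w x) \<in> H1" for k using H1_linear_combination(1)[OF v w, of k 1] by simp
  have iw: "integrable lebesgue (\<lambda>x. signed_powr (p x) (v k x + w x) * w x)" for k
    by (rule signed_powr_integrable[OF u w])
  have "(\<lambda>k. LINT x|lebesgue. signed_powr (p x) (v k x + w x) * w x - \<bar>w x\<bar> powr p x) \<longlonglongrightarrow> 0"
  proof (rule vanishing_integral)
    show "AE x in lebesgue. (\<lambda>k. signed_powr (p x) (v k x + w x) * w x - \<bar>w x\<bar> powr p x) \<longlonglongrightarrow> 0"
      using v_lim
    proof eventually_elim
      case (elim x)
      from tendsto_diff[OF tendsto_mult[OF sp[OF elim] tendsto_const[of "w x"]] tendsto_const[of "\<bar>w x\<bar> powr p x"]]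
      show ?case by (simp add: signed_powr_self)
    qed
    fix \<epsilon> :: real assume "\<epsilon> > 0"
    define \<eta> where "\<eta> = \<epsilon> / 2 powr pp"
    have "\<eta> > 0" using \<open>\<epsilon> > 0\<close> by (simp add: \<eta>_def)
    obtain C where C: "C \<ge> 0" "\<And>a b s. 0 \<le> a \<Longrightarrow> 0 \<le> b \<Longrightarrow> 1 < s \<Longrightarrow> s \<le> pp \<Longrightarrow>
        a powr (s - 1) * b \<le> \<eta> * a powr s + C * b powr s"
      using powr_young[OF \<open>\<eta> > 0\<close> pp0] by metis
    have "\<bar>signed_powr (p x) (v k x + w x) * w x - \<bar>w x\<bar> powr p x\<bar>
        \<le> \<epsilon> * ((v k x)\<^sup>2 + \<bar>v k x\<bar> powr q) + (\<epsilon> + C + 1) * \<bar>w x\<bar> powr p x" for k x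
    proof -
      define mx where "mx = max \<bar>v k x\<bar> \<bar>w x\<bar>"
      have "\<bar>signed_powr (p x) (v k x + w x) * w x\<bar> = \<bar>v k x + w x\<bar> powr (p x - 1) * \<bar>w x\<bar>"
        by (simp add: abs_mult abs_signed_powr)
      also have "\<dots> \<le> \<eta> * \<bar>v k x + w x\<bar> powr p x + C * \<bar>w x\<bar> powr p x"
        using C(2)[of "\<bar>v k x + w x\<bar>" "\<bar>w x\<bar>" "p x"] p_bounds(1)[of x] p_le[of x] by simp
      also have "\<bar>v k x + w x\<bar> powr p x \<le> (2 * mx) powr p x"
        by (intro powr_mono2) (auto simp: mx_def)
      also have "(2 * mx) powr p x \<le> 2 powr pp * (\<bar>v k x\<bar> powr p x + \<bar>w x\<bar> powr p x)"
      proof -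
        have "(2 * mx) powr p x = 2 powr p x * mx powr p x" by (simp add: powr_mult mx_def)
        also have "\<dots> \<le> 2 powr pp * (\<bar>v k x\<bar> powr p x + \<bar>w x\<bar> powr p x)"
          using p_le[of x] by (intro mult_mono powr_mono) (auto simp: mx_def max_def)
        finally show ?thesis .
      qed
      finally have "\<bar>signed_powr (p x) (v k x + w x) * w x\<bar>
          \<le> \<eta> * (2 powr pp * (\<bar>v k x\<bar> powr p x + \<bar>w x\<bar> powr p x)) + C * \<bar>w x\<bar> powr p x"
        using \<open>\<eta> > 0\<close> by (simp add: mult_left_mono)
      also have "\<eta> * (2 powr pp * (\<bar>v k x\<bar> powr p x + \<bar>w x\<bar> powr p x)) = \<epsilon> * \<bar>v k x\<bar> powr p x + \<epsilon> * \<bar>w x\<bar> powr p x"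
        by (simp add: \<eta>_def distrib_left)
      finally have "\<bar>signed_powr (p x) (v k x + w x) * w x\<bar>
          \<le> \<epsilon> * \<bar>v k x\<bar> powr p x + \<epsilon> * \<bar>w x\<bar> powr p x + C * \<bar>w x\<bar> powr p x" .
      moreover have "\<epsilon> * \<bar>v k x\<bar> powr p x \<le> \<epsilon> * ((v k x)\<^sup>2 + \<bar>v k x\<bar> powr q)"
        using ple \<open>\<epsilon> > 0\<close> by (intro mult_left_mono) auto
      moreover have "\<bar>signed_powr (p x) (v k x + w x) * w x - \<bar>w x\<bar> powr p x\<bar>
          \<le> \<bar>signed_powr (p x) (v k x + w x) * w x\<bar> + \<bar>w x\<bar> powr p x"
        using abs_triangle_ineq4[of "signed_powr (p x) (v k x + w x) * w x" "\<bar>w x\<bar> powr p x"] by simp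
      ultimately show ?thesis unfolding distrib_right by linarith
    qed
    then show "\<exists>D. integrable lebesgue D \<and> (\<forall>k. AE x in lebesgue.
        \<bar>signed_powr (p x) (v k x + w x) * w x - \<bar>w x\<bar> powr p x\<bar> \<le> \<epsilon> * ((v k x)\<^sup>2 + \<bar>v k x\<bar> powr q) + D x)"
      using wi by (intro exI[of _ "\<lambda>x. (\<epsilon> + C + 1) * \<bar>w x\<bar> powr p x"]) auto
  qed measurable
  then have "(\<lambda>k. (LINT x|lebesgue. signed_powr (p x) (v k x + w x) * w x) - (LINT x|lebesgue. \<bar>w x\<bar> powr p x)) \<longlonglongrightarrow> 0"
    using iw wi by simp
  then show "(\<lambda>k. LINT x|lebesgue. signed_powr (p x) (v k x + w x) * w x) \<longlonglongrightarrow> (LINT x|lebesgue. \<bar>w x\<bar> powr p x)"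
    by (simp add: LIM_zero_iff)
qed

end

section \<open>The Palais--Smale condition\<close>

lemma J_inf_eq:
  assumes "u \<in> H1"
  shows "J_inf Vinf u = (LINT x|lebesgue. (norm (grad u x))\<^sup>2) + Vinf * (LINT x|lebesgue. (u x)\<^sup>2)"
  using H1_grad[OF assms] by (simp add: J_inf_def square_integrable_def)

lemma J_inf_nonneg: "Vinf \<ge> 0 \<Longrightarrow> J_inf Vinf u \<ge> 0"
  unfolding J_inf_def by (intro Bochner_Integration.integral_nonneg) simp

lemma H1_norm_le_J_inf:
  assumes u: "u \<in> H1"
  shows "min 1 Vinf * (H1_norm u)\<^sup>2 \<le> J_inf Vinf u"
proof -
  have "min 1 Vinf * (LINT x|lebesgue. (norm (grad u x))\<^sup>2) \<le> 1 * (LINT x|lebesgue. (norm (grad u x))\<^sup>2)"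
    "min 1 Vinf * (LINT x|lebesgue. (u x)\<^sup>2) \<le> Vinf * (LINT x|lebesgue. (u x)\<^sup>2)"
    by (intro mult_right_mono; simp)+
  then show ?thesis unfolding H1_norm_square[OF u] J_inf_eq[OF u] distrib_left by linarith
qed

text \<open>Both functionals at infinity are homogeneous, so the infimum over the constraint set bounds
  the energy of every function.\<close>

lemma lambda1_inf_bound:
  fixes v :: "'a::euclidean_space \<Rightarrow> real"
  assumes v: "v \<in> H1" and "Vinf > 0" "pinf > 0" and Y: "(LINT x|lebesgue. \<bar>v x\<bar> powr pinf) > 0"
  shows "lambda1_inf TYPE('a) Vinf pinf * ((LINT x|lebesgue. \<bar>v x\<bar> powr pinf) / pinf) powr (2 / pinf) \<le> J_inf Vinf v"
    and "lambda1_inf TYPE('a) Vinf pinf \<ge> 0"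
proof -
  define Y where "Y = (LINT x|lebesgue. \<bar>v x\<bar> powr pinf)"
  define i where "i = (Y / pinf) powr (1 / pinf)"
  have "Y > 0" using assms by (simp add: Y_def)
  have i: "i > 0" using \<open>Y > 0\<close> \<open>pinf > 0\<close> by (simp add: i_def)
  have ip: "i powr pinf = Y / pinf" "i\<^sup>2 = (Y / pinf) powr (2 / pinf)"
    using \<open>Y > 0\<close> \<open>pinf > 0\<close> by (simp_all add: i_def powr_powr power2_eq_square powr_add[symmetric])
  let ?v = "\<lambda>x. (1 / i) * v x"
  have v': "?v \<in> H1" by (rule H1_scale(1)[OF v])
  have "(LINT x|lebesgue. \<bar>?v x\<bar> powr pinf / pinf) = (LINT x|lebesgue. \<bar>v x\<bar> powr pinf / Y)"
  proof (intro Bochner_Integration.integral_cong refl)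
    fix x
    have "\<bar>?v x\<bar> powr pinf = \<bar>v x\<bar> powr pinf / (Y / pinf)"
      using i ip(1) by (simp add: abs_mult abs_divide powr_divide)
    then show "\<bar>?v x\<bar> powr pinf / pinf = \<bar>v x\<bar> powr pinf / Y"
      using \<open>pinf > 0\<close> by simp
  qed
  also have "\<dots> = 1" using \<open>Y > 0\<close> by (simp add: Y_def)
  finally have "I_inf pinf ?v = 1" by (simp add: I_inf_def)
  then have mem: "?v \<in> M_inf pinf" using v' by (simp add: M_inf_def)
  have bdd: "bdd_below (J_inf Vinf ` (M_inf pinf :: ('a \<Rightarrow> real) set))"
    using J_inf_nonneg[of Vinf] \<open>Vinf > 0\<close> by (intro bdd_belowI2[of _ 0]) auto
  have "lambda1_inf TYPE('a) Vinf pinf \<le> J_inf Vinf ?v"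
    unfolding lambda1_inf_def by (rule cINF_lower[OF bdd mem])
  also have "J_inf Vinf ?v = (1 / i)\<^sup>2 * J_inf Vinf v"
    unfolding J_inf_eq[OF v'] J_inf_eq[OF v] integral_grad_scale[OF v]
    by (simp add: power_mult_distrib power_divide add_divide_distrib distrib_left)
  finally have "lambda1_inf TYPE('a) Vinf pinf * i\<^sup>2 \<le> J_inf Vinf v"
    using i by (simp add: power_divide field_simps)
  then show "lambda1_inf TYPE('a) Vinf pinf * ((LINT x|lebesgue. \<bar>v x\<bar> powr pinf) / pinf) powr (2 / pinf) \<le> J_inf Vinf v"
    by (simp only: ip(2) Y_def)
  show "lambda1_inf TYPE('a) Vinf pinf \<ge> 0"
    unfolding lambda1_inf_def using mem J_inf_nonneg[OF less_imp_le[OF \<open>Vinf > 0\<close>]] by (intro cINF_greatest) auto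
qed

lemma H1_diff:
  assumes u: "u \<in> H1" and w: "w \<in> H1"
  shows "(\<lambda>x. u x - w x) \<in> H1" "AE x in lebesgue. grad (\<lambda>x. u x - w x) x = grad u x - grad w x"
  using H1_linear_combination[OF u w, of "- 1"] by simp_all

lemma H1_norm_diff_le:
  assumes u: "u \<in> H1" and w: "w \<in> H1"
  shows "(H1_norm (\<lambda>x. u x - w x))\<^sup>2 \<le> 2 * (H1_norm u)\<^sup>2 + 2 * (H1_norm w)\<^sup>2"
proof -
  note d = H1_diff[OF u w]
  note L = H1_grad(1,2)[OF u, unfolded square_integrable_def] H1_grad(1,2)[OF w, unfolded square_integrable_def]
    H1_grad(1,2)[OF d(1), unfolded square_integrable_def]
  have pw: "(norm (a - b))\<^sup>2 \<le> 2 * (norm a)\<^sup>2 + 2 * (norm b)\<^sup>2" for a b :: "'c::real_inner"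
  proof -
    have "0 \<le> (norm (a + b))\<^sup>2" by simp
    moreover have "(norm (a - b))\<^sup>2 + (norm (a + b))\<^sup>2 = 2 * (norm a)\<^sup>2 + 2 * (norm b)\<^sup>2"
      unfolding power2_norm_eq_inner by (simp add: inner_diff_left inner_diff_right inner_add_left inner_add_right)
    ultimately show ?thesis by linarith
  qed
  have "(LINT x|lebesgue. (norm (grad (\<lambda>x. u x - w x) x))\<^sup>2)
      \<le> (LINT x|lebesgue. 2 * (norm (grad u x))\<^sup>2 + 2 * (norm (grad w x))\<^sup>2)"
  proof (rule integral_mono_AE)
    show "AE x in lebesgue. (norm (grad (\<lambda>x. u x - w x) x))\<^sup>2 \<le> 2 * (norm (grad u x))\<^sup>2 + 2 * (norm (grad w x))\<^sup>2"
      using d(2) by eventually_elim (simp add: pw)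
  qed (use L in auto)
  moreover have "(LINT x|lebesgue. (u x - w x)\<^sup>2) \<le> (LINT x|lebesgue. 2 * (u x)\<^sup>2 + 2 * (w x)\<^sup>2)"
  proof (rule integral_mono)
    show "(u x - w x)\<^sup>2 \<le> 2 * (u x)\<^sup>2 + 2 * (w x)\<^sup>2" for x using pw[of "u x" "w x"] by simp
  qed (use L in auto)
  ultimately show ?thesis
    unfolding H1_norm_square[OF u] H1_norm_square[OF w] H1_norm_square[OF d(1)] using L by simp
qed

text \<open>Outside a ball \<open>V\<close> is bounded below by \<open>Vinf / 2\<close>; inside it \<open>u\<^sup>2\<close> is controlled by the
  constraint, because \<open>u\<^sup>2 \<le> 1 + |u|\<^sup>p\<close>.\<close>

lemma (in variable_exponent) coercive_on_M:
  assumes V: "V \<in> L_infinity" "ess_tendsto_at_infinity V Vinf" and "Vinf > 0"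
  obtains C where "\<And>u. u \<in> M p \<Longrightarrow> min 1 (Vinf / 2) * (H1_norm u)\<^sup>2 \<le> J V u + C"
proof -
  obtain B where B: "AE x in lebesgue. \<bar>V x\<bar> \<le> B"
    using V(1) by (auto simp: L_infinity_def)
  obtain r where r: "AE x in lebesgue. r \<le> norm x \<longrightarrow> \<bar>V x - Vinf\<bar> < Vinf / 2"
    using V(2) \<open>Vinf > 0\<close> unfolding ess_tendsto_at_infinity_def by (meson half_gt_zero)
  define A where "A = \<bar>B\<bar> + Vinf"
  have "A > 0" using \<open>Vinf > 0\<close> by (simp add: A_def add_nonneg_pos)
  define vol where "vol = (LINT x|lebesgue. 1 * indicat_real (cball (0::'a) r) x)"
  have "min 1 (Vinf / 2) * (H1_norm u)\<^sup>2 \<le> J V u + A * (vol + pp)" if uM: "u \<in> M p" for u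
  proof -
    have u: "u \<in> H1" using uM by (simp add: M_def)
    note i2 = H1_integrable_square[OF u]
    have i1: "integrable lebesgue (\<lambda>x. A * (1 * indicat_real (cball (0::'a) r) x + \<bar>u x\<bar> powr p x))"
      by (rule integrable_mult_right[OF Bochner_Integration.integrable_add[
              OF integrable_indicator_cball[of 1 r] H1_integrable_p[OF u]]])
    have iV: "integrable lebesgue (\<lambda>x. V x * u x * u x)" by (rule energy_form_integrable(2)[OF V(1) u u])
    have "(LINT x|lebesgue. Vinf / 2 * (u x)\<^sup>2 - A * (1 * indicat_real (cball (0::'a) r) x + \<bar>u x\<bar> powr p x))
        \<le> (LINT x|lebesgue. V x * u x * u x)"
    proof (rule integral_mono_AE)
      show "AE x in lebesgue. Vinf / 2 * (u x)\<^sup>2 - A * (1 * indicat_real (cball (0::'a) r) x + \<bar>u x\<bar> powr p x)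
          \<le> V x * u x * u x"
        using B r
      proof eventually_elim
        case (elim x)
        have V2: "V x * u x * u x = V x * (u x)\<^sup>2" by (simp add: power2_eq_square)
        have pos: "0 \<le> A * \<bar>u x\<bar> powr p x" using \<open>A > 0\<close> by simp
        show ?case
        proof (cases "norm x \<le> r")
          case True
          have "(u x)\<^sup>2 \<le> 1 + \<bar>u x\<bar> powr p x"
          proof (cases "\<bar>u x\<bar> \<le> 1")
            case True
            then have "(u x)\<^sup>2 \<le> 1" by (simp add: abs_square_le_1)
            then show ?thesis by (simp add: add_increasing2)
          next
            case False
            then have "\<bar>u x\<bar> powr 2 \<le> \<bar>u x\<bar> powr p x" using p_bounds(1)[of x] by (intro powr_mono) auto
            then show ?thesis using False by (cases "u x = 0") auto
          qed
          then have "A * (u x)\<^sup>2 \<le> A * (1 + \<bar>u x\<bar> powr p x)" using \<open>A > 0\<close> by (intro mult_left_mono) auto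
          moreover have "(Vinf / 2 - A) * (u x)\<^sup>2 \<le> V x * (u x)\<^sup>2"
            using elim(1) \<open>Vinf > 0\<close> by (intro mult_right_mono) (auto simp: A_def)
          moreover have "indicat_real (cball (0::'a) r) x = 1" using True by simp
          ultimately show ?thesis unfolding V2 left_diff_distrib by simp
        next
          case False
          then have "Vinf / 2 \<le> V x" using elim(2) by linarith
          then have "Vinf / 2 * (u x)\<^sup>2 \<le> V x * (u x)\<^sup>2"
            by (rule mult_right_mono) simp
          moreover have "indicat_real (cball (0::'a) r) x = 0" using False by simp
          ultimately show ?thesis unfolding V2 using pos by simp
        qed
      qed
    qed (use i1 i2 iV in auto)
    then have "Vinf / 2 * (LINT x|lebesgue. (u x)\<^sup>2) - A * (vol + (LINT x|lebesgue. \<bar>u x\<bar> powr p x))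
        \<le> (LINT x|lebesgue. V x * u x * u x)"
      using i1 i2 integrable_indicator_cball[of 1 r, where 'a='a] H1_integrable_p[OF u]
      by (simp add: vol_def)
    moreover have "A * (vol + (LINT x|lebesgue. \<bar>u x\<bar> powr p x)) \<le> A * (vol + pp)"
      using \<open>A > 0\<close> M_integral_bounds(2)[OF uM] by (intro mult_left_mono) auto
    moreover have "J V u = (LINT x|lebesgue. (norm (grad u x))\<^sup>2) + (LINT x|lebesgue. V x * u x * u x)"
      unfolding J_eq_energy_form[OF V(1) u] energy_form_def power2_norm_eq_inner ..
    moreover have "min 1 (Vinf / 2) * (LINT x|lebesgue. (norm (grad u x))\<^sup>2) \<le> 1 * (LINT x|lebesgue. (norm (grad u x))\<^sup>2)"
      "min 1 (Vinf / 2) * (LINT x|lebesgue. (u x)\<^sup>2) \<le> Vinf / 2 * (LINT x|lebesgue. (u x)\<^sup>2)"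
      by (intro mult_right_mono; simp)+
    ultimately show ?thesis unfolding H1_norm_square[OF u] distrib_left by linarith
  qed
  then show ?thesis by (rule that)
qed

text \<open>Write the given bound as \<open>l * (A / pinf) powr \<theta> * (A / Y) powr (1 - \<theta>) \<le> c\<close> with \<open>\<theta> = 2 / pinf\<close>. The last
  factor is at least \<open>1\<close> because \<open>\<theta> < 1\<close> and \<open>Y \<le> A\<close>.\<close>

lemma energy_threshold:
  fixes A Y c l pm pinf :: real
  assumes "0 < Y" "Y \<le> A" "0 < pm" "pm \<le> A" "2 < pinf" "0 \<le> l"
    and le: "l * (Y / pinf) powr (2 / pinf) \<le> c * Y / A"
  shows "(pm / pinf) powr (2 / pinf) * l \<le> c"
proof -
  define \<theta> where "\<theta> = 2 / pinf"
  have \<theta>: "0 < \<theta>" "\<theta> < 1" using assms by (auto simp: \<theta>_def)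
  have "A > 0" using assms by linarith
  have "(pm / pinf) powr \<theta> \<le> (A / pinf) powr \<theta>"
    using assms \<theta> by (intro powr_mono2 divide_right_mono) auto
  also have "\<dots> = (A / pinf) powr \<theta> * 1" by simp
  also have "\<dots> \<le> (A / pinf) powr \<theta> * (A / Y) powr (1 - \<theta>)"
    using assms \<theta> by (intro mult_left_mono ge_one_powr_ge_zero) auto
  also have "\<dots> = (Y / pinf) powr \<theta> * (A / Y)"
  proof -
    have "(A / pinf) powr \<theta> = (Y / pinf) powr \<theta> * (A / Y) powr \<theta>"
      using assms \<open>A > 0\<close> by (simp add: powr_mult[symmetric])
    moreover have "(A / Y) powr \<theta> * (A / Y) powr (1 - \<theta>) = A / Y"
      using assms \<open>A > 0\<close> by (simp add: powr_add[symmetric])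
    ultimately show ?thesis by (simp add: mult.assoc)
  qed
  finally have "(pm / pinf) powr \<theta> * l \<le> (Y / pinf) powr \<theta> * (A / Y) * l"
    using \<open>0 \<le> l\<close> by (intro mult_right_mono)
  also have "\<dots> = (l * (Y / pinf) powr \<theta>) * (A / Y)" by simp
  also have "\<dots> \<le> (c * Y / A) * (A / Y)"
    using le \<open>A > 0\<close> \<open>0 < Y\<close> by (intro mult_right_mono) (auto simp: \<theta>_def)
  also have "\<dots> = c" using \<open>A > 0\<close> \<open>0 < Y\<close> by simp
  finally show ?thesis by (simp add: \<theta>_def)
qed

text \<open>Testing the equation for \<open>u\<close> with the oscillating part \<open>v = u - w\<close> shows that the energy at
  infinity of \<open>v\<close> tends to \<open>c Y / A\<close>, where \<open>Y\<close> and \<open>A\<close> are the limits of the integrals of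
  \<open>|v| powr pinf\<close> and \<open>|u| powr p x\<close>. If \<open>Y > 0\<close>, the variational characterisation of the first level at infinity
  forces \<open>c\<close> above the threshold.\<close>

lemma (in variable_exponent) PS_condition_below_threshold:
  assumes V: "V \<in> L_infinity" "ess_tendsto_at_infinity V Vinf" and "Vinf > 0"
    and lim: "(p \<longlongrightarrow> pinf) at_infinity" and pinf: "pm \<le> pinf" "pinf \<le> pp"
    and c: "c < (pm / pinf) powr (2 / pinf) * lambda1_inf TYPE('a) Vinf pinf"
  shows "PS_condition V p c"
  unfolding PS_condition_def
proof (intro allI impI)
  fix u assume PS: "PS_sequence V p c u"
  then have uM: "u k \<in> M p" for k by (simp add: PS_sequence_def)
  then have u: "u k \<in> H1" for k by (simp add: M_def)
  have Jc: "(\<lambda>k. J V (u k)) \<longlonglongrightarrow> c" using PS by (simp add: PS_sequence_def)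
  obtain \<mu> DJ DI where D: "\<And>k. has_H1_derivative (J V) (DJ k) (u k)" "\<And>k. has_H1_derivative (I p) (DI k) (u k)"
    and dual: "(\<lambda>k. dual_norm (\<lambda>v. DJ k v - \<mu> k * DI k v)) \<longlonglongrightarrow> 0"
    using PS unfolding PS_sequence_def by blast
  have pinf2: "pinf > 2" using pinf pm_gt by linarith
  define m where "m = min 1 (Vinf / 2)"
  have "m > 0" using \<open>Vinf > 0\<close> by (simp add: m_def)
  obtain C where C: "\<And>u. u \<in> M p \<Longrightarrow> m * (H1_norm u)\<^sup>2 \<le> J V u + C"
    using coercive_on_M[OF V \<open>Vinf > 0\<close>] unfolding m_def by blast
  obtain Jb where Jb: "\<And>k. \<bar>J V (u k)\<bar> \<le> Jb"
    using convergent_imp_Bseq[OF convergentI[OF Jc]] by (auto simp: Bseq_def)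
  define R where "R = sqrt ((Jb + C) / m)"
  have R: "H1_norm (u k) \<le> R" for k
  proof -
    have "m * (H1_norm (u k))\<^sup>2 \<le> Jb + C" using C[OF uM[of k]] Jb[of k] by linarith
    then have "(H1_norm (u k))\<^sup>2 \<le> (Jb + C) / m" using \<open>m > 0\<close> by (simp add: pos_le_divide_eq mult.commute)
    then show ?thesis unfolding R_def by (rule real_le_rsqrt)
  qed
  obtain r w where r: "strict_mono (r :: nat \<Rightarrow> nat)" and w: "w \<in> H1"
    and ae: "AE x in lebesgue. (\<lambda>k. u (r k) x) \<longlonglongrightarrow> w x"
    and weak: "(\<lambda>k. LINT x|lebesgue. grad w x \<bullet> grad (u (r k)) x) \<longlonglongrightarrow> (LINT x|lebesgue. (norm (grad w x))\<^sup>2)"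
    by (rule H1_weak_compactness[of u R, OF u R])
  define v where "v k x = u (r k) x - w x" for k x
  have v: "v k \<in> H1" "AE x in lebesgue. grad (v k) x = grad (u (r k)) x - grad w x" for k
    using H1_diff[OF u w, of "r k"] by (simp_all add: v_def[abs_def])
  define S where "S = sqrt (2 * R\<^sup>2 + 2 * (H1_norm w)\<^sup>2)"
  have S: "H1_norm (v k) \<le> S" for k
  proof -
    have "(H1_norm (v k))\<^sup>2 \<le> 2 * (H1_norm (u (r k)))\<^sup>2 + 2 * (H1_norm w)\<^sup>2"
      using H1_norm_diff_le[OF u w, of "r k"] by (simp add: v_def[abs_def])
    also have "\<dots> \<le> 2 * R\<^sup>2 + 2 * (H1_norm w)\<^sup>2"
      using R[of "r k"] H1_norm_nonneg[of "u (r k)"] by (intro add_right_mono mult_left_mono power_mono) auto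
    finally show ?thesis unfolding S_def by (rule real_le_rsqrt)
  qed
  have v0: "AE x in lebesgue. (\<lambda>k. v k x) \<longlonglongrightarrow> 0"
    using ae by eventually_elim (simp add: v_def LIM_zero)
  define L where "L k f = DJ k f - \<mu> k * DI k f" for k f
  have L_small: "(\<lambda>k. L (r k) (f k)) \<longlonglongrightarrow> 0" if f: "\<And>k. f k \<in> H1" "\<And>k. H1_norm (f k) \<le> B" for f B
  proof (rule Lim_null_comparison)
    have HL: "H1_functional (L k)" for k
      unfolding L_def[abs_def] using D by (intro H1_functional_combination) (auto simp: has_H1_derivative_def)
    show "\<forall>\<^sub>F k in sequentially. norm (L (r k) (f k)) \<le> \<bar>dual_norm (L (r k))\<bar> * B"
    proof (intro always_eventually allI)
      fix k
      have "\<bar>L (r k) (f k)\<bar> \<le> dual_norm (L (r k)) * H1_norm (f k)" by (rule H1_functional_bound[OF HL f(1)])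
      also have "\<dots> \<le> \<bar>dual_norm (L (r k))\<bar> * B"
        using f(2)[of k] H1_norm_nonneg[of "f k"] by (intro mult_mono) auto
      finally show "norm (L (r k) (f k)) \<le> \<bar>dual_norm (L (r k))\<bar> * B" by simp
    qed
    have "(\<lambda>k. dual_norm (L (r k))) \<longlonglongrightarrow> 0"
      using LIMSEQ_subseq_LIMSEQ[OF dual r] by (simp add: o_def L_def[abs_def])
    from tendsto_mult[OF tendsto_rabs[OF this] tendsto_const[of B]]
    show "(\<lambda>k. \<bar>dual_norm (L (r k))\<bar> * B) \<longlonglongrightarrow> 0" by simp
  qed
  define A where "A k = (LINT x|lebesgue. \<bar>u (r k) x\<bar> powr p x)" for k
  define X where "X k = (LINT x|lebesgue. signed_powr (p x) (u (r k) x) * v k x)" for k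
  define Z where "Z k = (LINT x|lebesgue. \<bar>v k x\<bar> powr p x)" for k
  define Y where "Y k = (LINT x|lebesgue. \<bar>v k x\<bar> powr pinf)" for k
  have A: "pm \<le> A k" "A k \<le> pp" for k
    using M_integral_bounds[OF uM[of "r k"]] by (simp_all add: A_def)
  have L_eq: "L (r k) f = 2 * energy_form V (u (r k)) f
      - \<mu> (r k) * ((LINT x|lebesgue. signed_powr (p x) (u (r k) x) * f x) / A k)" if "f \<in> H1" for k f
    using J_derivative[OF V(1) u D(1) that] I_derivative[OF uM D(2) that] by (simp add: L_def A_def)
  \<comment> \<open>Testing with \<open>u\<close> itself identifies the limit of the multipliers.\<close>
  have mu: "(\<lambda>k. \<mu> (r k)) \<longlonglongrightarrow> 2 * c"
  proof -
    have "L (r k) (u (r k)) = 2 * J V (u (r k)) - \<mu> (r k)" for k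
    proof -
      have "A k > 0" using A(1)[of k] pm_gt by linarith
      then show ?thesis
        using L_eq[OF u, of k "r k"] by (simp add: J_eq_energy_form[OF V(1) u] signed_powr_self A_def[symmetric])
    qed
    then have "\<mu> (r k) = 2 * J V (u (r k)) - L (r k) (u (r k))" for k by simp
    moreover have "(\<lambda>k. 2 * J V (u (r k)) - L (r k) (u (r k))) \<longlonglongrightarrow> 2 * c - 0"
      using LIMSEQ_subseq_LIMSEQ[OF Jc r] by (intro tendsto_intros L_small[where B = R] u R) (simp add: o_def)
    ultimately show ?thesis by simp
  qed
  have uvw: "u (r k) x = v k x + w x" for k x by (simp add: v_def)
  interpret vs: vanishing_sequence p pm pp q v S
    by unfold_locales (rule v(1) S v0)+
  have XZ: "(\<lambda>k. X k - Z k) \<longlonglongrightarrow> 0"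
  proof -
    have "(LINT x|lebesgue. signed_powr (p x) (v k x + w x) * v k x - \<bar>v k x\<bar> powr p x) = X k - Z k" for k
      unfolding X_def Z_def uvw[symmetric]
      by (rule Bochner_Integration.integral_diff[OF signed_powr_integrable[OF u v(1)] H1_integrable_p[OF v(1)]])
    then show ?thesis using vs.nonlinear_term_splitting(1)[OF w] by simp
  qed
  have AX: "(\<lambda>k. A k - X k) \<longlonglongrightarrow> (LINT x|lebesgue. \<bar>w x\<bar> powr p x)"
  proof -
    have "A k - X k = (LINT x|lebesgue. signed_powr (p x) (v k x + w x) * w x)" for k
    proof -
      have "A k - X k = (LINT x|lebesgue. \<bar>u (r k) x\<bar> powr p x - signed_powr (p x) (u (r k) x) * v k x)"
        unfolding A_def X_def
        by (rule Bochner_Integration.integral_diff[symmetric, OF H1_integrable_p[OF u] signed_powr_integrable[OF u v(1)]])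
      also have "\<dots> = (LINT x|lebesgue. signed_powr (p x) (v k x + w x) * w x)"
        unfolding signed_powr_self[symmetric]
        by (intro Bochner_Integration.integral_cong refl) (simp add: uvw algebra_simps)
      finally show ?thesis .
    qed
    then show ?thesis using vs.nonlinear_term_splitting(2)[OF w] by simp
  qed
  have Yint: "integrable lebesgue (\<lambda>x. \<bar>v k x\<bar> powr pinf)" for k
    using pinf pp_less pinf2 by (intro H1_integrable_powr(1)[OF v(1)]) auto
  have ZY: "(\<lambda>k. Z k - Y k) \<longlonglongrightarrow> 0"
  proof -
    have "(LINT x|lebesgue. \<bar>v k x\<bar> powr p x - \<bar>v k x\<bar> powr pinf) = Z k - Y k" for k
      unfolding Z_def Y_def by (rule Bochner_Integration.integral_diff[OF H1_integrable_p[OF v(1)] Yint])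
    then show ?thesis using vs.exponent_term_vanishes[OF lim pinf] by simp
  qed
  have wv: "(\<lambda>k. energy_form V w (v k)) \<longlonglongrightarrow> 0"
  proof -
    have [measurable]: "grad w \<in> borel_measurable lebesgue" "\<And>k. grad (v k) \<in> borel_measurable lebesgue"
      "\<And>k. grad (u k) \<in> borel_measurable lebesgue"
      using H1_grad(2)[OF w] H1_grad(2)[OF v(1)] H1_grad(2)[OF u] by (auto simp: square_integrable_def)
    have "(LINT x|lebesgue. grad w x \<bullet> grad (v k) x) =
        (LINT x|lebesgue. grad w x \<bullet> grad (u (r k)) x) - (LINT x|lebesgue. (norm (grad w x))\<^sup>2)" for k
    proof -
      have "(LINT x|lebesgue. grad w x \<bullet> grad (v k) x) = (LINT x|lebesgue. grad w x \<bullet> grad (u (r k)) x - grad w x \<bullet> grad w x)"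
        using v(2)[of k] by (intro integral_cong_AE) (auto simp: inner_diff_right)
      also have "\<dots> = (LINT x|lebesgue. grad w x \<bullet> grad (u (r k)) x) - (LINT x|lebesgue. grad w x \<bullet> grad w x)"
        using energy_form_integrable(1)[OF V(1) w u, of "r k"] energy_form_integrable(1)[OF V(1) w w] by simp
      finally show ?thesis by (simp add: power2_norm_eq_inner)
    qed
    then have "(\<lambda>k. LINT x|lebesgue. grad w x \<bullet> grad (v k) x) \<longlonglongrightarrow> 0"
      using weak by (simp add: LIM_zero)
    from tendsto_add[OF this vs.mixed_potential_term_vanishes[OF V(1) w]]
    show ?thesis by (simp add: energy_form_def)
  qed
  have Jv: "J_inf Vinf (v k) = energy_form V (u (r k)) (v k) - energy_form V w (v k)
      - (LINT x|lebesgue. (V x - Vinf) * (v k x)\<^sup>2)" for k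
  proof -
    have "energy_form V (u (r k)) (v k) = energy_form V w (v k) + energy_form V (v k) (v k)"
      using energy_form_combination[OF V(1) w v(1) v(1), of 1 k k] by (simp add: v_def)
    moreover have "(LINT x|lebesgue. (V x - Vinf) * (v k x)\<^sup>2) = (LINT x|lebesgue. V x * v k x * v k x - Vinf * (v k x)\<^sup>2)"
      by (simp add: left_diff_distrib power2_eq_square mult.assoc)
    moreover have "\<dots> = (LINT x|lebesgue. V x * v k x * v k x) - Vinf * (LINT x|lebesgue. (v k x)\<^sup>2)"
      using energy_form_integrable(2)[OF V(1) v(1) v(1), of k k] H1_integrable_square[OF v(1), of k] by simp
    ultimately show ?thesis
      by (simp add: J_inf_eq[OF v(1)] energy_form_def power2_norm_eq_inner)
  qed
  obtain K where K: "\<And>k. (LINT x|lebesgue. (v k x)\<^sup>2 + \<bar>v k x\<bar> powr q) \<le> K"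
    using vs.energy_bound by blast
  have Y: "0 \<le> Y k" "Y k \<le> K" for k
    using H1_integrable_powr(2)[OF v(1)[of k], of "\<lambda>_. pinf"] K[of k] pinf pp_less pinf2
    by (auto simp: Y_def)
  \<comment> \<open>A further subsequence makes the two integrals converge; \<open>X\<close> then has the same limit as \<open>Y\<close>.\<close>
  have "bounded (range (\<lambda>k. (A k, Y k)))"
  proof (rule bounded_subset)
    show "bounded ({pm..pp} \<times> {0..K})" by (intro bounded_Times bounded_closed_interval)
    show "range (\<lambda>k. (A k, Y k)) \<subseteq> {pm..pp} \<times> {0..K}" using A Y by auto
  qed
  then obtain z s where s: "strict_mono (s :: nat \<Rightarrow> nat)" "((\<lambda>k. (A k, Y k)) \<circ> s) \<longlonglongrightarrow> z"
    using bounded_imp_convergent_subsequence by blast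
  define A0 Y0 where "A0 = fst z" and "Y0 = snd z"
  have As: "(\<lambda>k. A (s k)) \<longlonglongrightarrow> A0" and Ys: "(\<lambda>k. Y (s k)) \<longlonglongrightarrow> Y0"
    using tendsto_fst[OF s(2)] tendsto_snd[OF s(2)] by (simp_all add: A0_def Y0_def o_def)
  note sub = LIMSEQ_subseq_LIMSEQ[OF _ s(1), unfolded o_def]
  have A0: "pm \<le> A0" using A(1) by (intro LIMSEQ_le_const[OF As]) auto
  have Y0: "0 \<le> Y0" using Y(1) by (intro LIMSEQ_le_const[OF Ys]) auto
  have "A0 > 0" using A0 pm_gt by linarith
  have Xs: "(\<lambda>k. X (s k)) \<longlonglongrightarrow> Y0"
    using tendsto_add[OF sub[OF XZ] tendsto_add[OF sub[OF ZY] Ys]] by simp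
  have "Y0 \<le> A0"
  proof -
    have "A0 - Y0 = (LINT x|lebesgue. \<bar>w x\<bar> powr p x)"
      by (rule LIMSEQ_unique[OF tendsto_diff[OF As Xs] sub[OF AX]])
    moreover have "0 \<le> (LINT x|lebesgue. \<bar>w x\<bar> powr p x)" by simp
    ultimately show ?thesis by linarith
  qed
  have Elim: "(\<lambda>k. J_inf Vinf (v (s k))) \<longlonglongrightarrow> c * Y0 / A0"
  proof -
    have e: "energy_form V (u (r k)) (v k) = (L (r k) (v k) + \<mu> (r k) * (X k / A k)) / 2" for k
      using L_eq[OF v(1), of k k] by (simp add: X_def)
    have "(\<lambda>k. (L (r (s k)) (v (s k)) + \<mu> (r (s k)) * (X (s k) / A (s k))) / 2) \<longlonglongrightarrow> (0 + 2 * c * (Y0 / A0)) / 2"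
      using \<open>A0 > 0\<close> by (intro tendsto_intros sub[OF mu] Xs As sub[OF L_small[OF v(1) S]]) auto
    then have "(\<lambda>k. energy_form V (u (r (s k))) (v (s k))) \<longlonglongrightarrow> c * Y0 / A0"
      unfolding e by simp
    from tendsto_diff[OF tendsto_diff[OF this sub[OF wv]] sub[OF vs.potential_term_vanishes[OF V]]]
    show ?thesis unfolding Jv by simp
  qed
  have "Y0 = 0"
  proof (rule ccontr)
    assume "Y0 \<noteq> 0"
    then have "Y0 > 0" using Y0 by simp
    have "\<forall>\<^sub>F k in sequentially. Y (s k) > 0" by (rule order_tendstoD(1)[OF Ys \<open>Y0 > 0\<close>])
    then obtain k0 where k0: "\<And>k. k \<ge> k0 \<Longrightarrow> Y (s k) > 0" by (auto simp: eventually_sequentially)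
    let ?l = "lambda1_inf TYPE('a) Vinf pinf"
    have "?l * (Y (s k) / pinf) powr (2 / pinf) \<le> J_inf Vinf (v (s k))" if "k \<ge> k0" for k
      using lambda1_inf_bound(1)[OF v(1) \<open>Vinf > 0\<close>, of pinf "s k"] k0[OF that] pinf2 by (simp add: Y_def)
    moreover have "(\<lambda>k. ?l * (Y (s k) / pinf) powr (2 / pinf)) \<longlonglongrightarrow> ?l * (Y0 / pinf) powr (2 / pinf)"
      using \<open>Y0 > 0\<close> pinf2 by (intro tendsto_intros Ys) auto
    ultimately have "?l * (Y0 / pinf) powr (2 / pinf) \<le> c * Y0 / A0"
      by (intro LIMSEQ_le[OF _ Elim]) auto
    moreover have "?l \<ge> 0"
      using lambda1_inf_bound(2)[OF v(1) \<open>Vinf > 0\<close>, of pinf "s k0"] k0[of k0] pinf2 by (simp add: Y_def)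
    ultimately have "(pm / pinf) powr (2 / pinf) * ?l \<le> c"
      using \<open>Y0 > 0\<close> \<open>Y0 \<le> A0\<close> A0 pm_gt pinf2 by (intro energy_threshold[of Y0 A0 pm pinf ?l c]) auto
    then show False using c by linarith
  qed
  then have J0: "(\<lambda>k. J_inf Vinf (v (s k))) \<longlonglongrightarrow> 0" using Elim by simp
  define m' where "m' = min 1 Vinf"
  have "m' > 0" using \<open>Vinf > 0\<close> by (simp add: m'_def)
  have "(\<lambda>k. H1_norm (v (s k))) \<longlonglongrightarrow> 0"
  proof (rule Lim_null_comparison)
    show "\<forall>\<^sub>F k in sequentially. norm (H1_norm (v (s k))) \<le> sqrt (J_inf Vinf (v (s k)) / m')"
    proof (intro always_eventually allI)
      fix k
      have "m' * (H1_norm (v (s k)))\<^sup>2 \<le> J_inf Vinf (v (s k))"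
        unfolding m'_def by (rule H1_norm_le_J_inf[OF v(1)])
      then have "(H1_norm (v (s k)))\<^sup>2 \<le> J_inf Vinf (v (s k)) / m'"
        using \<open>m' > 0\<close> by (simp add: pos_le_divide_eq mult.commute)
      then show "norm (H1_norm (v (s k))) \<le> sqrt (J_inf Vinf (v (s k)) / m')"
        using H1_norm_nonneg[of "v (s k)"] by (simp add: real_le_rsqrt)
    qed
    have "(\<lambda>k. sqrt (J_inf Vinf (v (s k)) / m')) \<longlonglongrightarrow> sqrt (0 / m')"
      using \<open>m' > 0\<close> by (intro tendsto_intros J0) auto
    then show "(\<lambda>k. sqrt (J_inf Vinf (v (s k)) / m')) \<longlonglongrightarrow> 0" by simp
  qed
  then have "(\<lambda>k. H1_norm (\<lambda>x. u ((r \<circ> s) k) x - w x)) \<longlonglongrightarrow> 0"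
    by (simp add: v_def[abs_def])
  then show "\<exists>r w. strict_mono r \<and> w \<in> H1 \<and> (\<lambda>k. H1_norm (\<lambda>x. u (r k) x - w x)) \<longlonglongrightarrow> 0"
    using strict_mono_o[OF r s(1)] w by blast
qed

theorem theorem3p5:
  fixes V p :: "'a::euclidean_space \<Rightarrow> real" and Vinf pinf :: real
  assumes "DIM('a) \<ge> 2"
    and "V \<in> L_infinity"
    and "ess_tendsto_at_infinity V Vinf"
    and "Vinf > 0"
    and "continuous_on UNIV p"
    and "bdd_below (range p)"
    and "2 < (INF x. p x)"
    and "bdd_above (range p)"
    and "ereal (SUP x. p x) < critical_exponent DIM('a)"
    and "(p \<longlongrightarrow> pinf) at_infinity"
  shows "\<forall>c::real. c < ((INF x. p x) / pinf) powr (2 / pinf) * lambda1_inf TYPE('a) Vinf pinf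
           \<longrightarrow> PS_condition V p c"
proof -
  obtain q where q: "ereal (SUP x. p x) < ereal q" "ereal q < critical_exponent DIM('a)"
    using ereal_dense2[OF assms(9)] by blast
  have ge: "(INF x. p x) \<le> p x" and le: "p x \<le> (SUP x. p x)" for x
    using assms(6,8) by (auto intro: cINF_lower cSUP_upper)
  interpret variable_exponent p "INF x. p x" "SUP x. p x" q
    using assms(1,5,7) q ge le by unfold_locales auto
  have nt: "at_infinity \<noteq> (bot :: 'a filter)" by (rule trivial_limit_at_infinity)
  have "(INF x. p x) \<le> pinf" "pinf \<le> (SUP x. p x)"
    using tendsto_lowerbound[OF assms(10) always_eventually nt] tendsto_upperbound[OF assms(10) always_eventually nt] ge le
    by auto
  then show ?thesis
    using PS_condition_below_threshold[OF assms(2,3,4,10)] by blast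
qed

end
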